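(* The Semipaired Domination Decision problem is NP-complete for GP$5$-graphs; that is, given a GP$5$-graph $G$ and a positive integer $k$, deciding whether $G$ has a semipaired dominating set of cardinality at most $k$ is NP-complete.
   Context: All graphs are finite and simple. A graph $G=(V,E)$ is a GP$5$-graph if it is obtained from a connected graph $H=(V_H,E_H)$ with $V_H=\{v_1,\dots,v_n\}$ by setting $V=V_H\cup\{a_i,b_i,c_i,d_i,e_i : i\in[n]\}$ (new distinct vertices) and $E=E_H\cup\{v_ic_i,\,c_ib_i,\,c_id_i,\,b_ia_i,\,d_ie_i : i\in[n]\}$. For a graph with no isolated vertices, a semipaired dominating set is a set $D$ of vertices such that every vertex outside $D$ has a neighbor in $D$ and $D$ can be partitioned into $2$-element subsets $\{u,v\}$ with the distance between $u$ and $v$ in the graph at most $2$. *)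

theory Defs
  imports
    "HOL-Computational_Algebra.Polynomial"
    "HOL-Library.Disjoint_Sets"
    "Graph_Theory.Graph_Theory"
begin

section \<open>Deterministic multi-tape Turing machines\<close>

text \<open>
  States and symbols are initial segments of the natural numbers; symbol 0 is the blank.
  The transition function maps a state and the list of symbols under the heads to a new
  state and, for each tape, the symbol to be written and the head movement.
\<close>

record tm =
  tapes :: nat
  symbols :: nat
  states :: nat
  start :: nat
  acc :: nat
  rej :: nat
  delta :: "nat \<Rightarrow> nat list \<Rightarrow> nat \<times> (nat \<times> int) list"

text \<open>
  Symbols 1 and 2 are the two input letters. Tape 0 holds the input, tape 1 holds the
  certificate (for verifiers) or receives the output (for computed functions), and there
  may be any number of further work tapes.
\<close>

definition wf_tm :: "tm \<Rightarrow> bool" where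
  "wf_tm M \<longleftrightarrow>
     2 \<le> tapes M \<and> 3 \<le> symbols M \<and>
     start M < states M \<and> acc M < states M \<and> rej M < states M \<and> acc M \<noteq> rej M \<and>
     (\<forall>q syms. q < states M \<and> length syms = tapes M \<and> set syms \<subseteq> {..<symbols M} \<longrightarrow>
        fst (delta M q syms) < states M \<and>
        length (snd (delta M q syms)) = tapes M \<and>
        set (snd (delta M q syms)) \<subseteq> {..<symbols M} \<times> {-1, 0, 1})"

text \<open>
  A configuration consists of the state and, for each tape (infinite in both directions),
  the head position and the contents.
\<close>

type_synonym config = "nat \<times> (int \<times> (int \<Rightarrow> nat)) list"

fun tm_step :: "tm \<Rightarrow> config \<Rightarrow> config" where
  "tm_step M (q, ts) =
     (if q = acc M \<or> q = rej M then (q, ts)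
      else let (q', acts) = delta M q (map (\<lambda>(h, t). t h) ts)
           in (q', map2 (\<lambda>(h, t) (s, m). (h + m, t(h := s))) ts acts))"

definition word_tape :: "bool list \<Rightarrow> int \<Rightarrow> nat" where
  "word_tape w = (\<lambda>i. if 0 \<le> i \<and> i < int (length w) then if w ! nat i then 2 else 1 else 0)"

definition tm_init :: "tm \<Rightarrow> bool list list \<Rightarrow> config" where
  "tm_init M ws =
     (start M, map (\<lambda>i. (0, word_tape (if i < length ws then ws ! i else []))) [0..<tapes M])"

definition tm_run :: "tm \<Rightarrow> bool list list \<Rightarrow> nat \<Rightarrow> config" where
  "tm_run M ws t = (tm_step M ^^ t) (tm_init M ws)"

text \<open>
  Halting configurations are fixed points of \<^const>\<open>tm_step\<close>, so a machine halts within
  \<open>t\<close> steps iff it is in a halting state after exactly \<open>t\<close> steps.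
\<close>

definition halts_within :: "tm \<Rightarrow> bool list list \<Rightarrow> nat \<Rightarrow> bool" where
  "halts_within M ws t \<longleftrightarrow> fst (tm_run M ws t) \<in> {acc M, rej M}"

definition accepts :: "tm \<Rightarrow> bool list list \<Rightarrow> bool" where
  "accepts M ws \<longleftrightarrow> (\<exists>t. fst (tm_run M ws t) = acc M)"

section \<open>NP-completeness\<close>

definition in_NP :: "bool list set \<Rightarrow> bool" where
  "in_NP L \<longleftrightarrow>
     (\<exists>M (p :: nat poly) (r :: nat poly). wf_tm M \<and>
        (\<forall>x y. length y \<le> poly p (length x) \<longrightarrow> halts_within M [x, y] (poly r (length x))) \<and>
        (\<forall>x. x \<in> L \<longleftrightarrow> (\<exists>y. length y \<le> poly p (length x) \<and> accepts M [x, y])))"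

definition polytime_computable :: "(bool list \<Rightarrow> bool list) \<Rightarrow> bool" where
  "polytime_computable f \<longleftrightarrow>
     (\<exists>M (p :: nat poly). wf_tm M \<and>
        (\<forall>x. fst (tm_run M [x] (poly p (length x))) = acc M \<and>
             snd (snd (tm_run M [x] (poly p (length x))) ! 1) = word_tape (f x)))"

text \<open>
  A decision problem is given by the set \<open>I\<close> of (encoded) instances and the set \<open>Y\<close> of
  (encoded) yes-instances. Membership in NP refers to the language \<open>Y\<close>, so strings that do
  not encode an instance have to be rejected; reductions have to produce instances.
\<close>

definition NP_hard :: "bool list set \<Rightarrow> bool list set \<Rightarrow> bool" where
  "NP_hard I Y \<longleftrightarrow>
     (\<forall>L. in_NP L \<longrightarrow>
        (\<exists>f. polytime_computable f \<and> (\<forall>x. f x \<in> I \<and> (x \<in> L \<longleftrightarrow> f x \<in> Y))))"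

definition NP_complete :: "bool list set \<Rightarrow> bool list set \<Rightarrow> bool" where
  "NP_complete I Y \<longleftrightarrow> Y \<subseteq> I \<and> in_NP Y \<and> NP_hard I Y"

section \<open>Semipaired domination in GP5-graphs\<close>

text \<open>
  Finite simple graphs are the digraphs satisfying \<^const>\<open>pair_graph\<close>: finite, loopless, and
  with a symmetric set of arcs. The index set is \<open>{..<n}\<close>.
\<close>

definition gp5_graph :: "'a pair_pre_digraph \<Rightarrow> bool" where
  "gp5_graph G \<longleftrightarrow>
     (\<exists>(H :: 'a pair_pre_digraph) n v a b c d e.
        pair_graph H \<and> connected (with_proj H) \<and> pverts H = v ` {..<n} \<and>
        distinct (concat (map (\<lambda>f. map f [0..<n]) [v, a, b, c, d, e])) \<and>
        pverts G = pverts H \<union> (\<Union>i<n. {a i, b i, c i, d i, e i}) \<and>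
        (let E = (\<Union>i<n. {(v i, c i), (c i, b i), (c i, d i), (b i, a i), (d i, e i)})
         in parcs G = parcs H \<union> E \<union> E\<inverse>))"

definition gdist :: "'a pair_pre_digraph \<Rightarrow> 'a \<Rightarrow> 'a \<Rightarrow> ereal" where
  "gdist G u v = wf_digraph.\<mu> (with_proj G) (\<lambda>_. 1) u v"

definition dominating_set :: "'a pair_pre_digraph \<Rightarrow> 'a set \<Rightarrow> bool" where
  "dominating_set G D \<longleftrightarrow>
     D \<subseteq> pverts G \<and> (\<forall>w \<in> pverts G - D. \<exists>u \<in> D. (w, u) \<in> parcs G)"

definition semipaired_dominating_set :: "'a pair_pre_digraph \<Rightarrow> 'a set \<Rightarrow> bool" where
  "semipaired_dominating_set G D \<longleftrightarrow>
     dominating_set G D \<and>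
     (\<exists>P. partition_on D P \<and> (\<forall>S \<in> P. \<exists>u v. S = {u, v} \<and> u \<noteq> v \<and> gdist G u v \<le> 2))"

section \<open>The decision problem\<close>

text \<open>Binary representation, least significant bit first.\<close>

fun bits :: "nat \<Rightarrow> bool list" where
  "bits k = (if k = 0 then [] else odd k # bits (k div 2))"

declare bits.simps [simp del]

text \<open>
  An instance is a graph with vertex set \<open>{..<n}\<close> and a number \<open>k\<close>. It is encoded by \<open>n\<close> in
  unary, a separator, the adjacency matrix row by row, and \<open>k\<close> in binary.
\<close>

definition encode :: "nat pair_pre_digraph \<Rightarrow> nat \<Rightarrow> bool list" where
  "encode G k =
     (let n = card (pverts G)
      in replicate n True @ [False] @
         map (\<lambda>ij. ij \<in> parcs G) (List.product [0..<n] [0..<n]) @ bits k)"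

definition gp5_instance :: "nat pair_pre_digraph \<Rightarrow> nat \<Rightarrow> bool" where
  "gp5_instance G k \<longleftrightarrow> gp5_graph G \<and> (\<exists>n. pverts G = {..<n}) \<and> 0 < k"

definition semipaired_domination_instances :: "bool list set" where
  "semipaired_domination_instances = {encode G k | G k. gp5_instance G k}"

definition semipaired_domination_yes :: "bool list set" where
  "semipaired_domination_yes =
     {encode G k | G k. gp5_instance G k \<and>
        (\<exists>D. semipaired_dominating_set G D \<and> card D \<le> k)}"

subsection \<open>Basic properties\<close>

lemma pair_graph_gp5:
  assumes "gp5_graph G"
  shows "pair_graph G"
proof -
  obtain H n v a b c d e where H: "pair_graph H" and V: "pverts H = v ` {..<n}"
    and dist: "distinct (concat (map (\<lambda>f. map f [0..<n]) [v, a, b, c, d, e]))"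
    and vG: "pverts G = pverts H \<union> (\<Union>i<n. {a i, b i, c i, d i, e i})"
    and eG: "parcs G = parcs H
      \<union> (\<Union>i<n. {(v i, c i), (c i, b i), (c i, d i), (b i, a i), (d i, e i)})
      \<union> (\<Union>i<n. {(v i, c i), (c i, b i), (c i, d i), (b i, a i), (d i, e i)})\<inverse>"
    using assms unfolding gp5_graph_def Let_def by (elim exE conjE) (rule that, assumption+)
  interpret H: pair_graph H by (fact H)
  define E where "E = (\<Union>i<n. {(v i, c i), (c i, b i), (c i, d i), (b i, a i), (d i, e i)})"
  have eG': "parcs G = parcs H \<union> (E \<union> E\<inverse>)"
    unfolding eG E_def by (simp only: Un_assoc)
  have disj: "f i \<noteq> g i" if "i < n" "f ` {0..<n} \<inter> g ` {0..<n} = {}" for f g :: "nat \<Rightarrow> 'a" and i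
    using that by (metis atLeastLessThan_iff disjoint_iff imageI zero_le)
  have ne: "v i \<noteq> c i" "c i \<noteq> b i" "c i \<noteq> d i" "b i \<noteq> a i" "d i \<noteq> e i" if "i < n" for i
    by (rule disj[OF that]; use dist in \<open>simp add: Int_Un_distrib Int_commute\<close>)+
  have sub: "E \<subseteq> pverts G \<times> pverts G" "parcs H \<subseteq> pverts G \<times> pverts G"
    using H.in_arcsD1 H.in_arcsD2 by (auto simp: E_def vG V)
  then have sub': "parcs G \<subseteq> pverts G \<times> pverts G" unfolding eG' by blast
  then have wf: "fst x \<in> pverts G \<and> snd x \<in> pverts G" if "x \<in> parcs G" for x
    using that by (metis mem_Times_iff subsetD)
  have sym: "sym (parcs G)"
  proof -
    have "sym (parcs H)" using H.pair_sym_arcs by (simp add: symmetric_def)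
    then show ?thesis unfolding eG' by (intro sym_Un sym_Un_converse)
  qed
  have "\<forall>x\<in>E. fst x \<noteq> snd x" using ne by (simp add: E_def)
  then have irr: "fst x \<noteq> snd x" if "x \<in> parcs G" for x
    using that H.pair_no_loops[of x] unfolding eG' by (cases x) force
  have fin: "finite (pverts G)" unfolding vG V by auto
  then have "finite (parcs G)" using sub' by (meson finite_SigmaI finite_subset)
  with wf sym irr fin show ?thesis
    by unfold_locales (auto simp: symmetric_def)
qed

lemma bits_inject: "bits k = bits l \<longleftrightarrow> k = l"
proof (induction k arbitrary: l rule: less_induct)
  case (less k)
  show ?case
  proof (cases "k = 0 \<or> l = 0")
    case True
    then show ?thesis by (auto simp: bits.simps[of k] bits.simps[of l] bits.simps[of 0])
  next
    case False
    have "bits k = bits l \<longleftrightarrow> odd k = odd l \<and> k div 2 = l div 2"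
      using False less.IH[of "k div 2" "l div 2"] by (simp add: bits.simps[of k] bits.simps[of l])
    also have "\<dots> \<longleftrightarrow> k = l"
      by (metis even_two_times_div_two odd_two_times_div_two_succ)
    finally show ?thesis .
  qed
qed

lemma encode_inject:
  assumes "gp5_instance G k" "gp5_instance G' k'"
  shows "encode G k = encode G' k' \<longleftrightarrow> G = G' \<and> k = k'"
proof
  assume eq: "encode G k = encode G' k'"
  obtain n n' where n: "pverts G = {..<n}" "pverts G' = {..<n'}"
    using assms unfolding gp5_instance_def by auto
  interpret G: pair_graph G using assms pair_graph_gp5 by (auto simp: gp5_instance_def)
  interpret G': pair_graph G' using assms pair_graph_gp5 by (auto simp: gp5_instance_def)
  have tw: "takeWhile id (encode G k) = replicate n True"
      "takeWhile id (encode G' k') = replicate n' True"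
    using n by (simp_all add: encode_def takeWhile_append)
  then have nn: "n' = n" using eq by (metis length_replicate)
  have m: "map (\<lambda>ij. ij \<in> parcs G) (List.product [0..<n] [0..<n])
      = map (\<lambda>ij. ij \<in> parcs G') (List.product [0..<n] [0..<n])" and "bits k = bits k'"
    using eq n nn by (simp_all add: encode_def)
  have "(i, j) \<in> parcs G \<longleftrightarrow> (i, j) \<in> parcs G'" if "i < n" "j < n" for i j
  proof -
    have "(i, j) \<in> set (List.product [0..<n] [0..<n])" using that by simp
    then show ?thesis using m by (simp only: map_eq_conv)
  qed
  then have "parcs G = parcs G'"
    using G.in_arcsD1 G.in_arcsD2 G'.in_arcsD1 G'.in_arcsD2
    unfolding n nn set_eq_iff split_paired_All lessThan_iff by meson
  then show "G = G' \<and> k = k'" using n nn \<open>bits k = bits k'\<close> by (simp add: bits_inject)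
qed simp

end

theory Submission
  imports Defs
begin

text \<open>
  Both halves of the theorem need concrete Turing machines. They are obtained once and for all from
  a small expression language over an input word and a certificate: constants, symbol lookup,
  addition, truncated subtraction and bounded sums. Values and evaluation times are polynomially
  bounded, and a machine that represents a counter by a head position evaluates expressions. Since
  bounded quantifiers and division are expressible, a verifier is just a first-order formula with
  bounded quantifiers, and a reduction is a formula for the bits of its output.

  Membership: the certificate consists of three functions on the vertices, namely a numbering that
  exhibits the GP5-structure, ranks witnessing that \<open>H\<close> is connected, and an involution
  whose non-fixed points form the paired dominating set.

  Hardness: an accepting run of a machine for a language in NP is a table obeying local rules,
  that is, a solution of a constraint satisfaction problem of arity 6 over a fixed finite domain. This becomes a set cover instance, and
  the set cover instance becomes a graph \<open>H\<close> whose sets form a clique, with every element adjacent to the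
  sets containing it. In the GP5-graph over \<open>H\<close> with \<open>n\<close> vertices, each index needs one of \<open>a, b\<close> and one
  of \<open>d, e\<close>, and choosing \<open>b\<close> and \<open>d\<close>, at distance 2, is optimal; what remains of the budget \<open>2 * n + k\<close>
  has to dominate \<open>H\<close>, and the clique allows an even number of sets to be paired arbitrarily.
\<close>

section \<open>Structured programs on Turing machine tapes\<close>

text \<open>One expression has to describe the instances for inputs of all lengths; the arbitrary
  machine enters it only through a finite table of codes. Bounded sums keep all values polynomial,
  which rules out exponentiation and the value of a number \<open>k\<close> given in binary. Hence
  powers of two are recognised by their divisors, and the verifier never computes \<open>k\<close>
  but excludes every number smaller than the size of the dominating set. In a run the heads of
  different tapes stand at unrelated positions, so no fixed window of cells shows all scanned
  symbols. A global value per time step makes them available everywhere, and each column checks it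
  against its own heads. A rule thus ties together three neighbouring columns, the middle one at the
  next time, and two successive global values: this is the arity 6. A paired set has even size, so
  the number of sets in a cover must be even. It equals the number of variables of the constraint
  problem, which is even since the table has odd width and each row has one additional
  variable.\<close>

type_synonym tapes = "(int \<times> (int \<Rightarrow> nat)) list"

abbreviation scan :: "tapes \<Rightarrow> nat \<Rightarrow> nat" where
  "scan ts t \<equiv> snd (ts ! t) (fst (ts ! t))"

datatype com =
    Skip
  | Mv nat int
  | Wr nat nat
  | Seq com com (infixr ";;" 60)
  | If nat nat com com
  | While nat nat com

text \<open>The step counts are those of the compiled code: one step for a test, one for the jump
  over the else-branch, one for the jump back to the head of a loop.\<close>

inductive bs :: "com \<Rightarrow> tapes \<Rightarrow> nat \<Rightarrow> tapes \<Rightarrow> bool" where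
  Skip: "bs Skip ts 0 ts"
| Mv: "bs (Mv t d) ts 1 (ts[t := (fst (ts ! t) + d, snd (ts ! t))])"
| Wr: "bs (Wr t s) ts 1 (ts[t := (fst (ts ! t), (snd (ts ! t))(fst (ts ! t) := s))])"
| Seq: "bs c ts k ts' \<Longrightarrow> bs c' ts' k' ts'' \<Longrightarrow> bs (c ;; c') ts (k + k') ts''"
| IfT: "scan ts t = s \<Longrightarrow> bs c ts k ts' \<Longrightarrow> bs (If t s c c') ts (k + 2) ts'"
| IfF: "scan ts t \<noteq> s \<Longrightarrow> bs c' ts k ts' \<Longrightarrow> bs (If t s c c') ts (k + 1) ts'"
| WhileF: "scan ts t = s \<Longrightarrow> bs (While t s c) ts 1 ts"
| WhileT: "scan ts t \<noteq> s \<Longrightarrow> bs c ts k ts' \<Longrightarrow> bs (While t s c) ts' k' ts'' \<Longrightarrow>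
    bs (While t s c) ts (k + k' + 2) ts''"

text \<open>An instruction looks at one tape only: its symbol determines what to write, the move,
  and the address of the next instruction.\<close>

type_synonym instr = "nat \<times> (nat \<Rightarrow> nat \<times> int \<times> nat)"

section \<open>Compilation of structured programs\<close>

fun clen :: "com \<Rightarrow> nat" where
  "clen Skip = 0"
| "clen (Mv t d) = 1"
| "clen (Wr t s) = 1"
| "clen (c ;; c') = clen c + clen c'"
| "clen (If t s c c') = clen c + clen c' + 2"
| "clen (While t s c) = clen c + 2"

text \<open>Jump targets are absolute, so the start address \<open>i\<close> is passed along. An
  instruction on tape 0 that writes back what it reads serves as an unconditional jump.\<close>

fun compile :: "com \<Rightarrow> nat \<Rightarrow> instr list" where
  "compile Skip i = []"
| "compile (Mv t d) i = [(t, \<lambda>z. (z, d, i + 1))]"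
| "compile (Wr t s) i = [(t, \<lambda>z. (s, 0, i + 1))]"
| "compile (c ;; c') i = compile c i @ compile c' (i + clen c)"
| "compile (If t s c c') i =
    (t, \<lambda>z. (z, 0, if z = s then i + 1 else i + 2 + clen c)) # compile c (i + 1) @
    (0, \<lambda>z. (z, 0, i + 2 + clen c + clen c')) # compile c' (i + 2 + clen c)"
| "compile (While t s c) i =
    (t, \<lambda>z. (z, 0, if z = s then i + 2 + clen c else i + 1)) # compile c (i + 1) @
    [(0, \<lambda>z. (z, 0, i))]"

lemma length_compile [simp]: "length (compile c i) = clen c"
  by (induction c arbitrary: i) auto

fun good_com :: "nat \<Rightarrow> com \<Rightarrow> bool" where
  "good_com K Skip = True"
| "good_com K (Mv t d) = (t < K \<and> d \<in> {-1, 0, 1})"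
| "good_com K (Wr t s) = (t < K \<and> s < 3)"
| "good_com K (c ;; c') = (good_com K c \<and> good_com K c')"
| "good_com K (If t s c c') = (t < K \<and> good_com K c \<and> good_com K c')"
| "good_com K (While t s c) = (t < K \<and> good_com K c)"

definition good_instr :: "nat \<Rightarrow> nat \<Rightarrow> instr \<Rightarrow> bool" where
  "good_instr K L I \<longleftrightarrow> fst I < K \<and>
     (\<forall>z<3. fst (snd I z) < 3 \<and> fst (snd (snd I z)) \<in> {-1, 0, 1} \<and> snd (snd (snd I z)) \<le> L)"

lemma good_compile:
  "good_com K c \<Longrightarrow> 0 < K \<Longrightarrow> i + clen c \<le> L \<Longrightarrow> I \<in> set (compile c i) \<Longrightarrow> good_instr K L I"
proof (induction c arbitrary: i)
  case (Seq c1 c2)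
  from Seq.prems consider "I \<in> set (compile c1 i)" | "I \<in> set (compile c2 (i + clen c1))" by auto
  then show ?case
    by cases (use Seq.prems Seq.IH(1)[of i] Seq.IH(2)[of "i + clen c1"] in auto)
next
  case (If t s c1 c2)
  from If.prems consider "I = (t, \<lambda>z. (z, 0, if z = s then i + 1 else i + 2 + clen c1))"
    | "I \<in> set (compile c1 (i + 1))" | "I = (0, \<lambda>z. (z, 0, i + 2 + clen c1 + clen c2))"
    | "I \<in> set (compile c2 (i + 2 + clen c1))" by auto
  then show ?case
    by cases (use If.prems If.IH(1)[of "i + 1"] If.IH(2)[of "i + 2 + clen c1"]
      in \<open>auto simp: good_instr_def\<close>)
next
  case (While t s c)
  from While.prems consider "I = (t, \<lambda>z. (z, 0, if z = s then i + 2 + clen c else i + 1))"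
    | "I \<in> set (compile c (i + 1))" | "I = (0, \<lambda>z. (z, 0, i))" by auto
  then show ?case
    by cases (use While.prems While.IH[of "i + 1"] in \<open>auto simp: good_instr_def\<close>)
qed (auto simp: good_instr_def)

text \<open>The last instruction branches on tape \<open>r\<close>: symbol 1 leads to the second halting state.\<close>

definition prog :: "com \<Rightarrow> nat \<Rightarrow> instr list" where
  "prog c r = compile c 0 @
    [(r, \<lambda>z. (z, 0, if z = 1 then clen c + 2 else clen c + 1))]"

definition machine :: "nat \<Rightarrow> com \<Rightarrow> nat \<Rightarrow> tm" where
  "machine K c r = \<lparr> tapes = K, symbols = 3, states = clen c + 3, start = 0,
     acc = clen c + 1, rej = clen c + 2,
     delta = (\<lambda>q syms. if q < clen c + 1 then
        (let (t, f) = prog c r ! q; (s, d, q') = f (syms ! t)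
         in (q', (map (\<lambda>z. (z, 0)) syms)[t := (s, d)]))
       else (q, map (\<lambda>z. (z, 0)) syms)) \<rparr>"

lemma machine_simps [simp]:
  "tapes (machine K c r) = K" "symbols (machine K c r) = 3"
  "states (machine K c r) = clen c + 3" "start (machine K c r) = 0"
  "acc (machine K c r) = clen c + 1" "rej (machine K c r) = clen c + 2"
  by (simp_all add: machine_def)

lemma wf_machine:
  assumes "2 \<le> K" "good_com K c" "r < K"
  shows "wf_tm (machine K c r)"
proof -
  have *: "good_instr K (clen c + 2) I" if "I \<in> set (prog c r)" for I
    using that assms good_compile[of K c 0 "clen c + 2" I]
    by (auto simp: prog_def) (auto simp: good_instr_def)
  have "fst (delta (machine K c r) q syms) < clen c + 3 \<and>
      length (snd (delta (machine K c r) q syms)) = K \<and>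
      set (snd (delta (machine K c r) q syms)) \<subseteq> {..<3} \<times> {-1, 0, 1}"
    if q: "q < clen c + 3" and syms: "length syms = K" "set syms \<subseteq> {..<3}" for q syms
  proof (cases "q < clen c + 1")
    case True
    obtain t f where I: "prog c r ! q = (t, f)" by (cases "prog c r ! q")
    have "prog c r ! q \<in> set (prog c r)" using True by (intro nth_mem) (simp add: prog_def)
    then have g: "good_instr K (clen c + 2) (t, f)" using * I by metis
    then have t: "t < K" by (simp add: good_instr_def)
    then have z: "syms ! t < 3" using syms nth_mem by fastforce
    obtain s d q' where f: "f (syms ! t) = (s, d, q')" by (rule prod_cases3)
    have "fst (f (syms ! t)) < 3 \<and> fst (snd (f (syms ! t))) \<in> {-1, 0, 1} \<and>
        snd (snd (f (syms ! t))) \<le> clen c + 2"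
      using g z by (simp add: good_instr_def)
    then have "s < 3" "d \<in> {-1,0,1}" "q' \<le> clen c + 2"
      using f by auto
    moreover have "set ((map (\<lambda>z. (z, 0)) syms)[t := (s, d)]) \<subseteq>
        insert (s, d) (set (map (\<lambda>z. (z, 0::int)) syms))"
      by (rule set_update_subset_insert)
    moreover have "delta (machine K c r) q syms = (q', (map (\<lambda>z. (z, 0)) syms)[t := (s, d)])"
      using True I f by (simp add: machine_def)
    moreover have "set (map (\<lambda>z. (z, 0::int)) syms) \<subseteq> {..<3} \<times> {-1, 0, 1}"
      using syms by auto
    ultimately show ?thesis using syms by auto
  next
    case False
    then show ?thesis using that by (auto simp: machine_def)
  qed
  then show ?thesis using assms by (simp add: wf_tm_def)
qed

lemma step_machine:
  assumes "q < clen c + 1" "prog c r ! q = (t, f)" "t < K" "length ts = K"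
    "f (scan ts t) = (s, d, q')"
  shows "tm_step (machine K c r) (q, ts) =
     (q', ts[t := (fst (ts ! t) + d, (snd (ts ! t))(fst (ts ! t) := s))])"
proof -
  let ?a = "(map (\<lambda>z. (z, 0)) (map (\<lambda>(h, t). t h) ts))[t := (s, d)]"
  have d: "delta (machine K c r) q (map (\<lambda>(h, t). t h) ts) = (q', ?a)"
    using assms by (simp add: machine_def case_prod_beta)
  have "map2 (\<lambda>(h, t) (s, m). (h + m, t(h := s))) ts ?a =
      ts[t := (fst (ts ! t) + d, (snd (ts ! t))(fst (ts ! t) := s))]"
    using assms(3,4)
    by (intro nth_equalityI) (auto simp: nth_list_update case_prod_beta)
  then show ?thesis using assms(1) d by simp
qed

lemma step_jump:
  assumes "prog c r ! q = (t, \<lambda>z. (z, 0, j z))" "q < clen c + 1" "t < K" "length ts = K"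
  shows "tm_step (machine K c r) (q, ts) = (j (scan ts t), ts)"
  using step_machine[OF assms(2,1,3,4) refl] by simp

declare tm_step.simps [simp del]

lemma length_bs: "bs c ts k ts' \<Longrightarrow> length ts' = length ts"
  by (induction rule: bs.induct) auto

definition code_at :: "instr list \<Rightarrow> nat \<Rightarrow> instr list \<Rightarrow> bool" where
  "code_at P i Q \<longleftrightarrow> (\<exists>us vs. P = us @ Q @ vs \<and> length us = i)"

lemma code_at_append:
  assumes "code_at P i (Q @ R)"
  shows "code_at P i Q" "code_at P (i + length Q) R"
proof -
  from assms obtain us vs where *: "P = us @ (Q @ R) @ vs" "length us = i"
    by (auto simp: code_at_def)
  then have "P = us @ Q @ (R @ vs)" "P = (us @ Q) @ R @ vs" "length (us @ Q) = i + length Q"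
    by simp_all
  then show "code_at P i Q" "code_at P (i + length Q) R"
    unfolding code_at_def using *(2) by blast+
qed

lemma code_at_Cons:
  assumes "code_at P i (I # R)"
  shows "P ! i = I" "code_at P (i + 1) R"
proof -
  from assms show "P ! i = I" by (auto simp: code_at_def)
  show "code_at P (i + 1) R" using assms code_at_append(2)[of P i "[I]" R] by simp
qed

lemma funpow_trans: "(f ^^ m) a = b \<Longrightarrow> (f ^^ n) b = d \<Longrightarrow> (f ^^ (m + n)) a = d"
  by (subst add.commute) (simp add: funpow_add)

text \<open>The machine state is the address of the current instruction.\<close>

lemma bs_simulation:
  assumes "bs c ts k ts'" "code_at (prog c0 r) i (compile c i)" "i + clen c \<le> clen c0"
    "good_com K c" "length ts = K" "0 < K"
  shows "(tm_step (machine K c0 r) ^^ k) (i, ts) = (i + clen c, ts')"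
  using assms
proof (induction arbitrary: i rule: bs.induct)
  case (Skip ts)
  then show ?case by simp
next
  case (Mv t d ts)
  from code_at_Cons(1)[OF Mv.prems(1)[unfolded compile.simps]] Mv.prems
  show ?case by (simp add: step_machine)
next
  case (Wr t s ts)
  from code_at_Cons(1)[OF Wr.prems(1)[unfolded compile.simps]] Wr.prems
  show ?case by (simp add: step_machine)
next
  case (Seq c ts k ts' c' k' ts'')
  note code = code_at_append[OF Seq.prems(1)[unfolded compile.simps], unfolded length_compile]
  have "(tm_step (machine K c0 r) ^^ k) (i, ts) = (i + clen c, ts')"
    using Seq.prems by (intro Seq.IH(1) code) auto
  moreover have "(tm_step (machine K c0 r) ^^ k') (i + clen c, ts') =
      (i + clen c + clen c', ts'')"
    using Seq.prems length_bs[OF Seq.hyps(1)] by (intro Seq.IH(2) code) auto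
  ultimately show ?case using funpow_trans by (fastforce simp: add.assoc)
next
  case (IfT ts t s c k ts' c')
  let ?M = "tm_step (machine K c0 r)"
  note code0 = code_at_Cons[OF IfT.prems(1)[unfolded compile.simps]]
  note code1 = code_at_append[OF code0(2), unfolded length_compile]
  note code2 = code_at_Cons[OF code1(2)]
  have 1: "(?M ^^ 1) (i, ts) = (i + 1, ts)"
    using IfT.prems IfT.hyps(1) by (simp add: step_jump[OF code0(1)])
  have 2: "(?M ^^ k) (i + 1, ts) = (i + 1 + clen c, ts')"
    using IfT.prems by (intro IfT.IH code1) auto
  have 3: "(?M ^^ 1) (i + 1 + clen c, ts') = (i + 2 + clen c + clen c', ts')"
    using IfT.prems length_bs[OF IfT.hyps(2)] step_jump[OF code2(1), where K=K and ts=ts'] by simp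
  show ?case using funpow_trans[OF 1 funpow_trans[OF 2 3]] by (simp add: ac_simps)
next
  case (IfF ts t s c' k ts' c)
  let ?M = "tm_step (machine K c0 r)"
  note code0 = code_at_Cons[OF IfF.prems(1)[unfolded compile.simps]]
  note code1 = code_at_append[OF code0(2), unfolded length_compile]
  note code2 = code_at_Cons[OF code1(2)]
  have 1: "(?M ^^ 1) (i, ts) = (i + 2 + clen c, ts)"
    using IfF.prems IfF.hyps(1) by (simp add: step_jump[OF code0(1)])
  have "code_at (prog c0 r) (i + 2 + clen c) (compile c' (i + 2 + clen c))"
    using code2(2) by simp
  then have 2: "(?M ^^ k) (i + 2 + clen c, ts) = (i + 2 + clen c + clen c', ts')"
    using IfF.prems by (intro IfF.IH) auto
  show ?case using funpow_trans[OF 1 2] by (simp add: ac_simps)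
next
  case (WhileF ts t s c)
  note code0 = code_at_Cons[OF WhileF.prems(1)[unfolded compile.simps]]
  show ?case using WhileF by (simp add: step_jump[OF code0(1)])
next
  case (WhileT ts t s c k ts' k' ts'')
  let ?M = "tm_step (machine K c0 r)"
  note code0 = code_at_Cons[OF WhileT.prems(1)[unfolded compile.simps]]
  note code1 = code_at_append[OF code0(2), unfolded length_compile]
  note code2 = code_at_Cons[OF code1(2)]
  have 1: "(?M ^^ 1) (i, ts) = (i + 1, ts)"
    using WhileT.prems WhileT.hyps(1) by (simp add: step_jump[OF code0(1)])
  have 2: "(?M ^^ k) (i + 1, ts) = (i + 1 + clen c, ts')"
    using WhileT.prems by (intro WhileT.IH(1) code1) auto
  have 3: "(?M ^^ 1) (i + 1 + clen c, ts') = (i, ts')"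
    using WhileT.prems length_bs[OF WhileT.hyps(2)] step_jump[OF code2(1), where K=K and ts=ts'] by simp
  have 4: "(?M ^^ k') (i, ts') = (i + clen (While t s c), ts'')"
    using WhileT.prems length_bs[OF WhileT.hyps(2)] by (intro WhileT.IH(2)) auto
  show ?case using funpow_trans[OF 1 funpow_trans[OF 2 funpow_trans[OF 3 4]]] by (simp add: ac_simps)
qed

lemma tm_step_halted: "q \<in> {acc M, rej M} \<Longrightarrow> (tm_step M ^^ k) (q, ts) = (q, ts)"
  by (induction k) (auto simp: tm_step.simps)

text \<open>\<open>k < n\<close> leaves one step for the final branch; all further steps are idle,
  since the state is then halting. So a time bound need not be exact.\<close>

lemma machine_run:
  assumes "bs c (snd (tm_init (machine K c r) ws)) k ts'" "good_com K c" "2 \<le> K" "r < K" "k < n"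
  shows "tm_run (machine K c r) ws n =
    (if scan ts' r = 1 then rej (machine K c r) else acc (machine K c r), ts')"
proof -
  let ?M = "machine K c r"
  define ts where "ts = snd (tm_init ?M ws)"
  have l: "length ts = K" "tm_init ?M ws = (0, ts)" by (simp_all add: ts_def tm_init_def)
  have bs: "bs c ts k ts'" using assms by (simp add: ts_def)
  have "code_at (prog c r) 0 (compile c 0)"
    unfolding code_at_def prog_def by (rule exI[of _ "[]"]) simp
  from bs_simulation[OF bs this] have 1: "(tm_step ?M ^^ k) (0, ts) = (clen c, ts')"
    using assms l by simp
  have 2: "(tm_step ?M ^^ 1) (clen c, ts') = (if scan ts' r = 1 then rej ?M else acc ?M, ts')"
    using assms l length_bs[OF bs] by (simp add: step_machine prog_def nth_append)
  have 3: "(tm_step ?M ^^ (n - k - 1)) (if scan ts' r = 1 then rej ?M else acc ?M, ts') =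
      (if scan ts' r = 1 then rej ?M else acc ?M, ts')"
    by (intro tm_step_halted) auto
  show ?thesis using funpow_trans[OF 1 funpow_trans[OF 2 3]] assms(5) l by (simp add: tm_run_def)
qed

section \<open>Counter programs evaluating bounded-sum expressions\<close>

text \<open>Only an upper bound on the time is recorded, so that branches of different cost can be
  joined and estimates rounded up.\<close>

definition runs :: "com \<Rightarrow> tapes \<Rightarrow> tapes \<Rightarrow> nat \<Rightarrow> bool" where
  "runs c s s' n \<longleftrightarrow> (\<exists>k\<le>n. bs c s k s')"

lemma runs_Seq: "runs c s s' n \<Longrightarrow> runs c' s' s'' n' \<Longrightarrow> runs (c ;; c') s s'' (n + n')"
  unfolding runs_def by (meson add_mono bs.Seq)

lemma runs_Skip: "runs Skip s s 0"
  unfolding runs_def by (meson bs.Skip le_refl)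

lemma runs_eq: "runs c s s' n \<Longrightarrow> s' = t \<Longrightarrow> n \<le> m \<Longrightarrow> runs c s t m"
  unfolding runs_def using order_trans by blast

lemma runs_If:
  assumes "scan s t = z \<Longrightarrow> runs c s s' n" "scan s t \<noteq> z \<Longrightarrow> runs c' s s' n"
  shows "runs (If t z c c') s s' (n + 2)"
proof (cases "scan s t = z")
  case True
  then show ?thesis using assms(1) bs.IfT[OF True] unfolding runs_def by fastforce
next
  case False
  then obtain k where "k \<le> n" "bs c' s k s'" using assms(2) unfolding runs_def by auto
  then show ?thesis using bs.IfF[OF False] unfolding runs_def by (meson add_mono one_le_numeral)
qed

text \<open>The register \<open>r\<close> is the head position on tape \<open>r + 2\<close>; symbol 1 marks position 0.\<close>

definition mark :: "int \<Rightarrow> nat" where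
  "mark = (\<lambda>i. if i = 0 then 1 else 0)"

type_synonym tape = "int \<times> (int \<Rightarrow> nat)"

definition cf :: "tape \<Rightarrow> tape \<Rightarrow> nat \<Rightarrow> (nat \<Rightarrow> nat) \<Rightarrow> tapes" where
  "cf A B K \<rho> = A # B # map (\<lambda>r. (int (\<rho> r), mark)) [0..<K]"

lemma cf_cong: "\<rho> = \<rho>' \<Longrightarrow> cf A B K \<rho> = cf A B K \<rho>'"
  by simp

definition inc :: "nat \<Rightarrow> com" where "inc r = Mv (r + 2) 1"
definition dec :: "nat \<Rightarrow> com" where "dec r = Mv (r + 2) (- 1)"
definition loop :: "nat \<Rightarrow> com \<Rightarrow> com" where "loop r c = While (r + 2) 1 c"
definition ifz :: "nat \<Rightarrow> com \<Rightarrow> com \<Rightarrow> com" where "ifz r c c' = If (r + 2) 1 c c'"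

lemma good_com_regs [simp]:
  "good_com K (inc r) \<longleftrightarrow> r + 2 < K" "good_com K (dec r) \<longleftrightarrow> r + 2 < K"
  "good_com K (loop r c) \<longleftrightarrow> r + 2 < K \<and> good_com K c"
  "good_com K (ifz r c c') \<longleftrightarrow> r + 2 < K \<and> good_com K c \<and> good_com K c'"
  by (auto simp: inc_def dec_def loop_def ifz_def)

lemma cf_nth: "r < K \<Longrightarrow> cf A B K \<rho> ! (r + 2) = (int (\<rho> r), mark)"
  "cf A B K \<rho> ! 0 = A" "cf A B K \<rho> ! 1 = B"
  by (simp_all add: cf_def)

lemma cf_update: "r < K \<Longrightarrow> (cf A B K \<rho>)[r + 2 := (int v, mark)] = cf A B K (\<rho>(r := v))"
  "(cf A B K \<rho>)[0 := A'] = cf A' B K \<rho>" "(cf A B K \<rho>)[1 := B'] = cf A B' K \<rho>"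
  by (auto simp: cf_def intro!: nth_equalityI simp: nth_list_update)

lemma runs_Mv: "s' = s[t := (fst (s ! t) + d, snd (s ! t))] \<Longrightarrow> runs (Mv t d) s s' 1"
  unfolding runs_def using bs.Mv by blast

lemma runs_inc: "r < K \<Longrightarrow> runs (inc r) (cf A B K \<rho>) (cf A B K (\<rho>(r := Suc (\<rho> r)))) 1"
  unfolding inc_def using cf_update(1)[of r K A B \<rho> "Suc (\<rho> r)"]
  by (intro runs_Mv) (simp only: cf_nth(1) fst_conv snd_conv of_nat_Suc add.commute)

lemma runs_dec: "r < K \<Longrightarrow> 0 < \<rho> r \<Longrightarrow> runs (dec r) (cf A B K \<rho>) (cf A B K (\<rho>(r := \<rho> r - 1))) 1"
  unfolding dec_def using cf_update(1)[of r K A B \<rho> "\<rho> r - 1"]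
  by (intro runs_Mv) (simp only: cf_nth(1) fst_conv snd_conv int_ops(6), simp)

lemma runs_Mv0: "runs (Mv 0 d) (cf A B K \<rho>) (cf (fst A + d, snd A) B K \<rho>) 1"
  by (intro runs_Mv) (simp only: cf_nth cf_update)

lemma runs_Mv1: "runs (Mv 1 d) (cf A B K \<rho>) (cf A (fst B + d, snd B) K \<rho>) 1"
  by (intro runs_Mv) (simp only: cf_nth cf_update)

lemma scan_cf: "r < K \<Longrightarrow> scan (cf A B K \<rho>) (r + 2) = (if \<rho> r = 0 then 1 else 0)"
  by (simp only: cf_nth mark_def fst_conv snd_conv of_nat_eq_0_iff)

lemma runs_ifz:
  assumes "r < K" "\<rho> r = 0 \<Longrightarrow> runs c (cf A B K \<rho>) s' n"
    "0 < \<rho> r \<Longrightarrow> runs c' (cf A B K \<rho>) s' n"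
  shows "runs (ifz r c c') (cf A B K \<rho>) s' (n + 2)"
  unfolding ifz_def
  by (rule runs_If; subst (asm) scan_cf) (use assms in \<open>auto split: if_splits\<close>)

lemma runs_While:
  assumes "\<And>j. j < n \<Longrightarrow> scan (S j) t \<noteq> z" "scan (S n) t = z"
    "\<And>j. j < n \<Longrightarrow> runs c (S j) (S (Suc j)) (T j)"
  shows "runs (While t z c) (S 0) (S n) (1 + (\<Sum>j<n. T j + 2))"
  using assms
proof (induction n arbitrary: S T)
  case 0
  then show ?case using bs.WhileF[of "S 0" t z c] unfolding runs_def by (intro exI[of _ 1]) simp
next
  case (Suc n)
  have "runs (While t z c) (S 1) (S (Suc n)) (1 + (\<Sum>j<n. T (Suc j) + 2))"
    using Suc.IH[of "\<lambda>j. S (Suc j)" "\<lambda>j. T (Suc j)"] Suc.prems by simp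
  then obtain k' where k': "k' \<le> 1 + (\<Sum>j<n. T (Suc j) + 2)" "bs (While t z c) (S 1) k' (S (Suc n))"
    unfolding runs_def by blast
  obtain k where k: "k \<le> T 0" "bs c (S 0) k (S 1)"
    using Suc.prems(3)[of 0] unfolding runs_def by auto
  have "scan (S 0) t \<noteq> z" using Suc.prems(1) by simp
  from bs.WhileT[OF this k(2) k'(2)] show ?case
    unfolding runs_def using k(1) k'(1)
    by (intro exI[of _ "k + k' + 2"]) (auto simp only: sum.lessThan_Suc_shift o_apply)
qed

lemma runs_loop:
  assumes "r < K" "\<And>j. j \<le> n \<Longrightarrow> \<rho> j r = n - j"
    "\<And>j. j < n \<Longrightarrow> runs c (cf (A j) (B j) K (\<rho> j)) (cf (A (Suc j)) (B (Suc j)) K (\<rho> (Suc j))) (T j)"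
  shows "runs (loop r c) (cf (A 0) (B 0) K (\<rho> 0)) (cf (A n) (B n) K (\<rho> n)) (1 + (\<Sum>j<n. T j + 2))"
  unfolding loop_def
  by (rule runs_While[where S = "\<lambda>j. cf (A j) (B j) K (\<rho> j)"])
    (use assms(2,3) in \<open>auto simp only: scan_cf[OF assms(1)] split: if_splits\<close>)

section \<open>Elementary register programs\<close>

definition clear :: "nat \<Rightarrow> com" where
  "clear r = loop r (dec r)"

definition move :: "nat \<Rightarrow> nat \<Rightarrow> com" where
  "move r d = loop r (dec r ;; inc d)"

text \<open>Reading a register empties it, so the value is written twice, and the second copy, in
  the scratch register \<open>d + 1\<close>, is moved back.\<close>

definition copy :: "nat \<Rightarrow> nat \<Rightarrow> com" where
  "copy r d = loop r (dec r ;; inc d ;; inc (d + 1)) ;; move (d + 1) r"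

lemma runs_clear:
  assumes "r < K"
  shows "runs (clear r) (cf A B K \<rho>) (cf A B K (\<rho>(r := 0))) (1 + 3 * \<rho> r)"
proof -
  have "runs (clear r) (cf A B K (\<rho>(r := \<rho> r - 0))) (cf A B K (\<rho>(r := \<rho> r - \<rho> r))) (1 + (\<Sum>j<\<rho> r. 1 + 2))"
    unfolding clear_def
    by (rule runs_loop[where \<rho> = "\<lambda>j. \<rho>(r := \<rho> r - j)"])
      (use assms in \<open>auto intro!: runs_eq[OF runs_dec]\<close>)
  then have "runs (clear r) (cf A B K \<rho>) (cf A B K (\<rho>(r := 0))) (1 + (\<Sum>j<\<rho> r. 1 + 2))"
    by simp
  then show ?thesis by (rule runs_eq) auto
qed

lemma runs_move:
  assumes "r < K" "d < K" "r \<noteq> d"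
  shows "runs (move r d) (cf A B K \<rho>) (cf A B K (\<rho>(r := 0, d := \<rho> d + \<rho> r))) (1 + 4 * \<rho> r)"
proof -
  have "runs (move r d) (cf A B K (\<rho>(r := \<rho> r - 0, d := \<rho> d + 0)))
      (cf A B K (\<rho>(r := \<rho> r - \<rho> r, d := \<rho> d + \<rho> r))) (1 + (\<Sum>j<\<rho> r. 2 + 2))"
    unfolding move_def
    by (rule runs_loop[where \<rho> = "\<lambda>j. \<rho>(r := \<rho> r - j, d := \<rho> d + j)"])
      (use assms in \<open>auto intro!: runs_eq[OF runs_Seq[OF runs_dec runs_inc]] cf_cong\<close>)
  then show ?thesis using assms by (simp add: mult.commute)
qed

lemma runs_copy:
  assumes "r < d" "d + 1 < K" "\<rho> d = 0" "\<rho> (d + 1) = 0"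
  shows "runs (copy r d) (cf A B K \<rho>) (cf A B K (\<rho>(d := \<rho> r))) (2 + 9 * \<rho> r)"
proof -
  have 1: "runs (loop r (dec r ;; inc d ;; inc (d + 1))) (cf A B K (\<rho>(r := \<rho> r - 0, d := 0, d + 1 := 0)))
      (cf A B K (\<rho>(r := \<rho> r - \<rho> r, d := \<rho> r, d + 1 := \<rho> r))) (1 + (\<Sum>j<\<rho> r. 3 + 2))"
    by (rule runs_loop[where \<rho> = "\<lambda>j. \<rho>(r := \<rho> r - j, d := j, d + 1 := j)"])
      (use assms in \<open>auto intro!: runs_eq[OF runs_Seq[OF runs_dec runs_Seq[OF runs_inc runs_inc]]] cf_cong\<close>)
  have 0: "\<rho>(r := \<rho> r - 0, d := 0, d + 1 := 0) = \<rho>" using assms by auto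
  show ?thesis unfolding copy_def
    by (rule runs_eq[OF runs_Seq[OF 1[unfolded 0] runs_move]])
      (use assms in \<open>auto intro!: cf_cong\<close>)
qed

text \<open>The flag \<^const>\<open>True\<close> of \<open>Len\<close> and \<open>Rd\<close> selects the second word.\<close>

datatype exp =
    Var nat
  | One
  | Len bool
  | Rd bool exp
  | Add exp exp
  | Sub exp exp
  | Sum exp exp

definition sy :: "bool list \<Rightarrow> nat \<Rightarrow> nat" where
  "sy w i = (if i < length w then if w ! i then 2 else 1 else 0)"

lemma word_tape_sy: "word_tape w (int i) = sy w i"
  by (simp add: word_tape_def sy_def)

text \<open>Variables are de Bruijn indices; only bounded sums bind them.\<close>

fun ev :: "bool list \<Rightarrow> bool list \<Rightarrow> (nat \<Rightarrow> nat) \<Rightarrow> exp \<Rightarrow> nat" where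
  "ev x y E (Var i) = E i"
| "ev x y E One = 1"
| "ev x y E (Len b) = length (if b then y else x)"
| "ev x y E (Rd b e) = sy (if b then y else x) (ev x y E e)"
| "ev x y E (Add e1 e2) = ev x y E e1 + ev x y E e2"
| "ev x y E (Sub e1 e2) = ev x y E e1 - ev x y E e2"
| "ev x y E (Sum e1 e2) = (\<Sum>i<ev x y E e1. ev x y (case_nat i E) e2)"

text \<open>\<open>ce vs d e\<close> leaves the value of \<open>e\<close> in register \<open>d\<close>, using only registers from \<open>d\<close> on,
  all of which must be 0 before. The list \<open>vs\<close> holds the registers of the variables.\<close>

fun ce :: "nat list \<Rightarrow> nat \<Rightarrow> exp \<Rightarrow> com" where
  "ce vs d (Var i) = (if i < length vs then copy (vs ! i) d else Skip)"
| "ce vs d One = inc d"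
| "ce vs d (Len b) = copy (if b then 1 else 0) d"
| "ce vs d (Rd b e) = (let t = if b then 1 else 0 in
    ce vs (d + 1) e ;; loop (d + 1) (dec (d + 1) ;; inc (d + 2) ;; Mv t 1) ;;
    If t 1 (inc d) (If t 2 (inc d ;; inc d) Skip) ;;
    loop (d + 2) (dec (d + 2) ;; Mv t (-1)))"
| "ce vs d (Add e1 e2) = ce vs d e1 ;; ce vs (d + 1) e2 ;; move (d + 1) d"
| "ce vs d (Sub e1 e2) = ce vs d e1 ;; ce vs (d + 1) e2 ;;
    loop (d + 1) (dec (d + 1) ;; ifz d Skip (dec d))"
| "ce vs d (Sum e1 e2) = ce vs (d + 1) e1 ;;
    loop (d + 1) (dec (d + 1) ;; ce ((d + 2) # vs) (d + 3) e2 ;; move (d + 3) d ;; inc (d + 2)) ;;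
    clear (d + 2)"

fun nregs :: "exp \<Rightarrow> nat" where
  "nregs (Rd b e) = nregs e + 3"
| "nregs (Add e1 e2) = nregs e1 + nregs e2 + 2"
| "nregs (Sub e1 e2) = nregs e1 + nregs e2 + 2"
| "nregs (Sum e1 e2) = nregs e1 + nregs e2 + 4"
| "nregs e = 2"

text \<open>An upper bound for the time of \<open>ce\<close>. Values occur in it because registers
  are emptied in unit steps.\<close>

fun cost :: "bool list \<Rightarrow> bool list \<Rightarrow> (nat \<Rightarrow> nat) \<Rightarrow> exp \<Rightarrow> nat" where
  "cost x y E (Var i) = 2 + 9 * E i"
| "cost x y E One = 1"
| "cost x y E (Len b) = 2 + 9 * length (if b then y else x)"
| "cost x y E (Rd b e) = cost x y E e + 8 + 9 * ev x y E e"
| "cost x y E (Add e1 e2) = cost x y E e1 + cost x y E e2 + 1 + 4 * ev x y E e2"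
| "cost x y E (Sub e1 e2) = cost x y E e1 + cost x y E e2 + 1 + 6 * ev x y E e2"
| "cost x y E (Sum e1 e2) = cost x y E e1 + 2 + 3 * ev x y E e1 +
    (\<Sum>i<ev x y E e1. cost x y (case_nat i E) e2 + 5 + 4 * ev x y (case_nat i E) e2)"

lemma good_com_ce:
  "set vs \<subseteq> {..<d} \<Longrightarrow> 2 \<le> d \<Longrightarrow> d + nregs e + 2 \<le> K \<Longrightarrow> good_com K (ce vs d e)"
proof (induction e arbitrary: vs d)
  case (Var i)
  then have "i < length vs \<Longrightarrow> vs ! i < d" by (meson lessThan_iff nth_mem subsetD)
  then show ?case using Var by (auto simp: copy_def move_def)
next
  case (Rd b e)
  then have "good_com K (ce vs (d + 1) e)" by (intro Rd.IH) auto
  then show ?case using Rd.prems by (auto simp: Let_def)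
next
  case (Add e1 e2)
  then have "good_com K (ce vs d e1)" "good_com K (ce vs (d + 1) e2)" by (auto intro!: Add.IH)
  then show ?case using Add.prems by (auto simp: move_def)
next
  case (Sub e1 e2)
  then have "good_com K (ce vs d e1)" "good_com K (ce vs (d + 1) e2)" by (auto intro!: Sub.IH)
  then show ?case using Sub.prems by auto
next
  case (Sum e1 e2)
  have "insert (d + 2) (set vs) \<subseteq> {..<d + 3}"
    using order_trans[OF Sum.prems(1), of "{..<d + 3}"] by auto
  then have "good_com K (ce vs (d + 1) e1)" "good_com K (ce ((d + 2) # vs) (d + 3) e2)"
    using Sum.prems by (auto intro!: Sum.IH)
  then show ?case using Sum.prems by (auto simp: move_def clear_def)
qed (auto simp: copy_def move_def)

text \<open>To look up a symbol, the head walks as many cells as the index says while register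
  \<open>d + 2\<close> counts them; the second loop spends this count on walking back and so
  restores the tapes.\<close>

lemma runs_shift:
  fixes t :: nat and A B :: tape
  defines "X \<equiv> \<lambda>j. if t = 0 then (fst A + int j, snd A) else A"
    and "Y \<equiv> \<lambda>j. if t = 0 then B else (fst B + int j, snd B)"
  assumes "t \<le> 1" "d + 2 < K" "\<rho> (d + 2) = 0"
  shows "runs (loop (d + 1) (dec (d + 1) ;; inc (d + 2) ;; Mv t 1)) (cf A B K \<rho>)
      (cf (X (\<rho> (d + 1))) (Y (\<rho> (d + 1))) K (\<rho>(d + 1 := 0, d + 2 := \<rho> (d + 1)))) (1 + 5 * \<rho> (d + 1))"
    and "runs (loop (d + 2) (dec (d + 2) ;; Mv t (- 1)))
      (cf (X n) (Y n) K (\<rho>(d + 2 := n))) (cf A B K \<rho>) (1 + 4 * n)"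
proof -
  let ?n = "\<rho> (d + 1)"
  have mv: "runs (Mv t 1) (cf (X j) (Y j) K \<rho>) (cf (X (Suc j)) (Y (Suc j)) K \<rho>) 1"
    "runs (Mv t (- 1)) (cf (X (Suc j)) (Y (Suc j)) K \<rho>) (cf (X j) (Y j) K \<rho>) 1" for j \<rho>
    using assms(3) runs_Mv0 runs_Mv1 unfolding X_def Y_def
    by (auto intro!: runs_eq[OF runs_Mv0] runs_eq[OF runs_Mv1[unfolded One_nat_def]] simp: le_Suc_eq ac_simps)
  have "runs (loop (d + 1) (dec (d + 1) ;; inc (d + 2) ;; Mv t 1))
      (cf (X 0) (Y 0) K (\<rho>(d + 1 := ?n - 0, d + 2 := 0)))
      (cf (X ?n) (Y ?n) K (\<rho>(d + 1 := ?n - ?n, d + 2 := ?n))) (1 + (\<Sum>j<?n. 3 + 2))"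
  proof (rule runs_loop[where \<rho> = "\<lambda>j. \<rho>(d + 1 := ?n - j, d + 2 := j)"])
    fix j assume j: "j < ?n"
    show "runs (dec (d + 1) ;; inc (d + 2) ;; Mv t 1)
        (cf (X j) (Y j) K (\<rho>(d + 1 := ?n - j, d + 2 := j)))
        (cf (X (Suc j)) (Y (Suc j)) K (\<rho>(d + 1 := ?n - Suc j, d + 2 := Suc j))) 3"
      by (rule runs_eq[OF runs_Seq[OF runs_dec runs_Seq[OF runs_inc mv(1)]]])
        (use assms j in \<open>auto intro!: cf_cong\<close>)
  qed (use assms in auto)
  moreover have XY: "X 0 = A" "Y 0 = B" by (simp_all add: X_def Y_def)
  ultimately show "runs (loop (d + 1) (dec (d + 1) ;; inc (d + 2) ;; Mv t 1)) (cf A B K \<rho>)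
      (cf (X ?n) (Y ?n) K (\<rho>(d + 1 := 0, d + 2 := ?n))) (1 + 5 * ?n)"
    using assms(5) by (simp add: fun_upd_idem mult.commute)
  have "runs (loop (d + 2) (dec (d + 2) ;; Mv t (- 1)))
      (cf (X (n - 0)) (Y (n - 0)) K (\<rho>(d + 2 := n - 0)))
      (cf (X (n - n)) (Y (n - n)) K (\<rho>(d + 2 := n - n))) (1 + (\<Sum>j<n. 2 + 2))"
  proof (rule runs_loop[where A = "\<lambda>j. X (n - j)" and B = "\<lambda>j. Y (n - j)" and \<rho> = "\<lambda>j. \<rho>(d + 2 := n - j)"])
    fix j assume j: "j < n"
    then have "n - j = Suc (n - Suc j)" by simp
    show "runs (dec (d + 2) ;; Mv t (- 1)) (cf (X (n - j)) (Y (n - j)) K (\<rho>(d + 2 := n - j)))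
        (cf (X (n - Suc j)) (Y (n - Suc j)) K (\<rho>(d + 2 := n - Suc j))) 2"
      unfolding \<open>n - j = Suc (n - Suc j)\<close>
      by (rule runs_eq[OF runs_Seq[OF runs_dec mv(2)]]) (use assms in auto)
  qed (use assms in auto)
  then show "runs (loop (d + 2) (dec (d + 2) ;; Mv t (- 1)))
      (cf (X n) (Y n) K (\<rho>(d + 2 := n))) (cf A B K \<rho>) (1 + 4 * n)"
    using assms(5) by (simp add: fun_upd_idem mult.commute XY)
qed

text \<open>Registers 0 and 1 carry the lengths of the two words, and each lookup returns its head
  to the start, so the tapes look the same before every subexpression. The registers from
  \<open>d\<close> on are scratch space: zero before, and zero afterwards except for the
  result.\<close>

lemma runs_ce:
  assumes A: "\<And>i. snd A (fst A + int i) = sy x i" and B: "\<And>i. snd B (fst B + int i) = sy y i"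
    and "\<rho> 0 = length x" "\<rho> 1 = length y" "2 \<le> d" "\<And>r. d \<le> r \<Longrightarrow> \<rho> r = 0"
    "set vs \<subseteq> {..<d}" "E = (\<lambda>i. if i < length vs then \<rho> (vs ! i) else 0)" "d + nregs e \<le> K"
  shows "runs (ce vs d e) (cf A B K \<rho>) (cf A B K (\<rho>(d := ev x y E e))) (cost x y E e)"
  using assms(3-)
proof (induction e arbitrary: vs d E \<rho>)
  case (Var i)
  show ?case
  proof (cases "i < length vs")
    case True
    then have "vs ! i < d" using Var.prems(5) by (meson lessThan_iff nth_mem subsetD)
    then show ?thesis using True Var.prems
      by (auto intro!: runs_eq[OF runs_copy] cf_cong simp: fun_eq_iff)
  next
    case False
    then show ?thesis using Var.prems
      by (auto intro!: runs_eq[OF runs_Skip] cf_cong simp: fun_eq_iff)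
  qed
next
  case One
  then show ?case by (auto intro!: runs_eq[OF runs_inc] cf_cong simp: fun_eq_iff)
next
  case (Len b)
  then show ?case by (auto intro!: runs_eq[OF runs_copy] cf_cong simp: fun_eq_iff)
next
  case (Rd b e)
  define t :: nat where "t = (if b then 1 else 0)"
  let ?v = "ev x y E e"
  let ?X = "\<lambda>j. if t = 0 then (fst A + int j, snd A) else A"
  let ?Y = "\<lambda>j. if t = 0 then B else (fst B + int j, snd B)"
  let ?w = "sy (if b then y else x) ?v"
  have 1: "runs (ce vs (d + 1) e) (cf A B K \<rho>) (cf A B K (\<rho>(d + 1 := ?v))) (cost x y E e)"
    using Rd.prems by (intro Rd.IH) auto
  have 2: "runs (loop (d + 1) (dec (d + 1) ;; inc (d + 2) ;; Mv t 1)) (cf A B K (\<rho>(d + 1 := ?v)))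
      (cf (?X ?v) (?Y ?v) K (\<rho>(d + 2 := ?v))) (1 + 5 * ?v)"
    by (rule runs_eq[OF runs_shift(1)]) (use Rd.prems in \<open>auto simp: t_def fun_upd_idem fun_upd_twist\<close>)
  have sc: "scan (cf (?X ?v) (?Y ?v) K (\<rho>(d + 2 := ?v))) t = ?w"
    using A B by (simp add: t_def cf_nth(2) cf_nth(3)[unfolded One_nat_def])
  have 3: "runs (If t 1 (inc d) (If t 2 (inc d ;; inc d) Skip))
      (cf (?X ?v) (?Y ?v) K (\<rho>(d + 2 := ?v))) (cf (?X ?v) (?Y ?v) K (\<rho>(d := ?w, d + 2 := ?v))) (4 + 2)"
  proof (rule runs_If, unfold sc)
    assume "?w = 1"
    then show "runs (inc d) (cf (?X ?v) (?Y ?v) K (\<rho>(d + 2 := ?v)))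
        (cf (?X ?v) (?Y ?v) K (\<rho>(d := ?w, d + 2 := ?v))) 4"
      using Rd.prems by (auto intro!: runs_eq[OF runs_inc] cf_cong simp: fun_upd_twist)
  next
    assume n1: "?w \<noteq> 1"
    have "runs (If t 2 (inc d ;; inc d) Skip) (cf (?X ?v) (?Y ?v) K (\<rho>(d + 2 := ?v)))
        (cf (?X ?v) (?Y ?v) K (\<rho>(d := ?w, d + 2 := ?v))) (2 + 2)"
    proof (rule runs_If, unfold sc)
      assume "?w = 2"
      then show "runs (inc d ;; inc d) (cf (?X ?v) (?Y ?v) K (\<rho>(d + 2 := ?v)))
          (cf (?X ?v) (?Y ?v) K (\<rho>(d := ?w, d + 2 := ?v))) 2"
        using Rd.prems by (auto intro!: runs_eq[OF runs_Seq[OF runs_inc runs_inc]]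
            cf_cong simp: fun_upd_twist)
    next
      assume "?w \<noteq> 2"
      then have "?w = 0" using n1 by (auto simp: sy_def split: if_splits)
      then show "runs Skip (cf (?X ?v) (?Y ?v) K (\<rho>(d + 2 := ?v)))
          (cf (?X ?v) (?Y ?v) K (\<rho>(d := ?w, d + 2 := ?v))) 2"
        using Rd.prems by (auto intro!: runs_eq[OF runs_Skip] cf_cong simp: fun_upd_idem)
    qed
    then show "runs (If t 2 (inc d ;; inc d) Skip) (cf (?X ?v) (?Y ?v) K (\<rho>(d + 2 := ?v)))
        (cf (?X ?v) (?Y ?v) K (\<rho>(d := ?w, d + 2 := ?v))) 4" by simp
  qed
  have 4: "runs (loop (d + 2) (dec (d + 2) ;; Mv t (- 1)))
      (cf (?X ?v) (?Y ?v) K (\<rho>(d := ?w, d + 2 := ?v))) (cf A B K (\<rho>(d := ?w))) (1 + 4 * ?v)"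
    by (rule runs_shift(2)) (use Rd.prems in \<open>auto simp: t_def\<close>)
  show ?case unfolding ce.simps Let_def t_def[symmetric]
    by (rule runs_eq[OF runs_Seq[OF 1 runs_Seq[OF 2 runs_Seq[OF 3 4]]]]) (auto simp: fun_upd_def)
next
  case (Add e1 e2)
  have vs: "vs ! i \<noteq> k" if "i < length vs" "d \<le> k" for i k
    using Add.prems(5) that nth_mem by fastforce
  have sub: "set vs \<subseteq> {..<d + k}" for k
    by (rule order_trans[OF Add.prems(5)]) auto
  have 1: "runs (ce vs d e1) (cf A B K \<rho>) (cf A B K (\<rho>(d := ev x y E e1))) (cost x y E e1)"
    using Add.prems by (intro Add.IH) auto
  have 2: "runs (ce vs (d + 1) e2) (cf A B K (\<rho>(d := ev x y E e1)))
      (cf A B K (\<rho>(d := ev x y E e1, d + 1 := ev x y E e2))) (cost x y E e2)"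
    using Add.prems by (intro Add.IH) (auto simp: fun_eq_iff vs sub[of 1, simplified] cong: if_cong)
  show ?case unfolding ce.simps
    by (rule runs_eq[OF runs_Seq[OF 1 runs_Seq[OF 2 runs_move]]])
      (use Add.prems in \<open>auto intro!: cf_cong\<close>)
next
  case (Sub e1 e2)
  have vs: "vs ! i \<noteq> k" if "i < length vs" "d \<le> k" for i k
    using Sub.prems(5) that nth_mem by fastforce
  have sub: "set vs \<subseteq> {..<d + k}" for k
    by (rule order_trans[OF Sub.prems(5)]) auto
  let ?a = "ev x y E e1" and ?b = "ev x y E e2"
  have 1: "runs (ce vs d e1) (cf A B K \<rho>) (cf A B K (\<rho>(d := ?a))) (cost x y E e1)"
    using Sub.prems by (intro Sub.IH) auto
  have 2: "runs (ce vs (d + 1) e2) (cf A B K (\<rho>(d := ?a)))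
      (cf A B K (\<rho>(d := ?a, d + 1 := ?b))) (cost x y E e2)"
    using Sub.prems by (intro Sub.IH) (auto simp: fun_eq_iff vs sub[of 1, simplified] cong: if_cong)
  have 3: "runs (loop (d + 1) (dec (d + 1) ;; ifz d Skip (dec d)))
      (cf A B K (\<rho>(d := ?a - 0, d + 1 := ?b - 0))) (cf A B K (\<rho>(d := ?a - ?b, d + 1 := ?b - ?b)))
      (1 + (\<Sum>j<?b. 4 + 2))"
  proof (rule runs_loop[where \<rho> = "\<lambda>j. \<rho>(d := ?a - j, d + 1 := ?b - j)"])
    fix j assume j: "j < ?b"
    have 0: "runs (dec (d + 1)) (cf A B K (\<rho>(d := ?a - j, d + 1 := ?b - j)))
        (cf A B K (\<rho>(d := ?a - j, d + 1 := ?b - Suc j))) 1"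
      by (rule runs_eq[OF runs_dec]) (use j Sub.prems in auto)
    have "runs (ifz d Skip (dec d)) (cf A B K (\<rho>(d := ?a - j, d + 1 := ?b - Suc j)))
        (cf A B K (\<rho>(d := ?a - Suc j, d + 1 := ?b - Suc j))) (1 + 2)"
      by (rule runs_ifz)
        (use Sub.prems in \<open>auto intro!: runs_eq[OF runs_Skip] runs_eq[OF runs_dec]
          cf_cong\<close>)
    from runs_Seq[OF 0 this] show "runs (dec (d + 1) ;; ifz d Skip (dec d))
        (cf A B K (\<rho>(d := ?a - j, d + 1 := ?b - j)))
        (cf A B K (\<rho>(d := ?a - Suc j, d + 1 := ?b - Suc j))) 4" by (rule runs_eq) auto
  qed (use Sub.prems in auto)
  show ?case unfolding ce.simps
    by (rule runs_eq[OF runs_Seq[OF 1 runs_Seq[OF 2 3[unfolded diff_zero]]]])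
      (use Sub.prems in \<open>auto intro!: cf_cong\<close>)
next
  case (Sum e1 e2)
  have vs: "vs ! i \<noteq> k" if "i < length vs" "d \<le> k" for i k
    using Sum.prems(5) that nth_mem by fastforce
  have sub: "set vs \<subseteq> {..<d + k}" for k
    by (rule order_trans[OF Sum.prems(5)]) auto
  let ?a = "ev x y E e1" and ?b = "\<lambda>i. ev x y (case_nat i E) e2"
  let ?c = "\<lambda>i. cost x y (case_nat i E) e2"
  \<comment> \<open>Loop invariant: \<open>d\<close> holds the partial sum, \<open>d + 1\<close> the
    number of outstanding rounds, \<open>d + 2\<close> the summation variable.\<close>
  let ?\<rho> = "\<lambda>j. \<rho>(d := (\<Sum>i<j. ?b i), d + 1 := ?a - j, d + 2 := j)"
  have 1: "runs (ce vs (d + 1) e1) (cf A B K \<rho>) (cf A B K (\<rho>(d + 1 := ?a))) (cost x y E e1)"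
    using Sum.prems by (intro Sum.IH) auto
  have 2: "runs (loop (d + 1) (dec (d + 1) ;; ce ((d + 2) # vs) (d + 3) e2 ;; move (d + 3) d ;; inc (d + 2)))
      (cf A B K (?\<rho> 0)) (cf A B K (?\<rho> ?a)) (1 + (\<Sum>i<?a. ?c i + 3 + 4 * ?b i + 2))"
  proof (rule runs_loop[where \<rho> = ?\<rho>])
    fix j assume j: "j < ?a"
    let ?\<rho>1 = "\<rho>(d := (\<Sum>i<j. ?b i), d + 1 := ?a - Suc j, d + 2 := j)"
    have a: "runs (dec (d + 1)) (cf A B K (?\<rho> j)) (cf A B K ?\<rho>1) 1"
      by (rule runs_eq[OF runs_dec]) (use j Sum.prems in \<open>auto intro!: cf_cong\<close>)
    have b: "runs (ce ((d + 2) # vs) (d + 3) e2) (cf A B K ?\<rho>1) (cf A B K (?\<rho>1(d + 3 := ?b j))) (?c j)"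
    proof (rule Sum.IH(2))
      show "case_nat j E = (\<lambda>i. if i < length ((d + 2) # vs) then ?\<rho>1 (((d + 2) # vs) ! i) else 0)"
        (is "_ = ?R")
      proof
        fix i
        show "case_nat j E i = ?R i"
          by (cases i) (simp_all add: vs Sum.prems(6) cong: if_cong)
      qed
    qed (use Sum.prems sub[of 3] in auto)
    show "runs (dec (d + 1) ;; ce ((d + 2) # vs) (d + 3) e2 ;; move (d + 3) d ;; inc (d + 2))
       (cf A B K (?\<rho> j)) (cf A B K (?\<rho> (Suc j))) (?c j + 3 + 4 * ?b j)"
      by (rule runs_eq[OF runs_Seq[OF a runs_Seq[OF b runs_Seq[OF runs_move runs_inc]]]])
        (use Sum.prems in \<open>auto intro!: cf_cong\<close>)
  qed (use Sum.prems in auto)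
  have 0: "?\<rho> 0 = \<rho>(d + 1 := ?a)" using Sum.prems by auto
  show ?case unfolding ce.simps
    by (rule runs_eq[OF runs_Seq[OF 1 runs_Seq[OF 2[unfolded 0] runs_clear]]])
      (use Sum.prems in \<open>auto intro!: cf_cong simp: sum.distrib\<close>)
qed

section \<open>Polynomial time\<close>

lemma tm_run_halted:
  assumes "fst (tm_run M ws t) \<in> {acc M, rej M}" "t \<le> n"
  shows "tm_run M ws n = tm_run M ws t"
proof -
  have "(tm_step M ^^ (n - t)) (tm_run M ws t) = tm_run M ws t"
    using tm_step_halted[OF assms(1), of "n - t" "snd (tm_run M ws t)"] by simp
  moreover have "tm_run M ws n = (tm_step M ^^ (n - t)) (tm_run M ws t)"
    using funpow_add[of "n - t" t "tm_step M"] assms(2) by (simp add: tm_run_def)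
  ultimately show ?thesis by simp
qed

definition bounded_by :: "exp \<Rightarrow> nat poly \<Rightarrow> bool" where
  "bounded_by e q \<longleftrightarrow> (\<forall>x y E m. length x \<le> m \<longrightarrow> length y \<le> m \<longrightarrow> (\<forall>i. E i \<le> m) \<longrightarrow>
     ev x y E e \<le> poly q m \<and> cost x y E e \<le> poly q m)"

lemma bounded_byD:
  assumes "bounded_by e q" "length x \<le> m" "length y \<le> m" "\<forall>i. E i \<le> m"
  shows "ev x y E e \<le> poly q m \<and> cost x y E e \<le> poly q m"
  using assms by (auto simp: bounded_by_def)

text \<open>The summation variable stays below the value of its bound, so the body is evaluated in
  an environment bounded by \<open>m\<close> plus a polynomial in \<open>m\<close>. Polynomials are
  closed under this composition and under multiplication by the number of rounds.\<close>

lemma ex_bounded_by: "\<exists>q. bounded_by e q"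
proof (induction e)
  case (Var i)
  show ?case
  proof (unfold bounded_by_def, intro exI[of _ "[:2, 9:]"] allI impI)
    fix x y :: "bool list" and E :: "nat \<Rightarrow> nat" and m assume "\<forall>i. E i \<le> m"
    then have "E i \<le> m" by blast
    then show "ev x y E (Var i) \<le> poly [:2, 9:] m \<and> cost x y E (Var i) \<le> poly [:2, 9:] m"
      by simp
  qed
next
  case One
  show ?case unfolding bounded_by_def by (rule exI[of _ "[:1:]"]) auto
next
  case (Len b)
  show ?case unfolding bounded_by_def by (rule exI[of _ "[:2, 9:]"]) auto
next
  case (Rd b e)
  then obtain q where "bounded_by e q" by blast
  note q = bounded_byD[OF this]
  have sy: "sy w i \<le> 8" for w i by (auto simp: sy_def)
  show ?case
  proof (unfold bounded_by_def, intro exI[of _ "[:8:] + [:10:] * q"] allI impI)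
    fix x y :: "bool list" and E :: "nat \<Rightarrow> nat" and m assume *: "length x \<le> m" "length y \<le> m" "\<forall>i. E i \<le> m"
    have P: "poly ([:8:] + [:10:] * q) m = 8 + 10 * poly q m" by simp
    show "ev x y E (Rd b e) \<le> poly ([:8:] + [:10:] * q) m \<and>
        cost x y E (Rd b e) \<le> poly ([:8:] + [:10:] * q) m"
      using q[OF *] sy[of "if b then y else x" "ev x y E e"] 
      unfolding ev.simps cost.simps P by linarith
  qed
next
  case (Add e1 e2)
  then obtain q1 q2 where q: "bounded_by e1 q1" "bounded_by e2 q2" by blast
  note q1 = bounded_byD[OF q(1)] and q2 = bounded_byD[OF q(2)]
  show ?case
  proof (unfold bounded_by_def, intro exI[of _ "[:1:] + q1 + [:5:] * q2"] allI impI)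
    fix x y :: "bool list" and E :: "nat \<Rightarrow> nat" and m assume *: "length x \<le> m" "length y \<le> m" "\<forall>i. E i \<le> m"
    show "ev x y E (Add e1 e2) \<le> poly ([:1:] + q1 + [:5:] * q2) m \<and>
        cost x y E (Add e1 e2) \<le> poly ([:1:] + q1 + [:5:] * q2) m"
      using q1[OF *] q2[OF *] by simp
  qed
next
  case (Sub e1 e2)
  then obtain q1 q2 where q: "bounded_by e1 q1" "bounded_by e2 q2" by blast
  note q1 = bounded_byD[OF q(1)] and q2 = bounded_byD[OF q(2)]
  show ?case
  proof (unfold bounded_by_def, intro exI[of _ "[:1:] + q1 + [:7:] * q2"] allI impI)
    fix x y :: "bool list" and E :: "nat \<Rightarrow> nat" and m assume *: "length x \<le> m" "length y \<le> m" "\<forall>i. E i \<le> m"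
    show "ev x y E (Sub e1 e2) \<le> poly ([:1:] + q1 + [:7:] * q2) m \<and>
        cost x y E (Sub e1 e2) \<le> poly ([:1:] + q1 + [:7:] * q2) m"
      using q1[OF *] q2[OF *] by (simp, linarith)
  qed
next
  case (Sum e1 e2)
  then obtain q1 q2 where q: "bounded_by e1 q1" "bounded_by e2 q2" by blast
  note q1 = bounded_byD[OF q(1)] and q2 = bounded_byD[OF q(2)]
  define q3 where "q3 = pcompose q2 ([:0, 1:] + q1)"
  show ?case
  proof (unfold bounded_by_def, intro exI[of _ "[:2:] + [:4:] * q1 + q1 * ([:5:] * (q3 + 1))"] allI impI)
    fix x y :: "bool list" and E :: "nat \<Rightarrow> nat" and m assume *: "length x \<le> m" "length y \<le> m" "\<forall>i. E i \<le> m"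
    let ?m = "m + poly q1 m"
    have b: "ev x y (case_nat i E) e2 \<le> poly q3 m \<and> cost x y (case_nat i E) e2 \<le> poly q3 m"
      if "i < ev x y E e1" for i
    proof -
      have "\<forall>k. case_nat i E k \<le> ?m"
        using that q1[OF *] * by (auto split: nat.split intro: trans_le_add1)
      then show ?thesis using q2[of x ?m y "case_nat i E"] * by (simp add: q3_def poly_pcompose)
    qed
    have "(\<Sum>i<ev x y E e1. ev x y (case_nat i E) e2) \<le> (\<Sum>i<ev x y E e1. poly q3 m)"
      using b by (intro sum_mono) auto
    also have "\<dots> \<le> poly q1 m * poly q3 m" using q1[OF *] by simp
    also have "\<dots> \<le> poly q1 m * (5 * (poly q3 m + 1))" by (intro mult_left_mono) auto
    finally have 1: "ev x y E (Sum e1 e2) \<le> poly q1 m * (5 * (poly q3 m + 1))" by simp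
    have "(\<Sum>i<ev x y E e1. cost x y (case_nat i E) e2 + 5 + 4 * ev x y (case_nat i E) e2) \<le>
        (\<Sum>i<ev x y E e1. 5 * (poly q3 m + 1))"
      using b by (intro sum_mono) fastforce
    also have "\<dots> \<le> poly q1 m * (5 * (poly q3 m + 1))" using q1[OF *] by simp
    finally have 2: "(\<Sum>i<ev x y E e1. cost x y (case_nat i E) e2 + 5 + 4 * ev x y (case_nat i E) e2)
        \<le> poly q1 m * (5 * (poly q3 m + 1))" .
    have P: "poly ([:2:] + [:4:] * q1 + q1 * ([:5:] * (q3 + 1))) m =
        2 + 4 * poly q1 m + poly q1 m * (5 * (poly q3 m + 1))" by (simp add: distrib_left)
    show "ev x y E (Sum e1 e2) \<le> poly ([:2:] + [:4:] * q1 + q1 * ([:5:] * (q3 + 1))) m \<and>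
        cost x y E (Sum e1 e2) \<le> poly ([:2:] + [:4:] * q1 + q1 * ([:5:] * (q3 + 1))) m"
      using 1 2 q1[OF *] unfolding P cost.simps by linarith
  qed
qed

section \<open>Initialising the registers\<close>

fun marks :: "nat \<Rightarrow> com" where
  "marks 0 = Skip"
| "marks (Suc n) = marks n ;; Wr (n + 2) 1"

text \<open>Register \<open>t\<close> counts the letters up to the first blank; register 2 counts
  the same steps and is used up on the way back.\<close>

definition load :: "nat \<Rightarrow> com" where
  "load t = While t 0 (Mv t 1 ;; inc t ;; inc 2) ;; loop 2 (dec 2 ;; Mv t (- 1))"

definition boot :: "nat \<Rightarrow> com" where
  "boot K = marks K ;; load 0 ;; load 1"

lemma good_com_boot: "3 \<le> K \<Longrightarrow> good_com (K + 2) (boot K)"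
proof -
  have "n \<le> K \<Longrightarrow> good_com (K + 2) (marks n)" for n by (induction n) auto
  moreover assume "3 \<le> K"
  ultimately show ?thesis by (simp add: boot_def load_def)
qed

lemma runs_marks:
  assumes "n \<le> K"
  shows "runs (marks n) (A # B # map (\<lambda>r. (0, \<lambda>_. 0)) [0..<K])
    (A # B # map (\<lambda>r. (0, if r < n then mark else (\<lambda>_. 0))) [0..<K]) n"
  using assms
proof (induction n)
  case 0
  then show ?case by (auto intro: runs_eq[OF runs_Skip])
next
  case (Suc n)
  let ?ts = "\<lambda>n. A # B # map (\<lambda>r. (0 :: int, if r < n then mark else (\<lambda>_. 0))) [0..<K]"
  have "(?ts n)[n + 2 := (fst (?ts n ! (n + 2)), (snd (?ts n ! (n + 2)))(fst (?ts n ! (n + 2)) := 1))] =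
      ?ts (Suc n)"
    using Suc.prems by (auto simp: mark_def fun_eq_iff nth_list_update less_Suc_eq intro!: nth_equalityI)
  then have "runs (Wr (n + 2) 1) (?ts n) (?ts (Suc n)) 1"
    unfolding runs_def using bs.Wr[of "n + 2" 1 "?ts n"] by (metis le_refl)
  from runs_Seq[OF Suc.IH this] Suc.prems show ?case by simp
qed

lemma runs_load:
  fixes A B :: tape and t :: nat
  assumes A: "\<And>i. snd A (fst A + int i) = sy x i" and B: "\<And>i. snd B (fst B + int i) = sy y i"
    and w: "w = (if t = 0 then x else y)" and "t \<le> 1" "2 < K" "\<rho> t = 0" "\<rho> 2 = 0"
  shows "runs (load t) (cf A B K \<rho>) (cf A B K (\<rho>(t := length w))) (2 + 9 * length w)"
proof -
  define X where "X = (\<lambda>j. if t = 0 then (fst A + int j, snd A) else A)"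
  define Y where "Y = (\<lambda>j. if t = 0 then B else (fst B + int j, snd B))"
  have mv: "runs (Mv t 1) (cf (X j) (Y j) K \<rho>) (cf (X (Suc j)) (Y (Suc j)) K \<rho>) 1" for j \<rho>
    using assms(4) unfolding X_def Y_def
    by (auto intro!: runs_eq[OF runs_Mv0] runs_eq[OF runs_Mv1[unfolded One_nat_def]] simp: le_Suc_eq ac_simps)
  let ?S = "\<lambda>j. cf (X j) (Y j) K (\<rho>(t := j, 2 := j))"
  have sc: "scan (?S j) t = sy w j" for j
    using assms(4) by (auto simp: X_def Y_def cf_nth(2) cf_nth(3)[unfolded One_nat_def] A B w le_Suc_eq)
  have 1: "runs (While t 0 (Mv t 1 ;; inc t ;; inc 2)) (?S 0) (?S (length w)) (1 + (\<Sum>j<length w. 3 + 2))"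
  proof (rule runs_While, unfold sc)
    fix j assume "j < length w"
    show "runs (Mv t 1 ;; inc t ;; inc 2) (?S j) (?S (Suc j)) 3"
      by (rule runs_eq[OF runs_Seq[OF mv runs_Seq[OF runs_inc runs_inc]]])
        (use assms in \<open>auto intro!: cf_cong\<close>)
  qed (auto simp: sy_def)
  have 2: "runs (loop (0 + 2) (dec (0 + 2) ;; Mv t (- 1)))
      (cf (X n) (Y n) K ((\<rho>(t := length w))(0 + 2 := n))) (cf A B K (\<rho>(t := length w))) (1 + 4 * n)" for n
    unfolding X_def Y_def by (rule runs_shift(2)) (use assms in \<open>auto simp: numeral_2_eq_2\<close>)
  have 0: "?S 0 = cf A B K \<rho>" using assms by (auto simp: X_def Y_def fun_upd_idem)
  show ?thesis unfolding load_def
    by (rule runs_eq[OF runs_Seq[OF 1[unfolded 0] 2[unfolded add_0]]]) auto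
qed

lemma runs_boot:
  assumes "3 \<le> K" "length ws \<le> 2" "ws \<noteq> []"
  defines "x \<equiv> hd ws" and "y \<equiv> (if length ws = 1 then [] else ws ! 1)"
  shows "runs (boot K) (snd (tm_init (machine (K + 2) c r) ws))
    (cf (0, word_tape x) (0, word_tape y) K (\<lambda>r. if r = 0 then length x else if r = 1 then length y else 0))
    (K + 4 + 9 * (length x + length y))"
proof -
  have "word_tape [] = (\<lambda>_. 0)" by (simp add: word_tape_def fun_eq_iff)
  then have init: "snd (tm_init (machine (K + 2) c r) ws) =
      (0, word_tape x) # (0, word_tape y) # map (\<lambda>r. (0, \<lambda>_. 0)) [0..<K]"
  proof -
    consider a where "ws = [a]" | a b where "ws = [a, b]"
      using assms(2,3) by (cases ws rule: remdups_adj.cases) auto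
    moreover have "[0..<K + 2] = 0 # 1 # map (\<lambda>r. r + 2) [0..<K]"
      by (rule nth_equalityI) (auto simp: nth_Cons simp del: upt_Suc split: nat.split)
    ultimately show ?thesis using \<open>word_tape [] = (\<lambda>_. 0)\<close>
      by cases (simp_all add: tm_init_def x_def y_def)
  qed
  let ?A = "(0, word_tape x) :: tape" and ?B = "(0, word_tape y) :: tape"
  have AB: "snd ?A (fst ?A + int i) = sy x i" "snd ?B (fst ?B + int i) = sy y i" for i
    by (simp_all add: word_tape_sy)
  have m: "runs (marks K) (snd (tm_init (machine (K + 2) c r) ws)) (cf ?A ?B K (\<lambda>_. 0)) K"
    unfolding init by (rule runs_eq[OF runs_marks]) (auto simp: cf_def)
  have l0: "runs (load 0) (cf ?A ?B K (\<lambda>_. 0)) (cf ?A ?B K ((\<lambda>_. 0)(0 := length x))) (2 + 9 * length x)"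
    by (rule runs_load[OF AB]) (use assms in auto)
  have l1: "runs (load 1) (cf ?A ?B K ((\<lambda>_. 0)(0 := length x)))
      (cf ?A ?B K ((\<lambda>_. 0)(0 := length x, 1 := length y))) (2 + 9 * length y)"
    by (rule runs_load[OF AB]) (use assms in auto)
  show ?thesis unfolding boot_def
    by (rule runs_eq[OF runs_Seq[OF m runs_Seq[OF l0 l1]]])
      (auto intro!: cf_cong)
qed

section \<open>Verifiers and output machines from expressions\<close>

definition definable :: "(bool list \<Rightarrow> bool list \<Rightarrow> (nat \<Rightarrow> nat) \<Rightarrow> nat) \<Rightarrow> bool" where
  "definable f \<longleftrightarrow> (\<exists>e. \<forall>x y E. f x y E = ev x y E e)"

abbreviation definable_pred :: "(bool list \<Rightarrow> bool list \<Rightarrow> (nat \<Rightarrow> nat) \<Rightarrow> bool) \<Rightarrow> bool" where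
  "definable_pred P \<equiv> definable (\<lambda>x y E. of_bool (P x y E))"

theorem in_NP_I:
  assumes "definable_pred (\<lambda>x y E. V x y)" and L: "\<And>x. x \<in> L \<longleftrightarrow> (\<exists>y. length y \<le> poly p (length x) \<and> V x y)"
  shows "in_NP L"
proof -
  obtain e where e: "\<And>x y E. of_bool (V x y) = ev x y E e" using assms(1) unfolding definable_def by auto
  obtain q where "bounded_by e q" using ex_bounded_by by blast
  note q = bounded_byD[OF this]
  define K where "K = 3 + nregs e"
  define c where "c = boot K ;; ce [] 2 e"
  \<comment> \<open>Tape 4 is register 2, which holds the truth value. The value 0 leaves the head
    on the mark, and the symbol 1 found there leads to rejection.\<close>
  define M where "M = machine (K + 2) c 4"
  \<comment> \<open>The summands bound \<open>boot\<close> and the evaluation; one unit of the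
    constant pays for the final branch.\<close>
  define r where "r = [:K + 5:] + [:9:] * ([:0, 1:] + p) + pcompose q ([:0, 1:] + p)"
  have good: "good_com (K + 2) c"
    unfolding c_def using good_com_boot[of K] good_com_ce[of "[]" 2 e "K + 2"] by (simp add: K_def)
  have run: "fst (tm_run M [x, y] n) = (if V x y then acc M else rej M)"
    if y: "length y \<le> poly p (length x)" and n: "poly r (length x) \<le> n" for x y n
  proof -
    let ?\<rho> = "\<lambda>r. if r = 0 then length x else if r = 1 then length y else 0"
    let ?S = "cf (0, word_tape x) (0, word_tape y) K"
    have 1: "runs (boot K) (snd (tm_init M [x, y])) (?S ?\<rho>) (K + 4 + 9 * (length x + length y))"
      unfolding M_def by (rule runs_eq[OF runs_boot])
        (auto simp: K_def fun_eq_iff intro!: cf_cong)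
    have 2: "runs (ce [] 2 e) (?S ?\<rho>) (?S (?\<rho>(2 := ev x y (\<lambda>_. 0) e))) (cost x y (\<lambda>_. 0) e)"
      by (rule runs_ce) (auto simp: word_tape_sy K_def)
    have "cost x y (\<lambda>_. 0) e \<le> poly q (length x + poly p (length x))"
      using q[of x "length x + poly p (length x)" y "\<lambda>_. 0"] y by simp
    then have "runs c (snd (tm_init M [x, y])) (?S (?\<rho>(2 := of_bool (V x y)))) (poly r (length x) - 1)"
      unfolding c_def by (intro runs_eq[OF runs_Seq[OF 1 2]])
        (use y in \<open>auto simp: e[symmetric] r_def poly_pcompose\<close>)
    then obtain k where k: "k \<le> poly r (length x) - 1"
      "bs c (snd (tm_init (machine (K + 2) c 4) [x, y])) k (?S (?\<rho>(2 := of_bool (V x y))))"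
      unfolding runs_def M_def by auto
    have "0 < poly r (length x)" by (simp add: r_def)
    then have "k < n" using k(1) n by linarith
    have sc: "scan (?S (?\<rho>(2 := of_bool (V x y)))) 4 = (if V x y then 0 else 1)"
      using scan_cf[of 2 K "(0, word_tape x)" "(0, word_tape y)" "?\<rho>(2 := of_bool (V x y))"]
      by (simp add: K_def)
    have "tm_run M [x, y] n = (if V x y then acc M else rej M, ?S (?\<rho>(2 := of_bool (V x y))))"
      using machine_run[OF k(2) good _ _ \<open>k < n\<close>, folded M_def, unfolded sc] by (simp add: K_def)
    then show ?thesis by simp
  qed
  have "wf_tm M" unfolding M_def using good by (intro wf_machine) (auto simp: K_def)
  moreover have "halts_within M [x, y] (poly r (length x))" if "length y \<le> poly p (length x)" for x y
    using run[OF that order_refl] by (simp add: halts_within_def)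
  moreover have "accepts M [x, y] \<longleftrightarrow> V x y" if y: "length y \<le> poly p (length x)" for x y
  proof
    assume "V x y"
    then show "accepts M [x, y]"
      using run[OF y order_refl] unfolding accepts_def by auto
  next
    assume "accepts M [x, y]"
    then obtain t where t: "fst (tm_run M [x, y] t) = acc M" unfolding accepts_def by auto
    have "tm_run M [x, y] (t + poly r (length x)) = tm_run M [x, y] t"
      by (rule tm_run_halted) (simp_all add: t)
    then have "fst (tm_run M [x, y] (t + poly r (length x))) = acc M" using t by simp
    moreover have "acc M \<noteq> rej M" by (simp add: M_def)
    ultimately show "V x y" using run[OF y, of "t + poly r (length x)"] by (simp split: if_splits)
  qed
  ultimately show ?thesis unfolding in_NP_def L by blast
qed

text \<open>Value 0 stands for no output, 1 for \<^const>\<open>False\<close>, anything else for \<^const>\<open>True\<close>.\<close>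

definition emit :: "nat \<Rightarrow> bool list" where
  "emit v = (if v = 0 then [] else [v \<noteq> 1])"

lemma word_tape_snoc: "(word_tape w)(int (length w) := (if b then 2 else 1)) = word_tape (w @ [b])"
  by (auto simp: word_tape_def fun_eq_iff nth_append nat_less_iff)

lemma runs_Wr1: "runs (Wr 1 s) (cf A B K \<rho>) (cf A (fst B, (snd B)(fst B := s)) K \<rho>) 1"
proof -
  have "bs (Wr 1 s) (cf A B K \<rho>) 1 (cf A (fst B, (snd B)(fst B := s)) K \<rho>)"
    using bs.Wr[of 1 s "cf A B K \<rho>"] by (simp only: cf_nth cf_update)
  then show ?thesis unfolding runs_def by blast
qed

definition out :: "nat \<Rightarrow> com" where
  "out r = ifz r Skip (dec r ;; ifz r (Wr 1 1 ;; Mv 1 1) (clear r ;; Wr 1 2 ;; Mv 1 1))"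

lemma runs_out:
  assumes "r < K"
  shows "runs (out r) (cf A (int (length w), word_tape w) K \<rho>)
    (cf A (int (length (w @ emit (\<rho> r))), word_tape (w @ emit (\<rho> r))) K (\<rho>(r := 0))) (3 * \<rho> r + 8)"
proof -
  let ?v = "\<rho> r"
  let ?B = "\<lambda>w. (int (length w), word_tape w) :: tape"
  have wr: "runs (Wr 1 (if b then 2 else 1) ;; Mv 1 1) (cf A (?B w) K \<rho>') (cf A (?B (w @ [b])) K \<rho>') 2" for b \<rho>'
    by (rule runs_eq[OF runs_Seq[OF runs_Wr1 runs_Mv1]]) (auto simp: word_tape_snoc ac_simps)
  note wr1 = wr[of False, simplified] and wr2 = wr[of True, simplified]
  have "runs (out r) (cf A (?B w) K \<rho>) (cf A (?B (w @ emit ?v)) K (\<rho>(r := 0))) (3 * ?v + 6 + 2)"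
    unfolding out_def
  proof (rule runs_ifz[OF assms])
    assume "\<rho> r = 0"
    then show "runs Skip (cf A (?B w) K \<rho>) (cf A (?B (w @ emit ?v)) K (\<rho>(r := 0))) (3 * ?v + 6)"
      by (intro runs_eq[OF runs_Skip]) (auto simp: emit_def fun_upd_idem)
  next
    assume v: "0 < \<rho> r"
    let ?\<rho> = "\<rho>(r := ?v - 1)"
    have "runs (ifz r (Wr 1 1 ;; Mv 1 1) (clear r ;; Wr 1 2 ;; Mv 1 1)) (cf A (?B w) K ?\<rho>)
        (cf A (?B (w @ emit ?v)) K (\<rho>(r := 0))) (3 * ?v + 3 + 2)"
    proof (rule runs_ifz[OF assms])
      assume "?\<rho> r = 0"
      then have "?v = 1" using v by simp
      then show "runs (Wr 1 1 ;; Mv 1 1) (cf A (?B w) K ?\<rho>)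
          (cf A (?B (w @ emit ?v)) K (\<rho>(r := 0))) (3 * ?v + 3)"
        by (auto simp: emit_def intro!: runs_eq[OF wr1])
    next
      assume "0 < ?\<rho> r"
      then have "1 < ?v" by simp
      then show "runs (clear r ;; Wr 1 2 ;; Mv 1 1) (cf A (?B w) K ?\<rho>)
          (cf A (?B (w @ emit ?v)) K (\<rho>(r := 0))) (3 * ?v + 3)"
        by (auto simp: emit_def assms intro!: runs_eq[OF runs_Seq[OF runs_clear wr2]])
    qed
    from runs_Seq[OF runs_dec[where \<rho> = \<rho>, OF assms v] this]
    show "runs (dec r ;; ifz r (Wr 1 1 ;; Mv 1 1) (clear r ;; Wr 1 2 ;; Mv 1 1)) (cf A (?B w) K \<rho>)
        (cf A (?B (w @ emit ?v)) K (\<rho>(r := 0))) (3 * ?v + 6)"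
      by (rule runs_eq) auto
  qed
  then show ?thesis by (rule runs_eq) auto
qed

theorem polytime_computable_I:
  assumes "definable (\<lambda>x y E. N x)" "definable (\<lambda>x y E. q x (E 0))"
    and f: "\<And>x. f x = concat (map (\<lambda>i. emit (q x i)) [0..<N x])"
  shows "polytime_computable f"
proof -
  obtain e1 e2 where e1: "\<And>x y E. N x = ev x y E e1" and e2: "\<And>x y E. q x (E 0) = ev x y E e2"
    using assms(1,2) unfolding definable_def by meson
  obtain p1 where "bounded_by e1 p1" using ex_bounded_by by blast
  note p1 = bounded_byD[OF this]
  obtain p2 where "bounded_by e2 p2" using ex_bounded_by by blast
  note p2 = bounded_byD[OF this]
  define p3 where "p3 = pcompose p2 ([:0, 1:] + p1)"
  define K where "K = 5 + nregs e1 + nregs e2"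
  \<comment> \<open>Register 2 counts the outstanding positions; register 3 is the current position
    and serves as variable 0 of \<open>e2\<close>.\<close>
  define body where "body = dec 2 ;; ce [3] 4 e2 ;; out 4 ;; inc 3"
  define c where "c = boot K ;; ce [] 2 e1 ;; loop 2 body"
  \<comment> \<open>The final branch inspects the output tape: its head stands on the blank behind
    the output, so the machine accepts.\<close>
  define M where "M = machine (K + 2) c 1"
  define p where "p = [:K + 6, 9:] + p1 + p1 * ([:4:] * p3 + [:12:])"
  have good: "good_com (K + 2) c"
    unfolding c_def body_def out_def clear_def
    using good_com_boot[of K] good_com_ce[of "[]" 2 e1 "K + 2"] good_com_ce[of "[3]" 4 e2 "K + 2"]
    by (simp add: K_def)
  have "fst (tm_run M [x] (poly p (length x))) = acc M \<and>
      snd (snd (tm_run M [x] (poly p (length x))) ! 1) = word_tape (f x)" for x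
  proof -
    define o' where "o' j = concat (map (\<lambda>i. emit (q x i)) [0..<j])" for j
    let ?\<rho> = "\<lambda>r. if r = 0 then length x else 0"
    let ?B = "\<lambda>w. (int (length w), word_tape w) :: tape"
    let ?A = "(0, word_tape x) :: tape"
    \<comment> \<open>From the output head on, that tape is blank. To an expression the second word
      is therefore empty, however much has been written.\<close>
    have AB: "snd ?A (fst ?A + int i) = sy x i" "snd (?B w) (fst (?B w) + int i) = sy [] i" for i w
      by (simp_all add: word_tape_sy) (simp add: word_tape_def sy_def)
    have 1: "runs (boot K) (snd (tm_init M [x])) (cf ?A (?B []) K ?\<rho>) (K + 4 + 9 * length x)"
      unfolding M_def by (rule runs_eq[OF runs_boot]) (auto simp: K_def fun_eq_iff intro!: cf_cong)
    have 2: "runs (ce [] 2 e1) (cf ?A (?B []) K ?\<rho>) (cf ?A (?B []) K (?\<rho>(2 := N x))) (cost x [] (\<lambda>_. 0) e1)"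
      by (rule runs_eq[OF runs_ce[OF AB]]) (auto simp: K_def e1[symmetric])
    let ?\<rho>' = "\<lambda>j. ?\<rho>(2 := N x - j, 3 := j)"
    let ?c = "\<lambda>j. cost x [] (case_nat j (\<lambda>_. 0)) e2 + 3 * q x j + 10"
    have 3: "runs (loop 2 body) (cf ?A (?B (o' 0)) K (?\<rho>' 0)) (cf ?A (?B (o' (N x))) K (?\<rho>' (N x)))
        (1 + (\<Sum>j<N x. ?c j + 2))"
    proof (rule runs_loop[where \<rho> = ?\<rho>' and B = "\<lambda>j. ?B (o' j)"])
      fix j assume j: "j < N x"
      let ?\<rho>1 = "?\<rho>(2 := N x - Suc j, 3 := j)"
      have a: "runs (dec 2) (cf ?A (?B (o' j)) K (?\<rho>' j)) (cf ?A (?B (o' j)) K ?\<rho>1) 1"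
        by (rule runs_eq[OF runs_dec]) (use j in \<open>auto simp: K_def intro!: cf_cong\<close>)
      have "ev x [] (case_nat j (\<lambda>_. 0)) e2 = q x j" using e2[of x "case_nat j (\<lambda>_. 0)"] by simp
      then have b: "runs (ce [3] 4 e2) (cf ?A (?B (o' j)) K ?\<rho>1) (cf ?A (?B (o' j)) K (?\<rho>1(4 := q x j)))
          (cost x [] (case_nat j (\<lambda>_. 0)) e2)"
        by (intro runs_eq[OF runs_ce[OF AB, where vs = "[3]" and E = "case_nat j (\<lambda>_. 0)"]])
          (auto simp: K_def fun_eq_iff split: nat.split)
      have d: "runs (out 4) (cf ?A (?B (o' j)) K (?\<rho>1(4 := q x j))) (cf ?A (?B (o' (Suc j))) K ?\<rho>1) (3 * q x j + 8)"
        by (rule runs_eq[OF runs_out])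
          (auto simp: K_def o'_def intro!: cf_cong)
      show "runs body (cf ?A (?B (o' j)) K (?\<rho>' j)) (cf ?A (?B (o' (Suc j))) K (?\<rho>' (Suc j))) (?c j)"
        unfolding body_def by (rule runs_eq[OF runs_Seq[OF a runs_Seq[OF b runs_Seq[OF d runs_inc]]]])
          (auto simp: K_def intro!: cf_cong)
    qed (auto simp: K_def)
    have 0: "cf ?A (?B []) K (?\<rho>(2 := N x)) = cf ?A (?B (o' 0)) K (?\<rho>' 0)"
      by (auto simp: o'_def intro!: cf_cong)
    have N: "N x \<le> poly p1 (length x)" "cost x [] (\<lambda>_. 0) e1 \<le> poly p1 (length x)"
      using p1[of x "length x" "[]" "\<lambda>_. 0"] e1[of x "[]" "\<lambda>_. 0"] by simp_all
    have "?c j + 2 \<le> 4 * poly p3 (length x) + 12" if "j < N x" for j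
    proof -
      have "\<forall>k. case_nat j (\<lambda>_. 0) k \<le> length x + poly p1 (length x)"
        using that N by (auto split: nat.split)
      then show ?thesis
        using p2[of x "length x + poly p1 (length x)" "[]" "case_nat j (\<lambda>_. 0)"]
          e2[of x "case_nat j (\<lambda>_. 0)" "[]"] by (simp add: p3_def poly_pcompose)
    qed
    then have "(\<Sum>j<N x. ?c j + 2) \<le> (\<Sum>j<N x. 4 * poly p3 (length x) + 12)" by (intro sum_mono) simp
    also have "\<dots> \<le> poly p1 (length x) * (4 * poly p3 (length x) + 12)" 
      using N by (simp add: mult_le_mono1)
    finally have T: "(\<Sum>j<N x. ?c j + 2) \<le> poly p1 (length x) * (4 * poly p3 (length x) + 12)" .
    have "runs c (snd (tm_init M [x])) (cf ?A (?B (f x)) K (?\<rho>' (N x))) (poly p (length x) - 1)"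
      unfolding c_def by (rule runs_eq[OF runs_Seq[OF 1 runs_Seq[OF 2[unfolded 0] 3]]])
        (use N T in \<open>auto simp: f o'_def p_def\<close>)
    then obtain k where k: "k \<le> poly p (length x) - 1"
      "bs c (snd (tm_init (machine (K + 2) c 1) [x])) k (cf ?A (?B (f x)) K (?\<rho>' (N x)))"
      unfolding runs_def M_def by auto
    have "0 < poly p (length x)" by (simp add: p_def)
    then have "k < poly p (length x)" using k(1) by linarith
    from machine_run[OF k(2) good _ _ this] show ?thesis
      unfolding M_def by (auto simp: cf_def word_tape_def)
  qed
  moreover have "wf_tm M" unfolding M_def using good by (intro wf_machine) (auto simp: K_def)
  ultimately show ?thesis unfolding polytime_computable_def by blast
qed

section \<open>Definable functions and predicates\<close>

fun ren :: "(nat \<Rightarrow> nat) \<Rightarrow> exp \<Rightarrow> exp" where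
  "ren r (Var i) = Var (r i)"
| "ren r One = One"
| "ren r (Len b) = Len b"
| "ren r (Rd b e) = Rd b (ren r e)"
| "ren r (Add e1 e2) = Add (ren r e1) (ren r e2)"
| "ren r (Sub e1 e2) = Sub (ren r e1) (ren r e2)"
| "ren r (Sum e1 e2) = Sum (ren r e1) (ren (case_nat 0 (\<lambda>i. Suc (r i))) e2)"

lemma ev_ren: "ev x y E (ren r e) = ev x y (\<lambda>i. E (r i)) e"
proof (induction e arbitrary: E r)
  case (Sum e1 e2)
  have "(\<lambda>k. case_nat i E (case_nat 0 (\<lambda>i. Suc (r i)) k)) = case_nat i (\<lambda>i. E (r i))" for i
    by (auto split: nat.split)
  then show ?case by (simp add: Sum)
qed auto

text \<open>With \<open>r = Suc\<close> this carries a definable function under the binder of a sum,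
  where all variables are shifted by one.\<close>

lemma definable_ren: "definable f \<Longrightarrow> definable (\<lambda>x y E. f x y (\<lambda>i. E (r i)))"
  unfolding definable_def by (metis ev_ren)

lemma definable_var: "definable (\<lambda>x y E. E i)"
  unfolding definable_def by (rule exI[of _ "Var i"]) simp

lemma definable_len0: "definable (\<lambda>x y E. length x)"
  unfolding definable_def by (rule exI[of _ "Len False"]) simp

lemma definable_rd0: "definable a \<Longrightarrow> definable (\<lambda>x y E. sy x (a x y E))"
  unfolding definable_def by (elim exE, rule_tac x = "Rd False e" in exI) simp

lemma definable_rd1: "definable a \<Longrightarrow> definable (\<lambda>x y E. sy y (a x y E))"
  unfolding definable_def by (elim exE, rule_tac x = "Rd True e" in exI) simp

lemma definable_add: "definable a \<Longrightarrow> definable b \<Longrightarrow> definable (\<lambda>x y E. a x y E + b x y E)"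
  unfolding definable_def by (elim exE, rule_tac x = "Add e ea" in exI) simp

lemma definable_diff: "definable a \<Longrightarrow> definable b \<Longrightarrow> definable (\<lambda>x y E. a x y E - b x y E)"
  unfolding definable_def by (elim exE, rule_tac x = "Sub e ea" in exI) simp

lemma definable_sum:
  assumes "definable a" "definable (\<lambda>x y E. b x y (\<lambda>i. E (Suc i)) (E 0))"
  shows "definable (\<lambda>x y E. \<Sum>i<a x y E. b x y E i)"
proof -
  obtain e1 e2 where e1: "\<And>x y E. a x y E = ev x y E e1"
    and e2: "\<And>x y E. b x y (\<lambda>i. E (Suc i)) (E 0) = ev x y E e2"
    using assms unfolding definable_def by blast
  have "b x y E i = ev x y (case_nat i E) e2" for x y E i
    using e2[of x y "case_nat i E"] by simp
  then show ?thesis unfolding definable_def by (intro exI[of _ "Sum e1 e2"]) (simp add: e1)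
qed

lemma definable_const: "definable (\<lambda>x y E. n)"
proof (induction n)
  case 0
  show ?case unfolding definable_def by (rule exI[of _ "Sub One One"]) simp
next
  case (Suc n)
  moreover have "definable (\<lambda>x y E. 1)" unfolding definable_def by (rule exI[of _ One]) simp
  ultimately show ?case using definable_add by fastforce
qed

lemma definable_Suc: "definable a \<Longrightarrow> definable (\<lambda>x y E. Suc (a x y E))"
  using definable_add[OF definable_const[of 1], of a] by simp

lemma definable_mult: "definable a \<Longrightarrow> definable b \<Longrightarrow> definable (\<lambda>x y E. a x y E * b x y E)"
proof -
  assume *: "definable a" "definable b"
  have "definable (\<lambda>x y E. \<Sum>i<a x y E. b x y E)" by (intro definable_sum * definable_ren[OF *(2)])
  then show ?thesis by simp
qed

lemma definable_pred_not: "definable_pred P \<Longrightarrow> definable_pred (\<lambda>x y E. \<not> P x y E)"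
proof -
  assume "definable_pred P"
  then have "definable (\<lambda>x y E. 1 - of_bool (P x y E))" by (intro definable_diff definable_const)
  moreover have "of_bool (\<not> p) = 1 - (of_bool p :: nat)" for p by simp
  ultimately show ?thesis by simp
qed

lemma definable_pred_conj: "definable_pred P \<Longrightarrow> definable_pred Q \<Longrightarrow> definable_pred (\<lambda>x y E. P x y E \<and> Q x y E)"
  by (simp only: of_bool_conj) (intro definable_mult)

lemma definable_pred_disj: "definable_pred P \<Longrightarrow> definable_pred Q \<Longrightarrow> definable_pred (\<lambda>x y E. P x y E \<or> Q x y E)"
  using definable_pred_not[OF definable_pred_conj[OF definable_pred_not definable_pred_not], of P Q] by simp

lemma definable_pred_imp: "definable_pred P \<Longrightarrow> definable_pred Q \<Longrightarrow> definable_pred (\<lambda>x y E. P x y E \<longrightarrow> Q x y E)"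
  using definable_pred_not[OF definable_pred_conj[OF _ definable_pred_not], of P Q] by simp

lemma definable_pred_pos: "definable a \<Longrightarrow> definable_pred (\<lambda>x y E. 0 < a x y E)"
proof -
  assume "definable a"
  then have "definable (\<lambda>x y E. 1 - (1 - a x y E))" by (intro definable_diff definable_const)
  moreover have "of_bool (0 < n) = 1 - (1 - n)" for n :: nat by auto
  ultimately show ?thesis by simp
qed

lemma definable_pred_less: "definable a \<Longrightarrow> definable b \<Longrightarrow> definable_pred (\<lambda>x y E. a x y E < b x y E)"
  using definable_pred_pos[OF definable_diff, of b a] by simp

lemma definable_pred_le: "definable a \<Longrightarrow> definable b \<Longrightarrow> definable_pred (\<lambda>x y E. a x y E \<le> b x y E)"
  using definable_pred_not[OF definable_pred_less, of b a] by (simp add: not_less)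

lemma definable_pred_eq: "definable a \<Longrightarrow> definable b \<Longrightarrow> definable_pred (\<lambda>x y E. a x y E = b x y E)"
  using definable_pred_conj[OF definable_pred_le definable_pred_le, of a b b a] by (simp add: eq_iff)

lemma definable_pred_ex:
  assumes "definable a" "definable_pred (\<lambda>x y E. P x y (\<lambda>i. E (Suc i)) (E 0))"
  shows "definable_pred (\<lambda>x y E. \<exists>i<a x y E. P x y E i)"
proof -
  have "(0 < (\<Sum>i<a x y E. of_bool (P x y E i) :: nat)) = (\<exists>i<a x y E. P x y E i)" for x y E
    by (subst zero_less_iff_neq_zero, subst sum_eq_0_iff) auto
  then show ?thesis using definable_pred_pos[OF definable_sum[of a "\<lambda>x y E i. of_bool (P x y E i)"]] assms by simp
qed

lemma definable_pred_all:
  assumes "definable a" "definable_pred (\<lambda>x y E. P x y (\<lambda>i. E (Suc i)) (E 0))"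
  shows "definable_pred (\<lambda>x y E. \<forall>i<a x y E. P x y E i)"
  using definable_pred_not[OF definable_pred_ex[of a "\<lambda>x y E i. \<not> P x y E i", OF assms(1) definable_pred_not[OF assms(2)]]] by simp

lemma definable_if: "definable_pred P \<Longrightarrow> definable a \<Longrightarrow> definable b \<Longrightarrow> definable (\<lambda>x y E. if P x y E then a x y E else b x y E)"
proof -
  assume *: "definable_pred P" "definable a" "definable b"
  have "(if P then a else b) = of_bool P * a + (1 - of_bool P) * b" for P and a b :: nat by simp
  then show ?thesis using * by (simp only: definable_add definable_mult definable_diff definable_const)
qed

lemma definable_pred_if: "definable_pred P \<Longrightarrow> definable_pred a \<Longrightarrow> definable_pred b \<Longrightarrow> definable_pred (\<lambda>x y E. if P x y E then a x y E else b x y E)"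
  using definable_if[of P "\<lambda>x y E. of_bool (a x y E)" "\<lambda>x y E. of_bool (b x y E)"] by (simp add: if_distrib)

text \<open>Substitution of a definable value for variable 0, expressed by a sum in which only the
  term with \<open>i = a\<close> survives.\<close>

lemma definable_let:
  assumes "definable a" "definable (\<lambda>x y E. g x y (\<lambda>i. E (Suc i)) (E 0))"
  shows "definable (\<lambda>x y E. g x y E (a x y E))"
proof -
  have "definable (\<lambda>x y E. \<Sum>i<Suc (a x y E). if i = a x y E then g x y E i else 0)"
    by (intro definable_sum definable_Suc definable_if definable_pred_eq definable_var definable_const assms definable_ren[OF assms(1)])
  moreover have "(\<Sum>i<Suc n. if i = n then h i else 0) = h n" for n and h :: "nat \<Rightarrow> nat"
    by (simp add: sum.delta)
  ultimately show ?thesis by simp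
qed

text \<open>For a positive divisor \<open>n\<close> the quotient is the number of positive multiples
  of \<open>n\<close> up to \<open>m\<close>; as it is at most \<open>m\<close>, counting below
  \<open>m\<close> suffices.\<close>

lemma definable_div:
  assumes "definable a" "definable b" shows "definable (\<lambda>x y E. a x y E div b x y E)"
proof -
  have "m div n = (if n = 0 then 0 else \<Sum>i<m. of_bool (Suc i * n \<le> m))" for m n :: nat
  proof (cases "n = 0")
    case False
    have "{i. i < m \<and> Suc i * n \<le> m} = {i. i < m div n}"
    proof (intro set_eqI iffI; clarsimp simp: less_eq_div_iff_mult_less_eq[symmetric] Suc_le_eq)
      fix i assume "n + i * n \<le> m"
      then show "i < m div n" using False less_eq_div_iff_mult_less_eq[of n "Suc i" m] by simp
    next
      fix i assume i: "i < m div n"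
      then have "Suc i * n \<le> m" using False less_eq_div_iff_mult_less_eq[of n "Suc i" m] by simp
      then show "i < m \<and> n + i * n \<le> m" using less_le_trans[OF i div_le_dividend] by simp
    qed
    then show ?thesis using False by (simp add: lessThan_def Collect_conj_eq[symmetric] Int_def)
  qed simp
  then show ?thesis
    by (simp only:) (intro definable_if definable_pred_eq definable_const definable_sum definable_pred_le definable_mult definable_Suc definable_var assms definable_ren[OF assms(1)] definable_ren[OF assms(2)])
qed

lemma definable_mod: "definable a \<Longrightarrow> definable b \<Longrightarrow> definable (\<lambda>x y E. a x y E mod b x y E)"
  unfolding minus_div_mult_eq_mod[symmetric] by (intro definable_diff definable_mult definable_div)

lemma definable_pred_dvd: "definable a \<Longrightarrow> definable b \<Longrightarrow> definable_pred (\<lambda>x y E. a x y E dvd b x y E)"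
  unfolding dvd_eq_mod_eq_0 by (intro definable_pred_eq definable_mod definable_const)

lemma definable_poly: "definable a \<Longrightarrow> definable (\<lambda>x y E. poly p (a x y E))"
  by (induction p) (auto intro: definable_const definable_add definable_mult)

text \<open>Finite tables can be wired into a formula. This is how an arbitrary transition function
  becomes definable.\<close>

lemma definable_pred_finite:
  assumes "finite S" "definable a" shows "definable_pred (\<lambda>x y E. a x y E \<in> S)"
  using assms(1)
proof (induction S rule: finite_induct)
  case empty
  then show ?case using definable_const[of 0] by simp
next
  case (insert s S)
  then show ?case using definable_pred_disj[OF definable_pred_eq[OF assms(2) definable_const[of s]]] by fastforce
qed

lemmas definable_intros = definable_var definable_len0 definable_rd0 definable_rd1 definable_add definable_diff definable_sum definable_const definable_Suc definable_mult definable_pred_not definable_pred_conj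
  definable_pred_disj definable_pred_imp definable_pred_less definable_pred_le definable_pred_eq definable_pred_ex definable_pred_all definable_if definable_pred_if definable_div definable_mod definable_pred_dvd definable_poly

definition outp :: "(bool list \<Rightarrow> bool list) \<Rightarrow> bool" where
  "outp f \<longleftrightarrow> (\<exists>N q. definable (\<lambda>x y E. N x) \<and> definable (\<lambda>x y E. q x (E 0)) \<and>
     (\<forall>x. f x = concat (map (\<lambda>i. emit (q x i)) [0..<N x])))"

lemma polytime_computable_outp: "outp f \<Longrightarrow> polytime_computable f"
  unfolding outp_def using polytime_computable_I by blast

lemma outp_append:
  assumes "outp f" "outp g" shows "outp (\<lambda>x. f x @ g x)"
proof -
  obtain N q where f: "definable (\<lambda>x y E. N x)" "definable (\<lambda>x y E. q x (E 0))"
    "\<And>x. f x = concat (map (\<lambda>i. emit (q x i)) [0..<N x])"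
    using assms(1) unfolding outp_def by blast
  obtain N' q' where g: "definable (\<lambda>x y E. N' x)" "definable (\<lambda>x y E. q' x (E 0))"
    "\<And>x. g x = concat (map (\<lambda>i. emit (q' x i)) [0..<N' x])"
    using assms(2) unfolding outp_def by blast
  define r where "r x i = (if i < N x then q x i else q' x (i - N x))" for x i
  have "definable (\<lambda>x y E. q' x (E 0 - N x))"
    by (rule definable_let[where g = "\<lambda>x y E. q' x"]) (intro definable_intros f g)+
  then have "definable (\<lambda>x y E. r x (E 0))" unfolding r_def by (intro definable_intros f)
  moreover have "definable (\<lambda>x y E. N x + N' x)" by (intro definable_intros f g)
  moreover have "f x @ g x = concat (map (\<lambda>i. emit (r x i)) [0..<N x + N' x])" for x
  proof -
    have u: "[0..<N x + N' x] = [0..<N x] @ map (\<lambda>i. i + N x) [0..<N' x]"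
      by (subst upt_add_eq_append) (simp_all add: map_add_upt add.commute[of "N x"])
    have m: "map (\<lambda>i. emit (r x i)) [0..<N x] = map (\<lambda>i. emit (q x i)) [0..<N x]"
      by (simp add: r_def)
    have m': "map (\<lambda>i. emit (r x (i + N x))) [0..<N' x] = map (\<lambda>i. emit (q' x i)) [0..<N' x]"
      by (simp add: r_def)
    show ?thesis unfolding f(3) g(3) u by (simp add: m m' o_def)
  qed
  ultimately show ?thesis unfolding outp_def
    by (intro exI[of _ "\<lambda>x. N x + N' x"] exI[of _ r]) blast
qed

lemma outp_filter:
  assumes "definable (\<lambda>x y E. N x)" "definable_pred (\<lambda>x y E. Q x (E 0))" "definable_pred (\<lambda>x y E. P x (E 0))"
  shows "outp (\<lambda>x. map (P x) (filter (Q x) [0..<N x]))"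
proof -
  have "definable (\<lambda>x y E. if Q x (E 0) then Suc (of_bool (P x (E 0))) else 0)"
    by (intro definable_intros assms)
  moreover have "map (P x) (filter (Q x) is) =
      concat (map (\<lambda>i. emit (if Q x i then Suc (of_bool (P x i)) else 0)) is)" for x "is"
    by (induction "is") (auto simp: emit_def)
  ultimately show ?thesis unfolding outp_def using assms(1)
    by (intro exI[of _ N] exI[of _ "\<lambda>x i. if Q x i then Suc (of_bool (P x i)) else 0"]) simp
qed

lemma outp_map:
  assumes "definable (\<lambda>x y E. N x)" "definable_pred (\<lambda>x y E. P x (E 0))"
  shows "outp (\<lambda>x. map (P x) [0..<N x])"
  using outp_filter[OF assms(1) _ assms(2), of "\<lambda>_ _. True"] definable_const[of 1] by simp

section \<open>Binary notation without exponentiation\<close>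

definition pow2 :: "nat \<Rightarrow> bool" where
  "pow2 n \<longleftrightarrow> (\<exists>j. n = 2 ^ j)"

text \<open>Every divisor of a power of two other than 1 is even; conversely a number with this
  property is 1 or can be halved. The right-hand side has only a bounded quantifier.\<close>

lemma pow2_iff: "pow2 n \<longleftrightarrow> 0 < n \<and> (\<forall>d<Suc n. d dvd n \<longrightarrow> d = 1 \<or> 2 dvd d)"
proof (induction n rule: less_induct)
  case (less n)
  show ?case
  proof
    assume "pow2 n"
    then obtain j where j: "n = 2 ^ j" by (auto simp: pow2_def)
    have "d = 1 \<or> 2 dvd d" if "d dvd n" for d
    proof -
      obtain i where "d = 2 ^ i" using \<open>d dvd n\<close> unfolding j by (metis divides_primepow_nat two_is_prime_nat)
      then show ?thesis by (cases i) auto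
    qed
    then show "0 < n \<and> (\<forall>d<Suc n. d dvd n \<longrightarrow> d = 1 \<or> 2 dvd d)" by (simp add: j)
  next
    assume *: "0 < n \<and> (\<forall>d<Suc n. d dvd n \<longrightarrow> d = 1 \<or> 2 dvd d)"
    then consider "n = 1" | "2 dvd n" by auto
    then show "pow2 n"
    proof cases
      case 1
      then show ?thesis unfolding pow2_def by (intro exI[of _ 0]) simp
    next
      case 2
      then obtain m where m: "n = 2 * m" by auto
      then have "pow2 m" using * less[of m] by (auto dest: dvd_mult[of _ m 2] simp: less_Suc_eq_le)
      then show ?thesis unfolding pow2_def m by (metis power_Suc)
    qed
  qed
qed

lemma definable_pred_pow2: assumes "definable a" shows "definable_pred (\<lambda>x y E. pow2 (a x y E))"
  unfolding pow2_iff by (intro definable_intros assms definable_ren[OF assms])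

lemma length_bits: "j < length (bits k) \<longleftrightarrow> 2 ^ j \<le> k"
proof (induction k arbitrary: j rule: less_induct)
  case (less k)
  show ?case
  proof (cases "k = 0")
    case False
    then have k: "bits k = odd k # bits (k div 2)" by (subst bits.simps) simp
    have "j < length (bits (k div 2)) \<longleftrightarrow> 2 ^ j \<le> k div 2" for j
      using False by (intro less) simp
    then show ?thesis using False
      by (cases j) (simp_all add: k less_eq_div_iff_mult_less_eq mult.commute Suc_le_eq)
  qed (simp add: bits.simps)
qed

lemma nth_bits: "j < length (bits k) \<Longrightarrow> bits k ! j = odd (k div 2 ^ j)"
proof (induction k arbitrary: j rule: less_induct)
  case (less k)
  show ?case
  proof (cases "k = 0")
    case False
    then have k: "bits k = odd k # bits (k div 2)" by (subst bits.simps) simp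
    have "i < length (bits (k div 2)) \<Longrightarrow> bits (k div 2) ! i = odd (k div 2 div 2 ^ i)" for i
      using False by (intro less) simp
    then show ?thesis using less.prems
      by (cases j) (simp_all add: k div_mult2_eq)
  next
    case True
    then show ?thesis using less.prems by (simp add: bits.simps)
  qed
qed

lemma filter_pow2: "filter pow2 [0..<Suc k] = map (\<lambda>j. 2 ^ j) [0..<length (bits k)]"
proof (rule sorted_distinct_set_unique)
  show "sorted (map (\<lambda>j. 2 ^ j :: nat) [0..<length (bits k)])"
    by (simp add: sorted_iff_nth_mono)
  show "distinct (map (\<lambda>j. 2 ^ j :: nat) [0..<length (bits k)])"
    by (simp add: distinct_map inj_on_def)
  show "set (filter pow2 [0..<Suc k]) = set (map (\<lambda>j. 2 ^ j) [0..<length (bits k)])"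
    by (auto simp: pow2_def length_bits simp del: upt_Suc)
qed (simp_all add: sorted_wrt_filter del: upt_Suc)

text \<open>Bit \<open>j\<close> is emitted at position \<open>2 ^ j\<close>, and the other
  positions up to \<open>k\<close> stay silent. Running through them all is affordable because
  \<open>k x\<close> is the value of an expression, hence polynomial in the length of
  \<open>x\<close>.\<close>

lemma outp_bits:
  assumes "definable (\<lambda>x y E. k x)" shows "outp (\<lambda>x. bits (k x))"
proof -
  have "bits k = map (\<lambda>p. odd (k div p)) (filter pow2 [0..<Suc k])" for k
    unfolding filter_pow2 by (rule nth_equalityI) (simp_all add: nth_bits)
  then have "(\<lambda>x. bits (k x)) = (\<lambda>x. map (\<lambda>p. odd (k x div p)) (filter pow2 [0..<Suc (k x)]))"
    by blast
  moreover have "outp \<dots>"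
    by (rule outp_filter) (intro definable_intros definable_pred_pow2 assms)+
  ultimately show ?thesis by simp
qed

lemma encode_eq:
  assumes "pverts G = {..<N}"
  shows "encode G k = replicate N True @ [False] @
    map (\<lambda>i. (i div N, i mod N) \<in> parcs G) [0..<N * N] @ bits k"
proof -
  have "map (\<lambda>ij. ij \<in> parcs G) (List.product [0..<N] [0..<N]) =
      map (\<lambda>i. (i div N, i mod N) \<in> parcs G) [0..<N * N]"
  proof (rule nth_equalityI)
    fix i assume "i < length (map (\<lambda>ij. ij \<in> parcs G) (List.product [0..<N] [0..<N]))"
    then have i: "i < N * N" by simp
    then have "0 < N" by (cases "N") auto
    then have "i div N < N" "i mod N < N" using i by (simp_all add: less_mult_imp_div_less)
    then show "map (\<lambda>ij. ij \<in> parcs G) (List.product [0..<N] [0..<N]) ! i =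
        map (\<lambda>i. (i div N, i mod N) \<in> parcs G) [0..<N * N] ! i"
      using i by (simp add: product_nth)
  qed simp
  then show ?thesis by (simp add: encode_def Let_def assms)
qed

lemma outp_encode:
  assumes "definable (\<lambda>x y E. N x)" "definable (\<lambda>x y E. k x)" "definable_pred (\<lambda>x y E. A x (E 0) (E 1))"
    and G: "\<And>x. pverts (G x) = {..<N x}"
    "\<And>x i j. i < N x \<Longrightarrow> j < N x \<Longrightarrow> (i, j) \<in> parcs (G x) \<longleftrightarrow> A x i j"
  shows "outp (\<lambda>x. encode (G x) (k x))"
proof -
  have "encode (G x) (k x) = map (\<lambda>i. True) [0..<N x] @ map (\<lambda>i. False) [0..<1] @
      map (\<lambda>i. A x (i div N x) (i mod N x)) [0..<N x * N x] @ bits (k x)" for x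
  proof -
    have "(i div N x, i mod N x) \<in> parcs (G x) \<longleftrightarrow> A x (i div N x) (i mod N x)" if "i < N x * N x" for i
    proof (rule G(2))
      show "i div N x < N x" using that by (simp add: less_mult_imp_div_less)
      show "i mod N x < N x" using that by (cases "N x") auto
    qed
    then show ?thesis by (simp add: encode_eq[OF G(1)] map_replicate_const)
  qed
  moreover have "definable_pred (\<lambda>x y E. A x (E 0 div N x) (E 0 mod N x))"
  proof -
    have "definable_pred (\<lambda>x y E. A x (E 0) (E 1 mod N x))"
      by (rule definable_let[where g = "\<lambda>x y E b. of_bool (A x (E 0) b)" and a = "\<lambda>x y E. E 1 mod N x"])
        (intro definable_intros assms definable_ren[OF assms(3), of "\<lambda>i. if i = 0 then 1 else 0", simplified])+
    from definable_ren[OF this, of "\<lambda>i. if i = 0 then 0 else 1", simplified]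
    show ?thesis
      by (intro definable_let[where g = "\<lambda>x y E a. of_bool (A x a (E 0 mod N x))" and a = "\<lambda>x y E. E 0 div N x"])
        (intro definable_intros assms | simp)+
  qed
  ultimately show ?thesis
    by (simp only:) (intro outp_append outp_map outp_bits definable_const assms definable_intros)
qed

section \<open>GP5-graphs and semipaired domination\<close>

definition near :: "nat pair_pre_digraph \<Rightarrow> nat \<Rightarrow> nat \<Rightarrow> bool" where
  "near G u v \<longleftrightarrow> u = v \<or> (u, v) \<in> parcs G \<or> (\<exists>w\<in>pverts G. (u, w) \<in> parcs G \<and> (w, v) \<in> parcs G)"

text \<open>The distance is an infimum of walk costs. These are natural numbers, so if no walk had
  length at most 2, the infimum would be at least 3.\<close>

lemma gdist_le_2:
  assumes "pair_graph G" "u \<in> pverts G" "v \<in> pverts G"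
  shows "gdist G u v \<le> 2 \<longleftrightarrow> near G u v"
proof -
  interpret pair_graph G by fact
  have cost: "awalk_cost (\<lambda>_. 1) p = real (length p)" for p :: "(nat \<times> nat) list"
    by (induction p) auto
  show ?thesis
  proof
    assume le: "gdist G u v \<le> 2"
    have "\<exists>p. awalk u p v \<and> length p \<le> 2"
    proof (rule ccontr)
      assume "\<not> ?thesis"
      then have "3 \<le> awalk_cost (\<lambda>_. 1) p" if "awalk u p v" for p
        using that unfolding cost by force
      then have "ereal 3 \<le> gdist G u v"
        unfolding gdist_def \<mu>_def by (intro INF_greatest) auto
      from order_trans[OF this le] show False by simp
    qed
    then obtain p where p: "awalk u p v" "length p \<le> 2" by blast
    then consider "p = []" | e where "p = [e]" | e f where "p = [e, f]"
      by (cases p rule: remdups_adj.cases) auto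
    then show "near G u v"
    proof cases
      case (2 e)
      then show ?thesis using p by (cases e) (auto simp: awalk_simps near_def)
    next
      case (3 e f)
      then show ?thesis using p by (cases e; cases f) (auto simp: awalk_simps near_def dest: in_arcsD1)
    qed (use p in \<open>auto simp: awalk_simps near_def\<close>)
  next
    assume "near G u v"
    then obtain p where "awalk u p v" "length p \<le> 2"
    proof (unfold near_def, elim disjE bexE conjE)
      assume "u = v" then show ?thesis using assms by (intro that[of "[]"]) (auto simp: awalk_simps)
    next
      assume "(u, v) \<in> parcs G"
      then show ?thesis using assms by (intro that[of "[(u, v)]"]) (auto simp: awalk_simps)
    next
      fix w assume "(u, w) \<in> parcs G" "(w, v) \<in> parcs G"
      then show ?thesis using assms by (intro that[of "[(u, w), (w, v)]"]) (auto simp: awalk_simps)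
    qed
    then have "gdist G u v \<le> ereal (length p)"
      unfolding gdist_def using min_cost_le_walk_cost[of u p v "\<lambda>_. 1"] by (simp add: cost)
    also have "\<dots> \<le> 2" using \<open>length p \<le> 2\<close> by simp
    finally show "gdist G u v \<le> 2" .
  qed
qed

text \<open>A pairing of a dominating set is an involution moving exactly its elements.\<close>

lemma semipaired_iff_involution:
  assumes G: "pair_graph G"
  shows "(\<exists>D. semipaired_dominating_set G D \<and> card D \<le> k) \<longleftrightarrow>
    (\<exists>\<mu>. (\<forall>z\<in>pverts G. \<mu> z \<in> pverts G \<and> \<mu> (\<mu> z) = z \<and> near G z (\<mu> z)) \<and>
       (\<forall>z\<in>pverts G. \<mu> z = z \<longrightarrow> (\<exists>u\<in>pverts G. \<mu> u \<noteq> u \<and> (z, u) \<in> parcs G)) \<and>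
       card {z \<in> pverts G. \<mu> z \<noteq> z} \<le> k)"
    (is "_ \<longleftrightarrow> (\<exists>\<mu>. ?Inv \<mu> \<and> ?Dom \<mu> \<and> ?Card \<mu>)")
proof -
  interpret pair_graph G by fact
  have sym: "(u, v) \<in> parcs G \<Longrightarrow> (v, u) \<in> parcs G" for u v using arcs_symmetric by blast
  show ?thesis
  proof
    assume "\<exists>D. semipaired_dominating_set G D \<and> card D \<le> k"
    then obtain D where spd: "semipaired_dominating_set G D" and k: "card D \<le> k" by blast
    then have D: "D \<subseteq> pverts G" "\<And>w. w \<in> pverts G - D \<Longrightarrow> \<exists>u\<in>D. (w, u) \<in> parcs G"
      by (simp_all add: semipaired_dominating_set_def dominating_set_def)
    have "\<exists>P. partition_on D P \<and> (\<forall>S\<in>P. \<exists>u v. S = {u, v} \<and> u \<noteq> v \<and> gdist G u v \<le> 2)"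
      using spd unfolding semipaired_dominating_set_def by (rule conjunct2)
    then obtain P where PP: "partition_on D P \<and> (\<forall>S\<in>P. \<exists>u v. S = {u, v} \<and> u \<noteq> v \<and> gdist G u v \<le> 2)"
      by (rule exE)
    note P = PP[THEN conjunct1] PP[THEN conjunct2, rule_format]
    have ex: "\<exists>w. w \<noteq> z \<and> {z, w} \<in> P \<and> near G z w" if z: "z \<in> D" for z
    proof -
      obtain S where S: "S \<in> P" "z \<in> S" using P(1) z by (auto simp: partition_on_def)
      obtain u v where uv: "S = {u, v}" "u \<noteq> v" "gdist G u v \<le> 2" using P(2)[OF S(1)] by blast
      then have "u \<in> pverts G" "v \<in> pverts G" using S P(1) D(1) by (auto simp: partition_on_def)
      then have "near G u v" using uv gdist_le_2[OF G] by simp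
      moreover have "near G v u" using calculation sym unfolding near_def by blast
      ultimately show ?thesis using S uv by (auto simp: insert_commute)
    qed
    define m where "m z = (SOME w. w \<noteq> z \<and> {z, w} \<in> P \<and> near G z w)" for z
    have m: "m z \<noteq> z \<and> {z, m z} \<in> P \<and> near G z (m z)" if "z \<in> D" for z
      unfolding m_def by (rule someI_ex) (rule ex[OF that])
    define \<mu> where "\<mu> z = (if z \<in> D then m z else z)" for z
    have mD: "m z \<in> D" if "z \<in> D" for z
      using m[OF that] P(1) by (auto simp: partition_on_def)
    have mm: "m (m z) = z" if z: "z \<in> D" for z
    proof -
      have "{z, m z} \<in> P" "{m z, m (m z)} \<in> P" using m z mD by auto
      then have "{z, m z} = {m z, m (m z)}"
        using partition_onD2[OF P(1)] disjointD[of P "{z, m z}" "{m z, m (m z)}"] by blast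
      then show ?thesis using m[OF z] by (auto simp: doubleton_eq_iff)
    qed
    have "{z \<in> pverts G. \<mu> z \<noteq> z} = D" using D(1) m by (auto simp: \<mu>_def)
    moreover have "?Inv \<mu>" using D(1) m mD mm by (auto simp: \<mu>_def near_def)
    moreover have "?Dom \<mu>"
    proof (intro ballI impI)
      fix z assume "z \<in> pverts G" "\<mu> z = z"
      then have "z \<notin> D" using m by (auto simp: \<mu>_def)
      then obtain u where "u \<in> D" "(z, u) \<in> parcs G" using D(2) \<open>z \<in> pverts G\<close> by blast
      then show "\<exists>u\<in>pverts G. \<mu> u \<noteq> u \<and> (z, u) \<in> parcs G"
        using D(1) m by (intro bexI[of _ u]) (auto simp: \<mu>_def)
    qed
    ultimately show "\<exists>\<mu>. ?Inv \<mu> \<and> ?Dom \<mu> \<and> ?Card \<mu>"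
      using k by (intro exI[of _ \<mu>] conjI) simp_all
  next
    assume "\<exists>\<mu>. ?Inv \<mu> \<and> ?Dom \<mu> \<and> ?Card \<mu>"
    then obtain \<mu> where \<mu>: "?Inv \<mu>" "?Dom \<mu>" "?Card \<mu>" by blast
    define D where "D = {z \<in> pverts G. \<mu> z \<noteq> z}"
    have D: "\<mu> z \<in> D" "\<mu> (\<mu> z) = z" "\<mu> z \<noteq> z" if "z \<in> D" for z using that \<mu>(1) by (auto simp: D_def)
    have "partition_on D ((\<lambda>z. {z, \<mu> z}) ` D)"
    proof (rule partition_onI)
      show "\<Union> ((\<lambda>z. {z, \<mu> z}) ` D) = D" using D by auto
    next
      fix p q assume "p \<in> (\<lambda>z. {z, \<mu> z}) ` D" "q \<in> (\<lambda>z. {z, \<mu> z}) ` D" "p \<noteq> q"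
      then obtain y z where yz: "p = {y, \<mu> y}" "q = {z, \<mu> z}" "y \<in> D" "z \<in> D" "p \<noteq> q" by blast
      note mm = D(2)[OF yz(3)] D(2)[OF yz(4)]
      have "y \<noteq> z" using yz by auto
      moreover have "\<mu> y \<noteq> \<mu> z" using mm \<open>y \<noteq> z\<close> by metis
      moreover have "y \<noteq> \<mu> z" "z \<noteq> \<mu> y" using yz mm by auto
      ultimately show "disjnt p q" unfolding disjnt_def yz(1,2) by simp
    qed auto
    moreover have "gdist G z (\<mu> z) \<le> 2" if "z \<in> D" for z
      using that \<mu>(1) gdist_le_2[OF G] by (auto simp: D_def)
    ultimately have "\<exists>P. partition_on D P \<and> (\<forall>S\<in>P. \<exists>u v. S = {u, v} \<and> u \<noteq> v \<and> gdist G u v \<le> 2)"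
      using D(3) by (intro exI[of _ "(\<lambda>z. {z, \<mu> z}) ` D"]) fastforce
    moreover have "dominating_set G D" using \<mu>(2) unfolding dominating_set_def D_def by auto
    ultimately show "\<exists>D. semipaired_dominating_set G D \<and> card D \<le> k"
      using \<mu>(3) unfolding semipaired_dominating_set_def D_def by blast
  qed
qed

section \<open>Connectivity by ranks\<close>

lemma connected_iff_root:
  assumes "pair_graph H" "z \<in> pverts H"
  shows "connected (with_proj H) \<longleftrightarrow> (\<forall>u\<in>pverts H. (u, z) \<in> (parcs H)\<^sup>*)"
proof -
  interpret pair_graph H by fact
  have sym: "sym (parcs H)" using pair_sym_arcs by (simp add: symmetric_def)
  then have "(parcs H)\<^sup>s = parcs H" by (auto simp: symcl_def sym_def)
  moreover have "(u, v) \<in> rtrancl_on (pverts H) (parcs H) \<longleftrightarrow> (u, v) \<in> (parcs H)\<^sup>*" if "u \<in> pverts H" for u v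
  proof
    assume "(u, v) \<in> rtrancl_on (pverts H) (parcs H)"
    then show "(u, v) \<in> (parcs H)\<^sup>*" by (induction) auto
  next
    assume "(u, v) \<in> (parcs H)\<^sup>*"
    then show "(u, v) \<in> rtrancl_on (pverts H) (parcs H)"
      by (induction) (auto intro: rtrancl_on_into_rtrancl_on that in_arcsD2)
  qed
  ultimately have *: "connected (with_proj H) \<longleftrightarrow> (\<forall>u\<in>pverts H. \<forall>v\<in>pverts H. (u, v) \<in> (parcs H)\<^sup>*)"
    using assms(2) unfolding connected_conv by auto
  have "sym ((parcs H)\<^sup>*)" using sym by (rule sym_rtrancl)
  then show ?thesis unfolding * using assms(2) by (meson rtrancl_trans symD)
qed

text \<open>Connectivity is certified by ranks that decrease along some arc from every vertex but the root.\<close>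

lemma rank_exists:
  assumes "finite V" "z \<in> V" "\<forall>u\<in>V. (u, z) \<in> R\<^sup>*" "R \<subseteq> V \<times> V"
  obtains rk :: "'a \<Rightarrow> nat" where "\<And>u. u \<in> V \<Longrightarrow> rk u < card V"
    "\<And>u. u \<in> V \<Longrightarrow> u \<noteq> z \<Longrightarrow> \<exists>w\<in>V. (u, w) \<in> R \<and> rk w < rk u"
proof -
  define rk where "rk u = (LEAST k. (u, z) \<in> R ^^ k)" for u
  have ex: "\<exists>k. (u, z) \<in> R ^^ k" if "u \<in> V" for u using assms(3) that rtrancl_imp_relpow by fast
  have rk: "(u, z) \<in> R ^^ rk u" if "u \<in> V" for u unfolding rk_def using ex[OF that] by (rule LeastI_ex)
  have le: "rk u \<le> k" if "(u, z) \<in> R ^^ k" for u k unfolding rk_def using that by (rule Least_le)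
  have step: "\<exists>w\<in>V. (u, w) \<in> R \<and> rk u = Suc (rk w)" if u: "u \<in> V" "u \<noteq> z" for u
  proof -
    obtain k where k: "rk u = Suc k" using rk[OF u(1)] u(2) by (cases "rk u") auto
    then obtain w where w: "(u, w) \<in> R" "(w, z) \<in> R ^^ k" using rk[OF u(1)] by (metis relpow_Suc_D2)
    then have "w \<in> V" using assms(4) by auto
    moreover have "rk w \<le> k" using le w(2) by blast
    moreover have "(u, z) \<in> R ^^ Suc (rk w)" using w(1) rk[OF \<open>w \<in> V\<close>] by (rule relpow_Suc_I2)
    then have "Suc k \<le> Suc (rk w)" using le k by metis
    ultimately show ?thesis using w k by auto
  qed
  \<comment> \<open>Along a shortest path all smaller ranks occur, so a rank is less than
    \<open>card V\<close>. The certificate relies on this bound to store ranks.\<close>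
  have img: "{..rk u} \<subseteq> rk ` V" if "u \<in> V" for u using that
  proof (induction "rk u" arbitrary: u)
    case 0
    then show ?case by force
  next
    case (Suc k)
    have "u \<noteq> z"
    proof
      assume "u = z"
      then have "rk u \<le> 0" by (intro le) simp
      then show False using Suc by simp
    qed
    then obtain w where "w \<in> V" "rk u = Suc (rk w)" using step Suc.prems by blast
    moreover have "rk u \<in> rk ` V" using Suc.prems by blast
    moreover have "{..rk w} \<subseteq> rk ` V" using calculation Suc.hyps(2) by (intro Suc.hyps(1)) auto
    ultimately show ?case by (auto simp: atMost_Suc)
  qed
  have "rk u < card V" if "u \<in> V" for u
    using card_mono[OF _ img[OF that]] card_image_le[OF assms(1), of rk] assms(1) by fastforce
  then show thesis using that step by (metis lessI)
qed

lemma rank_reaches: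
  fixes rk :: "'a \<Rightarrow> nat"
  assumes "\<And>u. u \<in> V \<Longrightarrow> u \<noteq> z \<Longrightarrow> \<exists>w\<in>V. (u, w) \<in> R \<and> rk w < rk u" "u \<in> V"
  shows "(u, z) \<in> R\<^sup>*"
  using assms(2)
proof (induction "rk u" arbitrary: u rule: less_induct)
  case less
  then show ?case using assms(1)[OF less.prems] by (cases "u = z") (auto intro: converse_rtrancl_into_rtrancl)
qed

text \<open>Canonical vertex numbers: the vertices \<open>v, a, b, c, d, e\<close> with index \<open>i\<close> are
  \<open>i, n + i, \<dots>, 5 * n + i\<close>.\<close>

definition leg :: "nat \<Rightarrow> nat \<Rightarrow> nat \<Rightarrow> bool" where
  "leg n p q \<longleftrightarrow> (\<exists>i<n. p = i \<and> q = 3 * n + i \<or> p = 3 * n + i \<and> q = 2 * n + i \<or>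
     p = 3 * n + i \<and> q = 4 * n + i \<or> p = 2 * n + i \<and> q = n + i \<or> p = 4 * n + i \<and> q = 5 * n + i)"

lemma leg_image:
  "(\<lambda>(p, q). (\<pi> p, \<pi> q)) ` {(p, q). leg n p q} =
    (\<Union>i<n. {(\<pi> i, \<pi> (3 * n + i)), (\<pi> (3 * n + i), \<pi> (2 * n + i)), (\<pi> (3 * n + i), \<pi> (4 * n + i)),
      (\<pi> (2 * n + i), \<pi> (n + i)), (\<pi> (4 * n + i), \<pi> (5 * n + i))})"
proof -
  have "{(p, q). leg n p q} = (\<Union>i<n. {(i, 3 * n + i), (3 * n + i, 2 * n + i), (3 * n + i, 4 * n + i),
      (2 * n + i, n + i), (4 * n + i, 5 * n + i)})"
    unfolding leg_def by blast
  then show ?thesis by (simp add: image_UN)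
qed

lemma concat_blocks:
  assumes "0 < (n::nat)"
  shows "concat (map (\<lambda>r. map (g r) [0..<n]) [0..<k]) = map (\<lambda>p. g (p div n) (p mod n)) [0..<k * n]"
proof (induction k)
  case (Suc k)
  have "[0..<Suc k * n] = [0..<k * n] @ map (\<lambda>i. i + k * n) [0..<n]"
    using upt_add_eq_append[of 0 "k * n" n] by (subst map_add_upt) (simp add: add.commute)
  then show ?case using Suc assms by (simp add: o_def)
qed simp

text \<open>\<open>\<pi>\<close> sends canonical numbers to vertices. Arcs between numbers below
  \<open>n\<close> are left open, since these vertices form \<open>H\<close>; the last clause
  certifies that \<open>H\<close> is connected, with root \<open>\<pi> 0\<close>. Ranks belong to
  vertices, not to canonical numbers.\<close>

definition gp5_layout :: "nat pair_pre_digraph \<Rightarrow> nat \<Rightarrow> nat \<Rightarrow> (nat \<Rightarrow> nat) \<Rightarrow> (nat \<Rightarrow> nat) \<Rightarrow> bool" where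
  "gp5_layout G N n \<pi> rk \<longleftrightarrow> N = 6 * n \<and> 0 < n \<and> (\<forall>p<N. \<pi> p < N \<and> rk p < N) \<and>
     (\<forall>p<N. \<forall>q<N. \<pi> p = \<pi> q \<longrightarrow> p = q) \<and>
     (\<forall>p<N. \<forall>q<N. \<not> (p < n \<and> q < n) \<longrightarrow> ((\<pi> p, \<pi> q) \<in> parcs G \<longleftrightarrow> leg n p q \<or> leg n q p)) \<and>
     (\<forall>p<n. 0 < p \<longrightarrow> (\<exists>q<n. (\<pi> p, \<pi> q) \<in> parcs G \<and> rk (\<pi> q) < rk (\<pi> p)))"

text \<open>The six vertex families are glued into a single permutation, and \<open>H\<close> is
  recovered as the subgraph on its first block. The existence of a graph and six functions thus
  becomes that of a number and two functions with values below \<open>N\<close>, which can be tested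
  and stored.\<close>

lemma gp5_graph_iff_layout:
  assumes N: "pverts G = {..<N}"
  shows "gp5_graph G \<longleftrightarrow> pair_graph G \<and> (\<exists>n \<pi> rk. gp5_layout G N n \<pi> rk)"
proof
  assume gp5: "gp5_graph G"
  then obtain H n v a b c d e where H: "pair_graph H" and conn: "connected (with_proj H)"
    and V: "pverts H = v ` {..<n}"
    and dist: "distinct (concat (map (\<lambda>f. map f [0..<n]) [v, a, b, c, d, e]))"
    and vG: "pverts G = pverts H \<union> (\<Union>i<n. {a i, b i, c i, d i, e i})"
    and eG: "parcs G = parcs H
      \<union> (\<Union>i<n. {(v i, c i), (c i, b i), (c i, d i), (b i, a i), (d i, e i)})
      \<union> (\<Union>i<n. {(v i, c i), (c i, b i), (c i, d i), (b i, a i), (d i, e i)})\<inverse>"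
    unfolding gp5_graph_def Let_def by (elim exE conjE) (rule that, assumption+)
  have n: "0 < n" using conn V by (auto simp: connected_conv)
  define \<pi> where "\<pi> p = ([v, a, b, c, d, e] ! (p div n)) (p mod n)" for p
  have six: "[v, a, b, c, d, e] = map (\<lambda>r. [v, a, b, c, d, e] ! r) [0..<6]"
    by (simp add: upt_rec eval_nat_numeral)
  have L: "concat (map (\<lambda>f. map f [0..<n]) [v, a, b, c, d, e]) = map \<pi> [0..<6 * n]"
    unfolding \<pi>_def concat_blocks[OF n, symmetric, where g = "\<lambda>r. [v, a, b, c, d, e] ! r"]
    by (subst six) (simp only: map_map o_def)
  have inj: "inj_on \<pi> {0..<6 * n}" using dist unfolding L by (simp add: distinct_map)
  have "pverts G = set (concat (map (\<lambda>f. map f [0..<n]) [v, a, b, c, d, e]))"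
    unfolding vG V by (auto simp: lessThan_atLeast0)
  then have img: "\<pi> ` {0..<6 * n} = {..<N}" unfolding L N by simp
  then have "N = 6 * n" using card_image[OF inj] by simp
  have gen: "\<pi> (r * n + i) = ([v, a, b, c, d, e] ! r) i" if "i < n" for r i
    using that by (simp add: \<pi>_def)
  have \<pi>: "\<pi> i = v i" "\<pi> (n + i) = a i" "\<pi> (2 * n + i) = b i" "\<pi> (3 * n + i) = c i"
    "\<pi> (4 * n + i) = d i" "\<pi> (5 * n + i) = e i" if "i < n" for i
    using gen[OF that, of 0] gen[OF that, of 1] gen[OF that, of 2] gen[OF that, of 3]
      gen[OF that, of 4] gen[OF that, of 5] by simp_all
  have E: "(\<Union>i<n. {(v i, c i), (c i, b i), (c i, d i), (b i, a i), (d i, e i)}) =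
      (\<lambda>(p, q). (\<pi> p, \<pi> q)) ` {(p, q). leg n p q}" (is "?E = ?F")
    unfolding leg_image by (simp add: \<pi>)
  have leg_less: "p < 6 * n" "q < 6 * n" if "leg n p q" for p q using that by (auto simp: leg_def)
  have E_iff: "(\<pi> p, \<pi> q) \<in> ?E \<longleftrightarrow> leg n p q" if "p < 6 * n" "q < 6 * n" for p q
  proof
    assume "(\<pi> p, \<pi> q) \<in> ?E"
    then obtain p' q' where "leg n p' q'" "\<pi> p = \<pi> p'" "\<pi> q = \<pi> q'" unfolding E by auto
    then show "leg n p q"
      using leg_less inj_onD[OF inj, of p p'] inj_onD[OF inj, of q q'] that by simp
  qed (auto simp: E)
  have vp: "v ` {..<n} = \<pi> ` {..<n}" using \<pi>(1) by auto
  interpret H: pair_graph H by fact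
  have sub: "parcs H \<subseteq> \<pi> ` {..<n} \<times> \<pi> ` {..<n}" using H.in_arcsD1 H.in_arcsD2 V vp by auto
  have notH: "(\<pi> p, \<pi> q) \<notin> parcs H" if "p < 6 * n" "q < 6 * n" "\<not> (p < n \<and> q < n)" for p q
  proof
    assume "(\<pi> p, \<pi> q) \<in> parcs H"
    then obtain p' q' where "p' < n" "q' < n" "\<pi> p = \<pi> p'" "\<pi> q = \<pi> q'" using sub by auto
    then show False using inj_onD[OF inj, of p p'] inj_onD[OF inj, of q q'] that by auto
  qed
  have "v 0 \<in> pverts H" using V n by auto
  then have reach: "\<forall>u\<in>pverts H. (u, v 0) \<in> (parcs H)\<^sup>*" using connected_iff_root[OF H] conn by blast
  have subH: "parcs H \<subseteq> pverts H \<times> pverts H" using H.in_arcsD1 H.in_arcsD2 by auto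
  obtain rk :: "nat \<Rightarrow> nat" where rk: "\<And>u. u \<in> pverts H \<Longrightarrow> rk u < card (pverts H)"
    "\<And>u. u \<in> pverts H \<Longrightarrow> u \<noteq> v 0 \<Longrightarrow> \<exists>w\<in>pverts H. (u, w) \<in> parcs H \<and> rk w < rk u"
    by (rule rank_exists[OF H.pair_finite_verts \<open>v 0 \<in> pverts H\<close> reach subH]) blast
  define rk' where "rk' u = (if u \<in> pverts H then rk u else 0)" for u
  have cH: "card (pverts H) \<le> n" unfolding V by (metis card_image_le card_lessThan finite_lessThan)
  have rk': "rk' u < N" for u
    using rk(1)[of u] cH n \<open>N = 6 * n\<close> by (auto simp: rk'_def)
  have dec: "\<exists>q<n. (\<pi> p, \<pi> q) \<in> parcs G \<and> rk' (\<pi> q) < rk' (\<pi> p)" if p: "p < n" "0 < p" for p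
  proof -
    have "\<pi> p \<noteq> \<pi> 0" using inj_onD[OF inj, of p 0] p n by auto
    then obtain w where "w \<in> pverts H" "(\<pi> p, w) \<in> parcs H" "rk w < rk (\<pi> p)"
      using rk(2)[of "\<pi> p"] V vp p \<pi>(1)[of 0] n by auto
    then show ?thesis using V vp p unfolding eG rk'_def by auto
  qed
  have "gp5_layout G N n \<pi> rk'"
    unfolding gp5_layout_def
  proof (intro conjI allI impI)
    show "\<pi> p < N" if "p < N" for p using img that \<open>N = 6 * n\<close> by auto
    show "p = q" if "p < N" "q < N" "\<pi> p = \<pi> q" for p q
      using inj_onD[OF inj] that \<open>N = 6 * n\<close> by simp
    show "(\<pi> p, \<pi> q) \<in> parcs G \<longleftrightarrow> leg n p q \<or> leg n q p"
      if "p < N" "q < N" "\<not> (p < n \<and> q < n)" for p q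
      using that notH[of p q] E_iff[of p q] E_iff[of q p] \<open>N = 6 * n\<close> unfolding eG Un_iff converse_iff by blast
  qed (use n \<open>N = 6 * n\<close> rk' dec in auto)
  then show "pair_graph G \<and> (\<exists>n \<pi> rk. gp5_layout G N n \<pi> rk)" using pair_graph_gp5[OF gp5] by blast
next
  assume "pair_graph G \<and> (\<exists>n \<pi> rk. gp5_layout G N n \<pi> rk)"
  then obtain n \<pi> rk where G: "pair_graph G" and lay: "gp5_layout G N n \<pi> rk" by blast
  interpret pair_graph G by fact
  have Nn: "N = 6 * n" and n: "0 < n" and lt: "\<And>p. p < N \<Longrightarrow> \<pi> p < N"
    and inj: "\<And>p q. p < N \<Longrightarrow> q < N \<Longrightarrow> \<pi> p = \<pi> q \<Longrightarrow> p = q"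
    and adj: "\<And>p q. p < N \<Longrightarrow> q < N \<Longrightarrow> \<not> (p < n \<and> q < n) \<Longrightarrow>
       (\<pi> p, \<pi> q) \<in> parcs G \<longleftrightarrow> leg n p q \<or> leg n q p"
    and dec: "\<And>p. p < n \<Longrightarrow> 0 < p \<Longrightarrow> \<exists>q<n. (\<pi> p, \<pi> q) \<in> parcs G \<and> rk (\<pi> q) < rk (\<pi> p)"
    using lay unfolding gp5_layout_def by auto
  have "inj_on \<pi> {..<N}" using inj by (auto simp: inj_on_def)
  then have img: "\<pi> ` {..<N} = {..<N}" using lt by (intro endo_inj_surj) auto
  define H :: "nat pair_pre_digraph" where
    "H = \<lparr> pverts = \<pi> ` {..<n}, parcs = parcs G \<inter> (\<pi> ` {..<n} \<times> \<pi> ` {..<n}) \<rparr>"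
  have sym: "(u, v) \<in> parcs G \<Longrightarrow> (v, u) \<in> parcs G" for u v using arcs_symmetric by blast
  have H: "pair_graph H"
    using sym pair_finite_arcs by unfold_locales
      (auto simp: H_def symmetric_def sym_def no_loops' intro: pair_no_loops)
  have "connected (with_proj H)"
  proof (subst connected_iff_root[OF H, of "\<pi> 0"])
    show "\<pi> 0 \<in> pverts H" using n by (auto simp: H_def)
    have "\<exists>w\<in>pverts H. (u, w) \<in> parcs H \<and> rk w < rk u" if u: "u \<in> pverts H" "u \<noteq> \<pi> 0" for u
    proof -
      obtain p where "p < n" "u = \<pi> p" using u(1) by (auto simp: H_def)
      moreover from this have "p \<noteq> 0" using u(2) by (intro notI) simp
      ultimately show ?thesis using dec[of p] by (auto simp: H_def)
    qed
    then show "\<forall>u\<in>pverts H. (u, \<pi> 0) \<in> (parcs H)\<^sup>*" using rank_reaches[of "pverts H" "\<pi> 0" "parcs H" rk] by blast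
  qed
  moreover have "distinct (concat (map (\<lambda>f. map f [0..<n])
      [\<pi>, \<lambda>i. \<pi> (n + i), \<lambda>i. \<pi> (2 * n + i), \<lambda>i. \<pi> (3 * n + i), \<lambda>i. \<pi> (4 * n + i), \<lambda>i. \<pi> (5 * n + i)]))"
  proof -
    have "concat (map (\<lambda>f. map f [0..<n])
      [\<pi>, \<lambda>i. \<pi> (n + i), \<lambda>i. \<pi> (2 * n + i), \<lambda>i. \<pi> (3 * n + i), \<lambda>i. \<pi> (4 * n + i), \<lambda>i. \<pi> (5 * n + i)]) =
      concat (map (\<lambda>r. map (\<lambda>i. \<pi> (r * n + i)) [0..<n]) [0..<6])"
      by (simp add: upt_rec[of _ 6] eval_nat_numeral upt_rec[of _ "Suc _"] del: upt_Suc)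
    also have "\<dots> = map \<pi> [0..<6 * n]" by (subst concat_blocks[OF n]) simp
    finally show ?thesis using inj Nn by (simp add: distinct_map inj_on_def)
  qed
  moreover have "pverts G = pverts H \<union> (\<Union>i<n. {\<pi> (n + i), \<pi> (2 * n + i), \<pi> (3 * n + i), \<pi> (4 * n + i), \<pi> (5 * n + i)})"
  proof
    show "pverts G \<subseteq> pverts H \<union> (\<Union>i<n. {\<pi> (n + i), \<pi> (2 * n + i), \<pi> (3 * n + i), \<pi> (4 * n + i), \<pi> (5 * n + i)})"
    proof
      fix u assume "u \<in> pverts G"
      then obtain p where p: "p < 6 * n" "u = \<pi> p" using N img Nn by auto
      define r i where "r = p div n" and "i = p mod n"
      have i: "i < n" "r < 6" "p = r * n + i"
        using p n by (simp_all add: less_mult_imp_div_less r_def i_def)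
      then have "r = 0 \<or> r = 1 \<or> r = 2 \<or> r = 3 \<or> r = 4 \<or> r = 5" by linarith
      then have "p = i \<or> p = n + i \<or> p = 2 * n + i \<or> p = 3 * n + i \<or> p = 4 * n + i \<or> p = 5 * n + i"
        unfolding i(3) by (elim disjE) simp_all
      then show "u \<in> pverts H \<union> (\<Union>i<n. {\<pi> (n + i), \<pi> (2 * n + i), \<pi> (3 * n + i), \<pi> (4 * n + i), \<pi> (5 * n + i)})"
        using p(2) i(1) by (auto simp: H_def)
    qed
    show "pverts H \<union> (\<Union>i<n. {\<pi> (n + i), \<pi> (2 * n + i), \<pi> (3 * n + i), \<pi> (4 * n + i), \<pi> (5 * n + i)}) \<subseteq> pverts G"
      unfolding N using lt Nn by (auto simp: H_def)
  qed
  moreover have "parcs G = parcs H \<union>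
      (\<Union>i<n. {(\<pi> i, \<pi> (3 * n + i)), (\<pi> (3 * n + i), \<pi> (2 * n + i)), (\<pi> (3 * n + i), \<pi> (4 * n + i)),
        (\<pi> (2 * n + i), \<pi> (n + i)), (\<pi> (4 * n + i), \<pi> (5 * n + i))}) \<union>
      (\<Union>i<n. {(\<pi> i, \<pi> (3 * n + i)), (\<pi> (3 * n + i), \<pi> (2 * n + i)), (\<pi> (3 * n + i), \<pi> (4 * n + i)),
        (\<pi> (2 * n + i), \<pi> (n + i)), (\<pi> (4 * n + i), \<pi> (5 * n + i))})\<inverse>" (is "_ = _ \<union> ?E \<union> _")
  proof -
    have E: "(u, w) \<in> ?E \<longleftrightarrow> (\<exists>p q. u = \<pi> p \<and> w = \<pi> q \<and> leg n p q)" for u w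
      unfolding leg_image[symmetric] by auto
    have leg_less: "p < N" "q < N" "\<not> (p < n \<and> q < n)" if "leg n p q" for p q
      using that by (auto simp: leg_def Nn)
    have "(u, w) \<in> parcs G \<longleftrightarrow> (u, w) \<in> parcs H \<or> (u, w) \<in> ?E \<or> (w, u) \<in> ?E" for u w
    proof
      assume uw: "(u, w) \<in> parcs G"
      then have "u \<in> \<pi> ` {..<N}" "w \<in> \<pi> ` {..<N}" unfolding img using in_arcsD1 in_arcsD2 N by auto
      then obtain p q where pq: "u = \<pi> p" "w = \<pi> q" "p < N" "q < N" by auto
      show "(u, w) \<in> parcs H \<or> (u, w) \<in> ?E \<or> (w, u) \<in> ?E"
      proof (cases "p < n \<and> q < n")
        case True
        then show ?thesis using uw by (simp add: H_def pq(1,2))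
      next
        case False
        then have "leg n p q \<or> leg n q p" using adj[OF pq(3,4) False] uw pq(1,2) by simp
        then show ?thesis unfolding E using pq(1,2) by blast
      qed
    next
      assume "(u, w) \<in> parcs H \<or> (u, w) \<in> ?E \<or> (w, u) \<in> ?E"
      moreover have "(\<pi> p, \<pi> q) \<in> parcs G" if "leg n p q" for p q
        using adj[OF leg_less[OF that]] that by simp
      ultimately show "(u, w) \<in> parcs G"
        unfolding E using sym by (elim disjE exE conjE) (simp_all add: H_def)
    qed
    then show ?thesis by (auto simp only: set_eq_iff split_paired_All Un_iff converse_iff)
  qed
  moreover have "pverts H = \<pi> ` {..<n}" by (simp add: H_def)
  ultimately show "gp5_graph G"
    unfolding gp5_graph_def Let_def using H
    by (intro exI[of _ H] exI[of _ n] exI[of _ \<pi>] exI[of _ "\<lambda>i. \<pi> (n + i)"] exI[of _ "\<lambda>i. \<pi> (2 * n + i)"]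
      exI[of _ "\<lambda>i. \<pi> (3 * n + i)"] exI[of _ "\<lambda>i. \<pi> (4 * n + i)"] exI[of _ "\<lambda>i. \<pi> (5 * n + i)"])
      (intro conjI; assumption)
qed

section \<open>Set cover as semipaired domination\<close>

definition gadj :: "nat \<Rightarrow> (nat \<Rightarrow> nat \<Rightarrow> bool) \<Rightarrow> nat \<Rightarrow> nat \<Rightarrow> bool" where
  "gadj n h p q \<longleftrightarrow> p < n \<and> q < n \<and> h p q \<or> leg n p q \<or> leg n q p"

definition gp5_of :: "nat \<Rightarrow> (nat \<Rightarrow> nat \<Rightarrow> bool) \<Rightarrow> nat pair_pre_digraph" where
  "gp5_of n h = \<lparr> pverts = {..<6 * n}, parcs = {(p, q). p < 6 * n \<and> q < 6 * n \<and> gadj n h p q} \<rparr>"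

lemma gp5_of_simps [simp]:
  "pverts (gp5_of n h) = {..<6 * n}"
  "(p, q) \<in> parcs (gp5_of n h) \<longleftrightarrow> p < 6 * n \<and> q < 6 * n \<and> gadj n h p q"
  by (simp_all add: gp5_of_def)

lemma leg_bound: "leg n p q \<Longrightarrow> p < 6 * n \<and> q < 6 * n \<and> n \<le> q \<and> p \<noteq> q"
  by (auto simp: leg_def)

lemma gp5_graph_gp5_of:
  fixes rk :: "nat \<Rightarrow> nat"
  assumes "0 < n" "\<And>p q. h p q \<Longrightarrow> h q p" "\<And>p. \<not> h p p" "\<And>p. rk p < 6 * n"
    "\<And>p. 0 < p \<Longrightarrow> p < n \<Longrightarrow> \<exists>q<n. h p q \<and> rk q < rk p"
  shows "gp5_graph (gp5_of n h)"
proof -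
  have fin: "finite (parcs (gp5_of n h))"
    by (rule finite_subset[of _ "{..<6 * n} \<times> {..<6 * n}"]) (auto simp: gp5_of_def)
  have "pair_graph (gp5_of n h)"
  proof
    show "symmetric (with_proj (gp5_of n h))"
      using assms(2) by (auto simp: symmetric_def sym_def gadj_def)
    show "fst e \<noteq> snd e" if "e \<in> parcs (gp5_of n h)" for e
      using that assms(3) leg_bound by (cases e) (auto simp: gadj_def)
  qed (use fin in \<open>auto simp: gp5_of_def\<close>)
  moreover have "gp5_layout (gp5_of n h) (6 * n) n (\<lambda>p. p) rk"
    unfolding gp5_layout_def gp5_of_simps gadj_def
  proof (intro conjI allI impI)
    fix p assume "p < n" "0 < p"
    then obtain q where "q < n" "h p q" "rk q < rk p" using assms(5) by blast
    then show "\<exists>q<n. (p < 6 * n \<and> q < 6 * n \<and> (p < n \<and> q < n \<and> h p q \<or> leg n p q \<or> leg n q p)) \<and> rk q < rk p"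
      using \<open>p < n\<close> by (intro exI[of _ q]) simp
  qed (use assms(1,4) in auto)
  ultimately show ?thesis by (subst gp5_graph_iff_layout[of _ "6 * n"]) auto
qed

lemma ex_pairing:
  assumes "finite C" "even (card C)"
  shows "\<exists>\<nu>. \<forall>s\<in>C. \<nu> s \<in> C \<and> \<nu> s \<noteq> s \<and> \<nu> (\<nu> s) = (s :: 'a)"
  using assms
proof (induction "card C" arbitrary: C rule: less_induct)
  case less
  show ?case
  proof (cases "C = {}")
    case False
    then obtain x where x: "x \<in> C" by blast
    have "C - {x} \<noteq> {}"
    proof
      assume "C - {x} = {}"
      then have "C = {x}" using x by blast
      then show False using less.prems by simp
    qed
    then obtain y where y: "y \<in> C" "y \<noteq> x" by blast
    define B where "B = C - {x, y}"
    have C: "C = insert x (insert y B)" "x \<notin> B" "y \<notin> B" using x y by (auto simp: B_def)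
    have B: "finite B" using less.prems by (simp add: B_def)
    then have "card C = card B + 2" using C y by simp
    then obtain \<nu> where \<nu>: "\<forall>s\<in>B. \<nu> s \<in> B \<and> \<nu> s \<noteq> s \<and> \<nu> (\<nu> s) = s"
      using less.hyps[of B] less.prems B by auto
    define \<nu>' where "\<nu>' s = (if s = x then y else if s = y then x else \<nu> s)" for s
    have "\<nu>' s \<in> C \<and> \<nu>' s \<noteq> s \<and> \<nu>' (\<nu>' s) = s" if s: "s \<in> C" for s
    proof -
      consider "s = x" | "s = y" | "s \<in> B" "s \<noteq> x" "s \<noteq> y" using s C by blast
      then show ?thesis by cases (use \<nu> C y x in \<open>auto simp: \<nu>'_def\<close>)
    qed
    then show ?thesis by blast
  qed simp
qed

text \<open>Sets are the vertices below \<open>l\<close> and form a clique, so that any two of them can be paired;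
  the element \<open>e\<close> is the vertex \<open>l + e\<close>.\<close>

definition cover_adj :: "nat \<Rightarrow> (nat \<Rightarrow> nat \<Rightarrow> bool) \<Rightarrow> nat \<Rightarrow> nat \<Rightarrow> bool" where
  "cover_adj l cov p q \<longleftrightarrow> p \<noteq> q \<and>
     (p < l \<and> q < l \<or> p < l \<and> l \<le> q \<and> cov p (q - l) \<or> q < l \<and> l \<le> p \<and> cov q (p - l))"

text \<open>\<open>k0\<close> is even because the chosen sets are paired with each other, positive
  so that some chosen set dominates the clique, and at most \<open>l\<close> so that a cover can be
  filled up to size \<open>k0\<close>. That every element lies in some set makes \<open>H\<close>
  connected and lets a chosen element be traded for a set.\<close>

locale cover_graph =
  fixes l m n k0 :: nat and cov :: "nat \<Rightarrow> nat \<Rightarrow> bool"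
  assumes n_eq: "n = l + m" and k0: "even k0" "0 < k0" "k0 \<le> l"
    and coverable: "\<And>e. e < m \<Longrightarrow> \<exists>s<l. cov s e"
begin

abbreviation G where "G \<equiv> gp5_of n (cover_adj l cov)"

lemma gp5: "gp5_graph G"
\<comment> \<open>The root is set 0; the other sets reach it within the clique, and every element is
  adjacent to a set containing it.\<close>
proof (rule gp5_graph_gp5_of[where rk = "\<lambda>p. if p = 0 then 0 else if p < l then 1 else 2"])
  fix p assume p: "0 < p" "p < n"
  show "\<exists>q<n. cover_adj l cov p q \<and> (if q = 0 then 0 else if q < l then 1 else 2) <
      (if p = 0 then 0 else if p < l then 1 else 2 :: nat)"
  proof (cases "p < l")
    case True
    then show ?thesis using p n_eq by (intro exI[of _ 0]) (auto simp: cover_adj_def)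
  next
    case False
    then have "p - l < m" using p n_eq by auto
    then obtain s where "s < l" "cov s (p - l)" using coverable by blast
    then show ?thesis using p False n_eq by (intro exI[of _ s]) (auto simp: cover_adj_def)
  qed
qed (use k0 n_eq in \<open>auto simp: cover_adj_def\<close>)

text \<open>The leaves \<open>a\<close> and \<open>e\<close> cost two vertices per index, so at most
  \<open>k0\<close> vertices of types \<open>v\<close> and \<open>c\<close> remain. An element
  vertex dominates no element but itself, and a vertex \<open>c\<close> only one vertex of
  \<open>H\<close>, so each can be replaced by a single set.\<close>

lemma dominating_cover:
  assumes D: "dominating_set G D" and card: "card D \<le> 2 * n + k0"
  shows "\<exists>C\<subseteq>{..<l}. card C \<le> k0 \<and> (\<forall>e<m. \<exists>s\<in>C. cov s e)"
proof -
  have sub: "D \<subseteq> {..<6 * n}" and dom: "\<And>w. w < 6 * n \<Longrightarrow> w \<notin> D \<Longrightarrow> \<exists>u\<in>D. gadj n (cover_adj l cov) w u"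
    using D by (auto simp: dominating_set_def)
  have fin: "finite D" using sub finite_subset by blast
  have a: "gadj n (cover_adj l cov) (n + i) u \<Longrightarrow> u = 2 * n + i" if "i < n" for i u
    using that by (auto simp: gadj_def leg_def)
  have e: "gadj n (cover_adj l cov) (5 * n + i) u \<Longrightarrow> u = 4 * n + i" if "i < n" for i u
    using that by (auto simp: gadj_def leg_def)
  have v: "gadj n (cover_adj l cov) i u \<Longrightarrow> u = 3 * n + i \<or> u < n \<and> cover_adj l cov i u" if "i < n" for i u
    using that by (auto simp: gadj_def leg_def)
  have "{..<n} \<subseteq> (\<lambda>p. p mod n) ` (D \<inter> {n..<3 * n})"
  proof
    fix i assume i: "i \<in> {..<n}"
    then have "n + i \<in> D \<or> 2 * n + i \<in> D" using dom[of "n + i"] a[of i] by auto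
    moreover have "(n + i) mod n = i" "(2 * n + i) mod n = i" using i by simp_all
    ultimately show "i \<in> (\<lambda>p. p mod n) ` (D \<inter> {n..<3 * n})"
      using i by (auto simp: image_iff intro: bexI[of _ "n + i"] bexI[of _ "2 * n + i"])
  qed
  then have 1: "n \<le> card (D \<inter> {n..<3 * n})"
    using surj_card_le[of "D \<inter> {n..<3 * n}" "{..<n}"] fin by simp
  have "{..<n} \<subseteq> (\<lambda>p. p mod n) ` (D \<inter> {4 * n..<6 * n})"
  proof
    fix i assume i: "i \<in> {..<n}"
    then have "5 * n + i \<in> D \<or> 4 * n + i \<in> D" using dom[of "5 * n + i"] e[of i] by auto
    moreover have "(5 * n + i) mod n = i" "(4 * n + i) mod n = i" using i by simp_all
    ultimately show "i \<in> (\<lambda>p. p mod n) ` (D \<inter> {4 * n..<6 * n})"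
      using i by (auto simp: image_iff intro: bexI[of _ "5 * n + i"] bexI[of _ "4 * n + i"])
  qed
  then have 2: "n \<le> card (D \<inter> {4 * n..<6 * n})"
    using surj_card_le[of "D \<inter> {4 * n..<6 * n}" "{..<n}"] fin by simp
  have sum: "card (D \<inter> {..<n} \<union> D \<inter> {n..<3 * n} \<union> D \<inter> {3 * n..<4 * n} \<union> D \<inter> {4 * n..<6 * n}) =
      card (D \<inter> {..<n}) + card (D \<inter> {n..<3 * n}) + card (D \<inter> {3 * n..<4 * n}) + card (D \<inter> {4 * n..<6 * n})"
    using fin by (subst card_Un_disjoint, simp, simp, force)+ simp
  have "D \<inter> {..<n} \<union> D \<inter> {n..<3 * n} \<union> D \<inter> {3 * n..<4 * n} \<union> D \<inter> {4 * n..<6 * n} = D"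
    using sub by fastforce
  note sum[unfolded this]
  then have cards: "card (D \<inter> {..<n}) + card (D \<inter> {3 * n..<4 * n}) \<le> k0"
    using 1 2 card by linarith
  \<comment> \<open>The replacement: a set stands for itself, an element for some set containing
    it.\<close>
  define \<sigma> where "\<sigma> i = (if i < l then i else SOME s. s < l \<and> cov s (i - l))" for i
  have \<sigma>_cov: "\<sigma> (l + e) < l \<and> cov (\<sigma> (l + e)) e" if "e < m" for e
    using someI_ex[of "\<lambda>s. s < l \<and> cov s e"] coverable[OF that] by (auto simp: \<sigma>_def)
  have \<sigma>: "\<sigma> i < l" if "i < n" for i
  proof (cases "i < l")
    case False
    then show ?thesis using \<sigma>_cov[of "i - l"] that n_eq by auto
  qed (simp add: \<sigma>_def)
  define C where "C = \<sigma> ` (D \<inter> {..<n}) \<union> (\<lambda>p. \<sigma> (p - 3 * n)) ` (D \<inter> {3 * n..<4 * n})"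
  have "card C \<le> card (D \<inter> {..<n}) + card (D \<inter> {3 * n..<4 * n})"
    unfolding C_def using fin by (intro order_trans[OF card_Un_le] add_mono card_image_le) auto
  then have "card C \<le> k0" using cards by simp
  moreover have "C \<subseteq> {..<l}" unfolding C_def using \<sigma> by auto
  moreover have "\<exists>s\<in>C. cov s e" if "e < m" for e
  proof -
    have "l + e \<in> D \<or> 3 * n + (l + e) \<in> D \<or> (\<exists>u\<in>D. u < n \<and> cover_adj l cov (l + e) u)"
      using dom[of "l + e"] v[of "l + e"] that n_eq by auto
    then show ?thesis
    proof (elim disjE bexE conjE)
      assume "l + e \<in> D"
      then show ?thesis using \<sigma>_cov[OF that] that n_eq by (intro bexI[of _ "\<sigma> (l + e)"]) (auto simp: C_def)
    next
      assume *: "3 * n + (l + e) \<in> D"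
      have "\<sigma> (l + e) \<in> (\<lambda>p. \<sigma> (p - 3 * n)) ` (D \<inter> {3 * n..<4 * n})"
        using that * n_eq by (intro image_eqI[of _ _ "3 * n + (l + e)"]) auto
      then show ?thesis using \<sigma>_cov[OF that] by (intro bexI[of _ "\<sigma> (l + e)"]) (auto simp: C_def)
    next
      fix u assume u: "u \<in> D" "u < n" "cover_adj l cov (l + e) u"
      then have "u < l" "cov u e" by (auto simp: cover_adj_def)
      then show ?thesis using u by (intro bexI[of _ u]) (auto simp: C_def \<sigma>_def)
    qed
  qed
  ultimately show ?thesis by blast
qed

lemma cover_dominating:
  assumes C0: "C0 \<subseteq> {..<l}" "card C0 \<le> k0" "\<And>e. e < m \<Longrightarrow> \<exists>s\<in>C0. cov s e"
  shows "\<exists>D. semipaired_dominating_set G D \<and> card D \<le> 2 * n + k0"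
proof -
  have fin0: "finite C0" using C0(1) finite_subset by blast
  then have "k0 - card C0 \<le> card ({..<l} - C0)" using C0 k0 by (simp add: card_Diff_subset)
  then obtain T where T: "T \<subseteq> {..<l} - C0" "card T = k0 - card C0" "finite T"
    by (rule obtain_subset_with_card_n)
  \<comment> \<open>Filling up with arbitrary further sets makes their number exactly
    \<open>k0\<close>, hence even.\<close>
  define C where "C = C0 \<union> T"
  have "C0 \<inter> T = {}" using T by blast
  then have "card C = k0" using C0(2) T fin0 by (simp add: C_def card_Un_disjoint)
  moreover have "\<exists>s\<in>C. cov s e" if "e < m" for e using C0(3)[OF that] by (auto simp: C_def)
  ultimately have C: "C \<subseteq> {..<l}" "card C = k0" "\<And>e. e < m \<Longrightarrow> \<exists>s\<in>C. cov s e" "finite C"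
    using C0(1) T fin0 by (auto simp: C_def)
  then obtain \<nu> where \<nu>: "\<And>s. s \<in> C \<Longrightarrow> \<nu> s \<in> C \<and> \<nu> s \<noteq> s \<and> \<nu> (\<nu> s) = s"
    using ex_pairing[of C] k0 by auto
  \<comment> \<open>The chosen sets are paired by \<open>\<nu>\<close>; the vertices
    \<open>b\<close> and \<open>d\<close> of each index, numbered \<open>2 * n + i\<close> and
    \<open>4 * n + i\<close>, are exchanged, their common neighbour being \<open>c\<close>.\<close>
  define \<mu> where "\<mu> p = (if p < n then if p \<in> C then \<nu> p else p
      else if 2 * n \<le> p \<and> p < 3 * n then p + 2 * n
      else if 4 * n \<le> p \<and> p < 5 * n then p - 2 * n else p)" for p
  have Cn: "s < n" "s < l" if "s \<in> C" for s using C(1) that n_eq by auto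
  have n: "0 < n" using k0 n_eq by simp
  have "\<mu> z < 6 * n \<and> \<mu> (\<mu> z) = z \<and> near G z (\<mu> z)" if z: "z < 6 * n" for z
  proof -
    consider "z \<in> C" | i where "i < n" "z = 2 * n + i" | i where "i < n" "z = 4 * n + i"
      | "z \<notin> C" "\<not> (2 * n \<le> z \<and> z < 3 * n)" "\<not> (4 * n \<le> z \<and> z < 5 * n)"
    proof -
      have "\<exists>i<n. z = 2 * n + i" if "2 * n \<le> z \<and> z < 3 * n" using that by (intro exI[of _ "z - 2 * n"]) auto
      moreover have "\<exists>i<n. z = 4 * n + i" if "4 * n \<le> z \<and> z < 5 * n" using that by (intro exI[of _ "z - 4 * n"]) auto
      ultimately show thesis using that by blast
    qed
    then show ?thesis
    proof cases
      case 1
      have "cover_adj l cov z (\<nu> z)" using \<nu>[OF 1] Cn 1 by (auto simp: cover_adj_def)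
      then have "near G z (\<nu> z)" using \<nu>[OF 1] Cn 1 z by (fastforce simp: near_def gadj_def)
      then show ?thesis using \<nu>[OF 1] Cn 1 by (force simp: \<mu>_def)
    next
      case (2 i)
      have "leg n (3 * n + i) (2 * n + i)" "leg n (3 * n + i) (4 * n + i)" using 2 by (auto simp: leg_def)
      then have "near G (2 * n + i) (4 * n + i)" using 2
        by (auto simp: near_def gadj_def intro!: bexI[of _ "3 * n + i"])
      moreover have "\<mu> z = 4 * n + i" "\<mu> (4 * n + i) = z" using 2 n by (auto simp: \<mu>_def)
      ultimately show ?thesis using 2 by simp
    next
      case (3 i)
      have "leg n (3 * n + i) (2 * n + i)" "leg n (3 * n + i) (4 * n + i)" using 3 by (auto simp: leg_def)
      then have "near G (4 * n + i) (2 * n + i)" using 3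
        by (auto simp: near_def gadj_def intro!: bexI[of _ "3 * n + i"])
      moreover have "\<mu> z = 2 * n + i" "\<mu> (2 * n + i) = z" using 3 n by (auto simp: \<mu>_def)
      ultimately show ?thesis using 3 by simp
    next
      case 4
      then have "\<mu> z = z" by (auto simp: \<mu>_def)
      then show ?thesis using z by (simp add: near_def)
    qed
  qed
  moreover have "\<exists>u<6 * n. \<mu> u \<noteq> u \<and> gadj n (cover_adj l cov) z u" if z: "z < 6 * n" "\<mu> z = z" for z
  proof -
    have b: "2 * n + i < 6 * n \<and> \<mu> (2 * n + i) \<noteq> 2 * n + i" if "i < n" for i using that n by (auto simp: \<mu>_def)
    have d: "4 * n + i < 6 * n \<and> \<mu> (4 * n + i) \<noteq> 4 * n + i" if "i < n" for i using that n by (auto simp: \<mu>_def)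
    have s: "s < 6 * n \<and> \<mu> s \<noteq> s" if "s \<in> C" for s using \<nu>[OF that] Cn[OF that] that by (auto simp: \<mu>_def)
    have leg: "leg n (3 * n + i) (2 * n + i)" "leg n (2 * n + i) (n + i)" "leg n (4 * n + i) (5 * n + i)"
      if "i < n" for i using that by (auto simp: leg_def)
    have "\<not> (2 * n \<le> z \<and> z < 3 * n)" "\<not> (4 * n \<le> z \<and> z < 5 * n)" using z n by (auto simp: \<mu>_def)
    then consider "z < l" | e where "e < m" "z = l + e" | i where "i < n" "z = n + i"
      | i where "i < n" "z = 3 * n + i" | i where "i < n" "z = 5 * n + i"
    proof -
      have "\<exists>e<m. z = l + e" if "l \<le> z \<and> z < n" using that n_eq by (intro exI[of _ "z - l"]) auto
      moreover have "\<exists>i<n. z = n + i" if "n \<le> z \<and> z < 2 * n" using that by (intro exI[of _ "z - n"]) auto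
      moreover have "\<exists>i<n. z = 3 * n + i" if "3 * n \<le> z \<and> z < 4 * n" using that by (intro exI[of _ "z - 3 * n"]) auto
      moreover have "\<exists>i<n. z = 5 * n + i" if "5 * n \<le> z \<and> z < 6 * n" using that by (intro exI[of _ "z - 5 * n"]) auto
      moreover have "z < l \<or> (l \<le> z \<and> z < n) \<or> (n \<le> z \<and> z < 2 * n) \<or> (3 * n \<le> z \<and> z < 4 * n) \<or> (5 * n \<le> z \<and> z < 6 * n)"
        using z(1) \<open>\<not> (2 * n \<le> z \<and> z < 3 * n)\<close> \<open>\<not> (4 * n \<le> z \<and> z < 5 * n)\<close> by linarith
      ultimately show thesis using that by blast
    qed
    then show ?thesis
    proof cases
      case 1
      have "C \<noteq> {}" using C(2) k0 by auto
      then obtain s where s': "s \<in> C" by blast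
      then have "z \<noteq> s" using s z by auto
      then have "cover_adj l cov z s" using 1 Cn[OF s'] by (auto simp: cover_adj_def)
      then show ?thesis using s[OF s'] Cn[OF s'] 1 n_eq by (intro exI[of _ s]) (auto simp: gadj_def)
    next
      case (2 e)
      then obtain s where s': "s \<in> C" "cov s e" using C(3) by blast
      then have "cover_adj l cov z s" using 2 Cn[OF s'(1)] by (auto simp: cover_adj_def)
      then show ?thesis using s[OF s'(1)] Cn[OF s'(1)] 2 n_eq by (intro exI[of _ s]) (auto simp: gadj_def)
    next
      case (3 i)
      then show ?thesis using b[OF 3(1)] leg[OF 3(1)] by (intro exI[of _ "2 * n + i"]) (simp add: gadj_def)
    next
      case (4 i)
      then show ?thesis using b[OF 4(1)] leg[OF 4(1)] by (intro exI[of _ "2 * n + i"]) (simp add: gadj_def)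
    next
      case (5 i)
      then show ?thesis using d[OF 5(1)] leg[OF 5(1)] by (intro exI[of _ "4 * n + i"]) (simp add: gadj_def)
    qed
  qed
  moreover have "card {z \<in> {..<6 * n}. \<mu> z \<noteq> z} \<le> 2 * n + k0"
  proof -
    have "{z \<in> {..<6 * n}. \<mu> z \<noteq> z} \<subseteq> C \<union> ({2 * n..<3 * n} \<union> {4 * n..<5 * n})"
      by (auto simp: \<mu>_def split: if_splits)
    then have "card {z \<in> {..<6 * n}. \<mu> z \<noteq> z} \<le> card (C \<union> ({2 * n..<3 * n} \<union> {4 * n..<5 * n}))"
      using C(4) by (intro card_mono) auto
    also have "\<dots> \<le> card C + (card {2 * n..<3 * n} + card {4 * n..<5 * n})"
      by (intro order_trans[OF card_Un_le] add_mono) auto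
    finally show ?thesis using C(2) by simp
  qed
  ultimately show ?thesis
    unfolding semipaired_iff_involution[OF pair_graph_gp5[OF gp5]]
    by (intro exI[of _ \<mu>]) auto
qed

theorem cover_iff:
  "(\<exists>D. semipaired_dominating_set G D \<and> card D \<le> 2 * n + k0) \<longleftrightarrow>
    (\<exists>C\<subseteq>{..<l}. card C \<le> k0 \<and> (\<forall>e<m. \<exists>s\<in>C. cov s e))"
  using dominating_cover cover_dominating unfolding semipaired_dominating_set_def by blast

end

section \<open>Membership in NP\<close>

lemma definable_pred_iff:
  assumes "definable_pred P" "definable_pred Q"
  shows "definable_pred (\<lambda>x y E. P x y E \<longleftrightarrow> Q x y E)"
proof -
  have "definable_pred (\<lambda>x y E. (P x y E \<longrightarrow> Q x y E) \<and> (Q x y E \<longrightarrow> P x y E))"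
    by (intro definable_pred_conj definable_pred_imp assms)
  moreover have "(p \<longleftrightarrow> q) \<longleftrightarrow> (p \<longrightarrow> q) \<and> (q \<longrightarrow> p)" for p q by blast
  ultimately show ?thesis by simp
qed

lemma definable_pred_leg:
  assumes "definable a" "definable b" "definable c"
  shows "definable_pred (\<lambda>x y E. leg (a x y E) (b x y E) (c x y E))"
  unfolding leg_def
  by (intro definable_intros definable_ren[OF assms(1)] definable_ren[OF assms(2)] definable_ren[OF assms(3)] assms)

section \<open>Recognising encoded instances\<close>

definition cnt :: "nat \<Rightarrow> nat" where
  "cnt i = (\<Sum>h<i. of_bool (pow2 h))"

lemma cnt_Suc: "cnt (Suc k) = length (bits k)"
proof -
  have "cnt (Suc k) = card {h. h < Suc k \<and> pow2 h}"
    by (simp add: cnt_def Int_def del: sum.lessThan_Suc)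
  also have "{h. h < Suc k \<and> pow2 h} = set (filter pow2 [0..<Suc k])" by (auto simp del: upt_Suc)
  also have "card \<dots> = length (filter pow2 [0..<Suc k])" by (rule distinct_card) (simp del: upt_Suc)
  finally show ?thesis unfolding filter_pow2 by simp
qed

lemma cnt_pow2: "cnt (2 ^ j) = j"
proof -
  have "{h. h < (2::nat) ^ j \<and> pow2 h} = (\<lambda>i. 2 ^ i) ` {..<j}" by (auto simp: pow2_def)
  then have "card {h. h < (2::nat) ^ j \<and> pow2 h} = j" by (simp add: card_image inj_on_def)
  moreover have "cnt (2 ^ j) = card {h. h < (2::nat) ^ j \<and> pow2 h}"
    by (simp add: cnt_def Int_def)
  ultimately show ?thesis by simp
qed

text \<open>Exponentiation is not available in bounded-sum expressions, so bit \<open>j\<close> is addressed by the power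
  of two \<open>i = 2 ^ j\<close>, and \<open>cnt i = j\<close>.\<close>

definition is_bits :: "bool list \<Rightarrow> nat \<Rightarrow> nat \<Rightarrow> bool" where
  "is_bits x s k \<longleftrightarrow> length x = s + cnt (Suc k) \<and>
     (\<forall>i<Suc k. pow2 i \<longrightarrow> sy x (s + cnt i) = (if odd (k div i) then 2 else 1))"

lemma is_bits_iff: "s \<le> length x \<Longrightarrow> is_bits x s k \<longleftrightarrow> drop s x = bits k"
proof
  assume s: "s \<le> length x" and *: "is_bits x s k"
  show "drop s x = bits k"
  proof (rule nth_equalityI)
    show l: "length (drop s x) = length (bits k)" using * by (simp add: is_bits_def cnt_Suc)
    fix j assume "j < length (drop s x)"
    then have j: "2 ^ j \<le> k" "j < length (bits k)" "s + j < length x" using l length_bits[of j k] by auto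
    then have "sy x (s + cnt (2 ^ j)) = (if odd (k div 2 ^ j) then 2 else 1)"
      using * unfolding is_bits_def pow2_def by (auto simp: less_Suc_eq_le)
    then show "drop s x ! j = bits k ! j"
      using j by (auto simp: cnt_pow2 nth_bits sy_def split: if_splits)
  qed
next
  assume s: "s \<le> length x" and *: "drop s x = bits k"
  then have l: "length x = s + length (bits k)" by (metis le_add_diff_inverse length_drop)
  have "sy x (s + cnt i) = (if odd (k div i) then 2 else 1)" if "i < Suc k" "pow2 i" for i
  proof -
    obtain j where j: "i = 2 ^ j" using \<open>pow2 i\<close> by (auto simp: pow2_def)
    then have j': "j < length (bits k)" using \<open>i < Suc k\<close> length_bits[of j k] by simp
    then have "x ! (s + j) = bits k ! j" using * s by (metis nth_drop)
    then show ?thesis using j' l by (simp add: j cnt_pow2 sy_def nth_bits)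
  qed
  then show "is_bits x s k" using l by (simp add: is_bits_def cnt_Suc)
qed

lemma bits_1: "bits (Suc 0) = [True]"
  by (simp add: bits.simps[of "Suc 0"] bits.simps[of 0])

text \<open>Together with \<open>last_bits\<close>: as the least significant bit comes first, the
  words ending in \<open>True\<close> are exactly the notations of positive numbers. Testing the
  last letter of an instance thus tells whether its binary part is well formed.\<close>

lemma ex_bits: "w \<noteq> [] \<Longrightarrow> last w \<Longrightarrow> \<exists>k>0. bits k = w"
proof (induction w)
  case (Cons b w)
  show ?case
  proof (cases "w = []")
    case True
    then show ?thesis using Cons.prems by (intro exI[of _ 1]) (simp add: bits_1)
  next
    case False
    then obtain k where "0 < k" "bits k = w" using Cons by auto
    then show ?thesis by (intro exI[of _ "2 * k + of_bool b"]) (simp add: bits.simps[of "2 * k + _"])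
  qed
qed simp

lemma last_bits: "0 < k \<Longrightarrow> bits k \<noteq> [] \<and> last (bits k)"
proof (induction k rule: less_induct)
  case (less k)
  then have k: "bits k = odd k # bits (k div 2)" by (subst bits.simps) simp
  show ?case
  proof (cases "k div 2 = 0")
    case True
    then have "k = 1" using less.prems by auto
    then show ?thesis by (simp add: bits_1)
  next
    case False
    then show ?thesis using less.IH[of "k div 2"] less.prems k by simp
  qed
qed

definition graph_of :: "nat \<Rightarrow> (nat \<Rightarrow> nat \<Rightarrow> bool) \<Rightarrow> nat pair_pre_digraph" where
  "graph_of N A = \<lparr> pverts = {..<N}, parcs = {(p, q). p < N \<and> q < N \<and> A p q} \<rparr>"

lemma graph_of_simps [simp]:
  "pverts (graph_of N A) = {..<N}" "(p, q) \<in> parcs (graph_of N A) \<longleftrightarrow> p < N \<and> q < N \<and> A p q"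
  by (simp_all add: graph_of_def)

text \<open>Simplicity of the graph, the layout and the pairing involution, unfolded into bounded
  quantifiers so that they are definable from an adjacency test and three functions. The size of the
  dominating set is compared with \<open>k\<close> separately.\<close>

definition check :: "(nat \<Rightarrow> nat \<Rightarrow> bool) \<Rightarrow> nat \<Rightarrow> nat \<Rightarrow> (nat \<Rightarrow> nat) \<Rightarrow> (nat \<Rightarrow> nat) \<Rightarrow> (nat \<Rightarrow> nat) \<Rightarrow> bool" where
  "check A N n \<pi> rk \<mu> \<longleftrightarrow>
     (\<forall>p<N. \<not> A p p) \<and> (\<forall>p<N. \<forall>q<N. A p q \<longrightarrow> A q p) \<and> N = 6 * n \<and> 0 < n \<and>
     (\<forall>p<N. \<pi> p < N \<and> rk p < N) \<and> (\<forall>p<N. \<forall>q<N. \<pi> p = \<pi> q \<longrightarrow> p = q) \<and>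
     (\<forall>p<N. \<forall>q<N. \<not> (p < n \<and> q < n) \<longrightarrow> (A (\<pi> p) (\<pi> q) \<longleftrightarrow> leg n p q \<or> leg n q p)) \<and>
     (\<forall>p<n. 0 < p \<longrightarrow> (\<exists>q<n. A (\<pi> p) (\<pi> q) \<and> rk (\<pi> q) < rk (\<pi> p))) \<and>
     (\<forall>z<N. \<mu> z < N \<and> \<mu> (\<mu> z) = z \<and> (z = \<mu> z \<or> A z (\<mu> z) \<or> (\<exists>w<N. A z w \<and> A w (\<mu> z)))) \<and>
     (\<forall>z<N. \<mu> z = z \<longrightarrow> (\<exists>u<N. \<mu> u \<noteq> u \<and> A z u))"

text \<open>A certificate determines the three functions only below \<open>N\<close>. All arguments
  that occur stay there, because the values of \<open>\<pi>\<close> and \<open>\<mu>\<close>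
  do.\<close>

lemma check_cong:
  assumes "\<And>z. z < N \<Longrightarrow> \<pi>' z = \<pi> z" "\<And>z. z < N \<Longrightarrow> rk' z = rk z" "\<And>z. z < N \<Longrightarrow> \<mu>' z = \<mu> z"
    and "check A N n \<pi> rk \<mu>"
  shows "check A N n \<pi>' rk' \<mu>'"
proof -
  note r0 = assms(4)[unfolded check_def]
  note r2 = r0[THEN conjunct2, THEN conjunct2]
  note r4 = r2[THEN conjunct2, THEN conjunct2]
  note r6 = r4[THEN conjunct2, THEN conjunct2]
  note r8 = r6[THEN conjunct2, THEN conjunct2]
  note lt = r4[THEN conjunct1, rule_format] and inj = r4[THEN conjunct2, THEN conjunct1, rule_format]
    and legs = r6[THEN conjunct1, rule_format] and dec = r6[THEN conjunct2, THEN conjunct1, rule_format]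
    and pair = r8[THEN conjunct1, rule_format] and dom = r8[THEN conjunct2, rule_format]
  have nN: "q < n \<Longrightarrow> q < N" for q using r2 by simp
  have 1: "\<exists>q<n. A (\<pi>' p) (\<pi>' q) \<and> rk' (\<pi>' q) < rk' (\<pi>' p)" if p: "p < n" "0 < p" for p
  proof -
    obtain q where "q < n" "A (\<pi> p) (\<pi> q) \<and> rk (\<pi> q) < rk (\<pi> p)" using dec[OF p] by blast
    moreover from this have N: "p < N" "q < N" using nN p by auto
    moreover from this have "\<pi> p < N" "\<pi> q < N" using lt by auto
    ultimately show ?thesis by (intro exI[of _ q]) (simp add: assms(1,2))
  qed
  have 2: "\<exists>u<N. \<mu>' u \<noteq> u \<and> A z u" if z: "z < N" "\<mu>' z = z" for z
  proof -
    have "\<mu> z = z" using z assms(3) by simp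
    then obtain u where "u < N" "\<mu> u \<noteq> u \<and> A z u" using dom z(1) by blast
    then show ?thesis using assms(3) by (intro exI[of _ u]) simp
  qed
  have 3: "A (\<pi>' p) (\<pi>' q) \<longleftrightarrow> leg n p q \<or> leg n q p" if "p < N" "q < N" "\<not> (p < n \<and> q < n)" for p q
    unfolding assms(1)[OF that(1)] assms(1)[OF that(2)] using legs[OF that] .
  have 4: "\<pi>' p < N \<and> rk' p < N" if "p < N" for p
    unfolding assms(1)[OF that] assms(2)[OF that] using lt[OF that] .
  have 5: "p = q" if "p < N" "q < N" "\<pi>' p = \<pi>' q" for p q
    using inj[OF that(1,2)] that(3)[unfolded assms(1)[OF that(1)] assms(1)[OF that(2)]] by blast
  have 6: "\<mu>' z < N \<and> \<mu>' (\<mu>' z) = z \<and> (z = \<mu>' z \<or> A z (\<mu>' z) \<or> (\<exists>w<N. A z w \<and> A w (\<mu>' z)))"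
    if "z < N" for z
    using pair[OF that] assms(3)[OF that] assms(3)[of "\<mu> z"] by simp
  have "\<forall>p<N. \<pi>' p < N \<and> rk' p < N" using 4 by blast
  moreover have "\<forall>p<N. \<forall>q<N. \<pi>' p = \<pi>' q \<longrightarrow> p = q" using 5 by blast
  moreover have "\<forall>p<N. \<forall>q<N. \<not> (p < n \<and> q < n) \<longrightarrow> (A (\<pi>' p) (\<pi>' q) \<longleftrightarrow> leg n p q \<or> leg n q p)"
    using 3 by blast
  moreover have "\<forall>p<n. 0 < p \<longrightarrow> (\<exists>q<n. A (\<pi>' p) (\<pi>' q) \<and> rk' (\<pi>' q) < rk' (\<pi>' p))"
    by (intro allI impI 1)
  moreover have "\<forall>z<N. \<mu>' z < N \<and> \<mu>' (\<mu>' z) = z \<and>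
      (z = \<mu>' z \<or> A z (\<mu>' z) \<or> (\<exists>w<N. A z w \<and> A w (\<mu>' z)))" by (intro allI impI 6)
  moreover have "\<forall>z<N. \<mu>' z = z \<longrightarrow> (\<exists>u<N. \<mu>' u \<noteq> u \<and> A z u)" by (intro allI impI 2)
  moreover note r0[THEN conjunct1] r0[THEN conjunct2, THEN conjunct1]
    r2[THEN conjunct1] r2[THEN conjunct2, THEN conjunct1]
  ultimately show ?thesis unfolding check_def by (intro conjI)
qed

lemma check_iff:
  "(\<exists>n \<pi> rk \<mu>. check A N n \<pi> rk \<mu> \<and> (\<Sum>z<N. of_bool (\<mu> z \<noteq> z)) \<le> k) \<longleftrightarrow>
    gp5_graph (graph_of N A) \<and> (\<exists>D. semipaired_dominating_set (graph_of N A) D \<and> card D \<le> k)"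
    (is "?L \<longleftrightarrow> ?R")
proof -
  let ?G = "graph_of N A"
  have fin: "finite (parcs ?G)"
    by (rule finite_subset[of _ "{..<N} \<times> {..<N}"]) (auto simp: graph_of_def)
  have pg: "pair_graph ?G \<longleftrightarrow> (\<forall>p<N. \<not> A p p) \<and> (\<forall>p<N. \<forall>q<N. A p q \<longrightarrow> A q p)"
  proof
    assume "pair_graph ?G"
    then interpret pair_graph ?G .
    show "(\<forall>p<N. \<not> A p p) \<and> (\<forall>p<N. \<forall>q<N. A p q \<longrightarrow> A q p)"
      using pair_no_loops arcs_symmetric by fastforce
  next
    assume *: "(\<forall>p<N. \<not> A p p) \<and> (\<forall>p<N. \<forall>q<N. A p q \<longrightarrow> A q p)"
    show "pair_graph ?G"
    proof
      show "symmetric (with_proj ?G)" using * by (auto simp: symmetric_def sym_def)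
      show "fst e \<noteq> snd e" if "e \<in> parcs ?G" for e using that * by (cases e) auto
    qed (use fin in \<open>auto simp: graph_of_def\<close>)
  qed
  have sum: "(\<Sum>z<N. of_bool (\<mu> z \<noteq> z)) = card {z \<in> pverts ?G. \<mu> z \<noteq> z}" for \<mu> :: "nat \<Rightarrow> nat"
    by (simp add: Int_def)
  define pairing where "pairing \<mu> \<longleftrightarrow> (\<forall>z\<in>pverts ?G. \<mu> z \<in> pverts ?G \<and> \<mu> (\<mu> z) = z \<and> near ?G z (\<mu> z)) \<and>
     (\<forall>z\<in>pverts ?G. \<mu> z = z \<longrightarrow> (\<exists>u\<in>pverts ?G. \<mu> u \<noteq> u \<and> (z, u) \<in> parcs ?G))" for \<mu>
  have check: "check A N n \<pi> rk \<mu> \<longleftrightarrow> pair_graph ?G \<and> gp5_layout ?G N n \<pi> rk \<and> pairing \<mu>" for n \<pi> rk \<mu>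
  proof -
    have "gp5_layout ?G N n \<pi> rk \<longleftrightarrow> N = 6 * n \<and> 0 < n \<and>
      (\<forall>p<N. \<pi> p < N \<and> rk p < N) \<and> (\<forall>p<N. \<forall>q<N. \<pi> p = \<pi> q \<longrightarrow> p = q) \<and>
      (\<forall>p<N. \<forall>q<N. \<not> (p < n \<and> q < n) \<longrightarrow> (A (\<pi> p) (\<pi> q) \<longleftrightarrow> leg n p q \<or> leg n q p)) \<and>
      (\<forall>p<n. 0 < p \<longrightarrow> (\<exists>q<n. A (\<pi> p) (\<pi> q) \<and> rk (\<pi> q) < rk (\<pi> p)))"
    proof (cases "N = 6 * n \<and> (\<forall>p<N. \<pi> p < N \<and> rk p < N)")
      case True
      then have "p < n \<Longrightarrow> \<pi> p < N" for p by auto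
      then show ?thesis using True unfolding gp5_layout_def graph_of_simps by (simp cong: conj_cong)
    next
      case False
      then show ?thesis unfolding gp5_layout_def by blast
    qed
    moreover have "pairing \<mu> \<longleftrightarrow>
       (\<forall>z<N. \<mu> z < N \<and> \<mu> (\<mu> z) = z \<and> (z = \<mu> z \<or> A z (\<mu> z) \<or> (\<exists>w<N. A z w \<and> A w (\<mu> z)))) \<and>
       (\<forall>z<N. \<mu> z = z \<longrightarrow> (\<exists>u<N. \<mu> u \<noteq> u \<and> A z u))"
      unfolding pairing_def near_def graph_of_simps Ball_def Bex_def lessThan_iff
      by (intro conj_cong refl) (meson+)
    ultimately show ?thesis unfolding check_def pg by (simp only: conj_assoc)
  qed
  have "?R \<longleftrightarrow> pair_graph ?G \<and> (\<exists>n \<pi> rk. gp5_layout ?G N n \<pi> rk) \<and>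
      (\<exists>\<mu>. pairing \<mu> \<and> card {z \<in> pverts ?G. \<mu> z \<noteq> z} \<le> k)"
    unfolding gp5_graph_iff_layout[OF graph_of_simps(1)] pairing_def conj_assoc
    using semipaired_iff_involution[of ?G k] by (intro iffI) (elim conjE, intro conjI; simp)+
  then show ?thesis unfolding check sum by blast
qed

text \<open>The value at \<open>z\<close> of the \<open>j\<close>-th certificate function is the number of set bits in a row of length \<open>N\<close>,
  so that every word encodes some functions.\<close>

definition cert :: "bool list \<Rightarrow> nat \<Rightarrow> nat \<Rightarrow> nat \<Rightarrow> nat" where
  "cert y N j z = (\<Sum>i<N. of_bool (sy y ((j * N + z) * N + i) = 2))"

lemma definable_cert:
  assumes "definable a" "definable b"
  shows "definable (\<lambda>x y E. cert y (a x y E) j (b x y E))"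
  unfolding cert_def by (intro definable_intros definable_ren[OF assms(1)] definable_ren[OF assms(2)] assms)

lemma ex_cert:
  assumes "\<And>j z. j < 3 \<Longrightarrow> z < N \<Longrightarrow> F j z \<le> N"
  shows "\<exists>y. length y = 3 * N * N \<and> (\<forall>j<3. \<forall>z<N. cert y N j z = F j z)"
proof (intro exI conjI allI impI)
  let ?y = "map (\<lambda>t. t mod N < F (t div N div N) (t div N mod N)) [0..<3 * N * N]"
  show "length ?y = 3 * N * N" by simp
  fix j z :: nat assume j: "j < 3" and z: "z < N"
  have "sy ?y ((j * N + z) * N + i) = 2 \<longleftrightarrow> i < F j z" if i: "i < N" for i
  proof -
    have "j * N + z < 3 * N"
    proof -
      have "j * N + z < (j + 1) * N" using z by simp
      also have "\<dots> \<le> 3 * N" using j by (intro mult_right_mono) auto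
      finally show ?thesis .
    qed
    then have "(j * N + z + 1) * N \<le> 3 * N * N" by (intro mult_right_mono) auto
    then have "(j * N + z) * N + i < 3 * N * N" using i by (simp add: distrib_right)
    then show ?thesis using i z by (simp add: sy_def)
  qed
  then have "cert ?y N j z = card ({..<N} \<inter> {i. i < F j z})"
    unfolding cert_def by (simp add: Int_def cong: conj_cong sum.cong)
  also have "{..<N} \<inter> {i. i < F j z} = {..<F j z}" using assms[OF j z] by auto
  finally show "cert ?y N j z = F j z" by simp
qed

definition adj :: "bool list \<Rightarrow> nat \<Rightarrow> nat \<Rightarrow> nat \<Rightarrow> bool" where
  "adj x N p q \<longleftrightarrow> sy x (N + 1 + (p * N + q)) = 2"

lemma definable_pred_adj:
  assumes "definable a" "definable b" "definable c"
  shows "definable_pred (\<lambda>x y E. adj x (a x y E) (b x y E) (c x y E))"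
  unfolding adj_def by (intro definable_intros assms)

text \<open>The strict inequality makes the binary part non-empty, and its last letter has to be
  \<open>True\<close>: then it denotes a positive number.\<close>

definition header :: "bool list \<Rightarrow> nat \<Rightarrow> bool" where
  "header x N \<longleftrightarrow> (\<forall>i<N. sy x i = 2) \<and> sy x N = 1 \<and> N + 1 + N * N < length x \<and> sy x (length x - 1) = 2"

text \<open>The graph is read off from \<open>x\<close> itself by \<open>adj\<close>, so every word
  with a proper header encodes some graph and number; whether it is a GP5-graph is left to
  \<open>check\<close>.\<close>

lemma encode_iff:
  "header x N \<and> x' = drop (N + 1 + N * N) x \<longleftrightarrow>
    (\<exists>k>0. x = encode (graph_of N (adj x N)) k \<and> x' = bits k)"
proof -
  let ?A = "adj x N"
  have enc: "encode (graph_of N A) k = replicate N True @ [False] @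
      map (\<lambda>i. A (i div N) (i mod N)) [0..<N * N] @ bits k" for A k
  proof -
    have "(i div N, i mod N) \<in> parcs (graph_of N A) \<longleftrightarrow> A (i div N) (i mod N)" if "i < N * N" for i
      using that by (cases "N = 0") (simp_all add: less_mult_imp_div_less)
    then show ?thesis by (simp add: encode_eq[OF graph_of_simps(1)])
  qed
  show ?thesis
  proof
    assume *: "header x N \<and> x' = drop (N + 1 + N * N) x"
    then have h: "\<And>i. i < N \<Longrightarrow> sy x i = 2" "sy x N = 1" "N + 1 + N * N < length x" "sy x (length x - 1) = 2"
      and x': "x' = drop (N + 1 + N * N) x" by (auto simp: header_def)
    have "x \<noteq> []" using h(3) by auto
    then have "last x" using h(4) by (simp add: last_conv_nth sy_def split: if_splits)
    then have "x' \<noteq> []" "last x'" using h(3) by (simp_all add: x' last_drop)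
    then obtain k where k: "0 < k" "bits k = x'" using ex_bits by blast
    have "x = encode (graph_of N ?A) k"
    proof (rule nth_equalityI)
      show len: "length x = length (encode (graph_of N ?A) k)" unfolding enc using k x' h(3) by simp
      fix i assume i: "i < length x"
      consider "i < N" | "i = N" | j where "j < N * N" "i = N + 1 + j" | j where "i = N + 1 + N * N + j"
      proof -
        have "\<exists>j. i = N + 1 + N * N + j" if "N + 1 + N * N \<le> i" using le_Suc_ex[OF that] by blast
        moreover have "\<exists>j<N * N. i = N + 1 + j" if "N < i" "i < N + 1 + N * N"
          using that by (intro exI[of _ "i - (N + 1)"]) auto
        ultimately show thesis using that by (meson linorder_neqE_nat not_less)
      qed
      then show "x ! i = encode (graph_of N ?A) k ! i"
      proof cases
        case 1
        then show ?thesis using h(1)[OF 1] i unfolding enc by (simp add: nth_append sy_def split: if_splits)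
      next
        case 2
        then show ?thesis using h(2) i unfolding enc by (simp add: nth_append sy_def split: if_splits)
      next
        case (3 j)
        then show ?thesis using i unfolding enc by (auto simp: nth_append adj_def sy_def)
      next
        case (4 j)
        then have "x ! i = x' ! j" using h(3) unfolding x' by simp
        then show ?thesis using 4 k unfolding enc by (simp add: nth_append)
      qed
    qed
    then show "\<exists>k>0. x = encode (graph_of N ?A) k \<and> x' = bits k" using k by blast
  next
    assume "\<exists>k>0. x = encode (graph_of N ?A) k \<and> x' = bits k"
    then obtain k where k: "0 < k" "x = encode (graph_of N ?A) k" "x' = bits k" by blast
    have x: "x = replicate N True @ [False] @ map (\<lambda>i. ?A (i div N) (i mod N)) [0..<N * N] @ bits k"
      using k(2) unfolding enc .
    have len: "length x = N + 1 + N * N + length (bits k)" by (subst x) simp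
    have b: "bits k \<noteq> []" "last (bits k)" using last_bits[OF k(1)] by auto
    have "x ! i = True" if "i < N" for i by (subst x) (use that in \<open>simp add: nth_append\<close>)
    moreover have "x ! N = False" by (subst x) (simp add: nth_append)
    moreover have "last x = True" by (subst x) (use b in simp)
    moreover have "x \<noteq> []" using len by auto
    ultimately have "header x N" using len b by (auto simp: header_def sy_def last_conv_nth)
    moreover have "x' = drop (N + 1 + N * N) x" unfolding k(3) by (subst x) simp
    ultimately show "header x N \<and> x' = drop (N + 1 + N * N) x" by blast
  qed
qed

lemma header_encode:
  assumes "0 < k" "pverts G = {..<N}" "parcs G \<subseteq> {..<N} \<times> {..<N}"
  shows "header (encode G k) N" "graph_of N (adj (encode G k) N) = G"
    "drop (N + 1 + N * N) (encode G k) = bits k"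
proof -
  let ?x = "encode G k"
  have "adj ?x N p q \<longleftrightarrow> (p, q) \<in> parcs G" if pq: "p < N" "q < N" for p q
  proof -
    have "(p + 1) * N \<le> N * N" using pq by (intro mult_right_mono) auto
    then have i: "p * N + q < N * N" using pq by simp
    then have "?x ! (N + 1 + (p * N + q)) = (List.product [0..<N] [0..<N] ! (p * N + q) \<in> parcs G)"
      unfolding encode_def Let_def assms(2) by (simp add: nth_append)
    also have "List.product [0..<N] [0..<N] ! (p * N + q) = (p, q)"
      using i pq by (simp add: product_nth)
    finally have "?x ! (N + 1 + (p * N + q)) = ((p, q) \<in> parcs G)" .
    moreover have "N + 1 + (p * N + q) < length ?x"
      unfolding encode_def Let_def assms(2) using i by simp
    ultimately show ?thesis by (simp add: adj_def sy_def)
  qed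
  then have "parcs (graph_of N (adj ?x N)) = parcs G"
    using assms(3) by (auto simp: graph_of_def)
  then show G: "graph_of N (adj ?x N) = G" using assms(2) by (simp add: graph_of_def)
  show "header ?x N" "drop (N + 1 + N * N) ?x = bits k"
    using encode_iff[of ?x N "bits k"] assms(1) unfolding G by auto
qed

text \<open>The encoded number may be exponential in the length of \<open>x\<close> and is then out
  of reach of a bounded quantifier. So the test does not compute it, but excludes that a number
  smaller than the count of moved vertices is the encoded one.\<close>

definition verify :: "bool list \<Rightarrow> bool list \<Rightarrow> bool" where
  "verify x y \<longleftrightarrow> (\<exists>N<Suc (length x). header x N \<and>
     (\<exists>n<Suc N. check (adj x N) N n (cert y N 0) (cert y N 1) (cert y N 2)) \<and>
     \<not> (\<exists>k<\<Sum>z<N. of_bool (cert y N 2 z \<noteq> z). is_bits x (N + 1 + N * N) k))"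

lemma definable_verify: "definable_pred (\<lambda>x y E. verify x y)"
  unfolding verify_def header_def check_def is_bits_def cnt_def
  by (intro definable_pred_adj definable_cert definable_pred_leg definable_pred_iff definable_pred_pow2
      definable_intros)

theorem in_NP_semipaired: "in_NP semipaired_domination_yes"
proof (rule in_NP_I[OF definable_verify])
  fix x
  \<comment> \<open>Three functions on \<open>N\<close> vertices, each value stored in a row of
    length \<open>N\<close>, take \<open>3 * N * N\<close> letters, and \<open>N\<close> is at most
    \<open>length x\<close>.\<close>
  show "x \<in> semipaired_domination_yes \<longleftrightarrow> (\<exists>y. length y \<le> poly [:0, 0, 3:] (length x) \<and> verify x y)"
  proof
    assume "x \<in> semipaired_domination_yes"
    then obtain G k where x: "x = encode G k" and inst: "gp5_instance G k"
      and D: "\<exists>D. semipaired_dominating_set G D \<and> card D \<le> k"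
      by (auto simp: semipaired_domination_yes_def)
    then obtain N where gp5: "gp5_graph G" and N: "pverts G = {..<N}" and k: "0 < k"
      by (auto simp: gp5_instance_def)
    interpret pair_graph G using pair_graph_gp5[OF gp5] .
    have "parcs G \<subseteq> {..<N} \<times> {..<N}" using in_arcsD1 in_arcsD2 N by auto
    note enc = header_encode[OF k N this, folded x]
    have "\<exists>n \<pi> rk \<mu>. check (adj x N) N n \<pi> rk \<mu> \<and> (\<Sum>z<N. of_bool (\<mu> z \<noteq> z)) \<le> k"
      unfolding check_iff enc(2) using gp5 D by blast
    then obtain n \<pi> rk \<mu> where chk: "check (adj x N) N n \<pi> rk \<mu>" "(\<Sum>z<N. of_bool (\<mu> z \<noteq> z)) \<le> k" by blast
    have "([\<pi>, rk, \<mu>] ! j) z \<le> N" if "j < 3" "z < N" for j z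
    proof -
      have "j = 0 \<or> j = 1 \<or> j = 2" using that by linarith
      then show ?thesis using chk(1) \<open>z < N\<close> by (auto simp: check_def less_imp_le)
    qed
    then obtain y where y: "length y = 3 * N * N" "\<And>j z. j < 3 \<Longrightarrow> z < N \<Longrightarrow> cert y N j z = ([\<pi>, rk, \<mu>] ! j) z"
      using ex_cert[of N "\<lambda>j z. ([\<pi>, rk, \<mu>] ! j) z"] by blast
    have eq: "cert y N 0 z = \<pi> z" "cert y N 1 z = rk z" "cert y N 2 z = \<mu> z" if "z < N" for z
      using y(2)[of 0 z] y(2)[of 1 z] y(2)[of 2 z] that by simp_all
    have "N \<le> length x" using enc(1) by (simp add: header_def)
    moreover from this have "N * N \<le> length x * length x" by (intro mult_mono) auto
    ultimately have "length y \<le> poly [:0, 0, 3:] (length x)" using y(1) by simp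
    moreover have "verify x y"
      unfolding verify_def
    proof (rule exI[of _ N], intro conjI)
      show "N < Suc (length x)" "header x N" using \<open>N \<le> length x\<close> enc(1) by simp_all
      have "check (adj x N) N n (cert y N 0) (cert y N 1) (cert y N 2)"
        by (rule check_cong[OF eq chk(1)])
      moreover have "n < Suc N" using chk(1) by (simp add: check_def)
      ultimately show "\<exists>n<Suc N. check (adj x N) N n (cert y N 0) (cert y N 1) (cert y N 2)" by blast
      have "(\<Sum>z<N. of_bool (cert y N 2 z \<noteq> z)) \<le> k" using chk(2) eq(3) by simp
      moreover have "k' = k" if "is_bits x (N + 1 + N * N) k'" for k'
        using that enc(1,3) is_bits_iff[of "N + 1 + N * N" x k'] bits_inject[of k k'] by (auto simp: header_def)
      ultimately show "\<not> (\<exists>k<\<Sum>z<N. of_bool (cert y N 2 z \<noteq> z). is_bits x (N + 1 + N * N) k)"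
        by fastforce
    qed
    ultimately show "\<exists>y. length y \<le> poly [:0, 0, 3:] (length x) \<and> verify x y" by blast
  next
    assume "\<exists>y. length y \<le> poly [:0, 0, 3:] (length x) \<and> verify x y"
    then obtain y N n where h: "header x N"
      and chk: "check (adj x N) N n (cert y N 0) (cert y N 1) (cert y N 2)"
      and le: "\<not> (\<exists>k<\<Sum>z<N. of_bool (cert y N 2 z \<noteq> z). is_bits x (N + 1 + N * N) k)"
      unfolding verify_def by blast
    obtain k where k: "0 < k" "x = encode (graph_of N (adj x N)) k" "drop (N + 1 + N * N) x = bits k"
      using encode_iff[of x N "drop (N + 1 + N * N) x"] h by auto
    have "is_bits x (N + 1 + N * N) k" using k(3) h is_bits_iff by (simp add: header_def)
    then have "(\<Sum>z<N. of_bool (cert y N 2 z \<noteq> z)) \<le> k" using le by (meson not_less)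
    then have "gp5_graph (graph_of N (adj x N)) \<and>
        (\<exists>D. semipaired_dominating_set (graph_of N (adj x N)) D \<and> card D \<le> k)"
      using chk check_iff by blast
    then show "x \<in> semipaired_domination_yes"
      using k(1,2) unfolding semipaired_domination_yes_def gp5_instance_def by fastforce
  qed
qed

section \<open>Tableaux of Turing machine runs\<close>

text \<open>A run is described by columns (for every position the symbol on each tape and whether its
  head is there) and by a global value per time step (the state and the scanned symbols).\<close>

type_synonym column = "(nat \<times> bool) list"
type_synonym global = "nat \<times> nat list"

definition globals :: "tm \<Rightarrow> global set" where
  "globals M = {..<states M} \<times> {w. set w \<subseteq> {..<symbols M} \<and> length w = tapes M}"

definition columns :: "tm \<Rightarrow> column set" where
  "columns M = {w. set w \<subseteq> {..<symbols M} \<times> UNIV \<and> length w = tapes M}"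

lemma finite_globals: "finite (globals M)"
  unfolding globals_def by (intro finite_cartesian_product finite_lists_length_eq) auto

lemma finite_columns: "finite (columns M)"
  unfolding columns_def by (intro finite_lists_length_eq finite_cartesian_product) auto

text \<open>In halting states the scanned symbols are written back and no head moves, in accordance
  with halting configurations being fixed points. A tableau may therefore continue beyond the end of
  the computation.\<close>

definition stepf :: "tm \<Rightarrow> global \<Rightarrow> nat \<times> (nat \<times> int) list" where
  "stepf M g = (if fst g = acc M \<or> fst g = rej M then (fst g, map (\<lambda>s. (s, 0)) (snd g))
     else delta M (fst g) (snd g))"

definition glob :: "config \<Rightarrow> global" where
  "glob c = (fst c, map (\<lambda>(h, t). t h) (snd c))"

definition col :: "config \<Rightarrow> int \<Rightarrow> column" where
  "col c i = map (\<lambda>(h, t). (t i, h = i)) (snd c)"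

text \<open>Once the actions are known, only the column and its two neighbours matter: a head
  arrives from the left by a move of 1 and from the right by a move of -1.\<close>

definition next_col :: "(nat \<times> int) list \<Rightarrow> column \<Rightarrow> column \<Rightarrow> column \<Rightarrow> column" where
  "next_col acts cl c cr = map (\<lambda>k. (if snd (c ! k) then fst (acts ! k) else fst (c ! k),
     snd (cl ! k) \<and> snd (acts ! k) = 1 \<or> snd (c ! k) \<and> snd (acts ! k) = 0 \<or>
     snd (cr ! k) \<and> snd (acts ! k) = - 1)) [0..<length acts]"

lemma tm_step_stepf:
  "tm_step M c = (fst (stepf M (glob c)),
     map2 (\<lambda>(h, t) (s, m). (h + m, t(h := s))) (snd c) (snd (stepf M (glob c))))"
proof (cases c)
  case (Pair q ts)
  have "map2 (\<lambda>(h, t) (s, m). (h + m, t(h := s))) ts (map (\<lambda>s. (s, 0)) (map (\<lambda>(h, t). t h) ts)) = ts"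
    by (rule nth_equalityI) (auto simp: case_prod_beta)
  then show ?thesis unfolding Pair tm_step.simps stepf_def glob_def by (simp add: case_prod_beta Let_def)
qed

lemma stepf_globals:
  assumes "wf_tm M" "g \<in> globals M"
  shows "fst (stepf M g) < states M" "length (snd (stepf M g)) = tapes M"
    "set (snd (stepf M g)) \<subseteq> {..<symbols M} \<times> {-1, 0, 1}"
proof -
  obtain q w where g: "g = (q, w)" "q < states M" "set w \<subseteq> {..<symbols M}" "length w = tapes M"
    using assms(2) by (auto simp: globals_def)
  have d: "fst (delta M q w) < states M \<and> length (snd (delta M q w)) = tapes M \<and>
      set (snd (delta M q w)) \<subseteq> {..<symbols M} \<times> {-1, 0, 1}"
    using assms(1) g unfolding wf_tm_def by blast
  show "fst (stepf M g) < states M" "length (snd (stepf M g)) = tapes M"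
    "set (snd (stepf M g)) \<subseteq> {..<symbols M} \<times> {-1, 0, 1}"
    using d g by (auto simp: stepf_def)
qed

definition good_config :: "tm \<Rightarrow> config \<Rightarrow> bool" where
  "good_config M c \<longleftrightarrow> fst c < states M \<and> length (snd c) = tapes M \<and>
     (\<forall>k<tapes M. \<forall>i. snd (snd c ! k) i < symbols M)"

lemma good_configD: "good_config M c \<Longrightarrow> k < tapes M \<Longrightarrow> snd c ! k = (h, t) \<Longrightarrow> t i < symbols M"
  unfolding good_config_def by (metis snd_conv)

lemma glob_globals: "good_config M c \<Longrightarrow> glob c \<in> globals M"
  using good_configD[of M c]
  by (auto simp: good_config_def glob_def globals_def in_set_conv_nth)

lemma col_columns: "good_config M c \<Longrightarrow> col c i \<in> columns M"
  using good_configD[of M c]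
  by (auto simp: good_config_def col_def columns_def in_set_conv_nth)

lemma snd_step_nth:
  assumes "wf_tm M" "good_config M c" "k < tapes M"
  shows "snd (tm_step M c) ! k = (fst (snd c ! k) + snd (snd (stepf M (glob c)) ! k),
    (snd (snd c ! k))(fst (snd c ! k) := fst (snd (stepf M (glob c)) ! k)))"
  using assms stepf_globals(2)[OF assms(1) glob_globals[OF assms(2)]]
  by (simp add: tm_step_stepf good_config_def case_prod_beta)

lemma act_bounds:
  assumes "wf_tm M" "good_config M c" "k < tapes M"
  shows "fst (snd (stepf M (glob c)) ! k) < symbols M" "snd (snd (stepf M (glob c)) ! k) \<in> {-1, 0, 1}"
proof -
  note s = stepf_globals[OF assms(1) glob_globals[OF assms(2)]]
  have "snd (stepf M (glob c)) ! k \<in> {..<symbols M} \<times> {-1, 0, 1}"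
    using s(2,3) assms(3) nth_mem by (metis subsetD)
  then show "fst (snd (stepf M (glob c)) ! k) < symbols M" "snd (snd (stepf M (glob c)) ! k) \<in> {-1, 0, 1}"
    by (auto simp: mem_Times_iff)
qed

lemma good_step:
  assumes "wf_tm M" "good_config M c" shows "good_config M (tm_step M c)"
proof -
  note s = stepf_globals[OF assms(1) glob_globals[OF assms(2)]]
  have "length (snd (tm_step M c)) = tapes M"
    using assms(2) s(2) by (simp add: tm_step_stepf good_config_def)
  moreover have "fst (tm_step M c) < states M" using s(1) by (simp add: tm_step_stepf)
  moreover have "snd (snd (tm_step M c) ! k) i < symbols M" if "k < tapes M" for k i
    using assms(2) that act_bounds(1)[OF assms that] by (simp add: snd_step_nth[OF assms that] good_config_def)
  ultimately show ?thesis unfolding good_config_def by blast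
qed

lemma good_run:
  assumes "wf_tm M" shows "good_config M (tm_run M ws t)"
proof (induction t)
  case 0
  have "word_tape w i < symbols M" for w i
    using assms by (auto simp: word_tape_def wf_tm_def)
  then show ?case using assms by (auto simp: tm_run_def tm_init_def good_config_def wf_tm_def)
next
  case (Suc t)
  then show ?case using good_step[OF assms] by (simp add: tm_run_def)
qed

lemma head_bound:
  assumes "wf_tm M" "k < tapes M" shows "\<bar>fst (snd (tm_run M ws t) ! k)\<bar> \<le> int t"
proof (induction t)
  case 0
  show ?case using assms by (simp add: tm_run_def tm_init_def)
next
  case (Suc t)
  have "tm_run M ws (Suc t) = tm_step M (tm_run M ws t)" by (simp add: tm_run_def)
  then show ?case
    using snd_step_nth[OF assms(1) good_run[OF assms(1)] assms(2), of ws t]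
      act_bounds(2)[OF assms(1) good_run[OF assms(1)] assms(2), of ws t] Suc by auto
qed

lemma col_nth: "good_config M c \<Longrightarrow> k < tapes M \<Longrightarrow>
    col c i ! k = (snd (snd c ! k) i, fst (snd c ! k) = i)"
  by (simp add: col_def good_config_def case_prod_beta)

lemma col_step:
  assumes "wf_tm M" "good_config M c"
  shows "col (tm_step M c) i = next_col (snd (stepf M (glob c))) (col c (i - 1)) (col c i) (col c (i + 1))"
proof (rule nth_equalityI)
  note g = good_step[OF assms] and l = stepf_globals(2)[OF assms(1) glob_globals[OF assms(2)]]
  show "length (col (tm_step M c) i) =
      length (next_col (snd (stepf M (glob c))) (col c (i - 1)) (col c i) (col c (i + 1)))"
    using g l by (simp add: col_def next_col_def good_config_def)
  fix k assume "k < length (col (tm_step M c) i)"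
  then have k: "k < tapes M" using g by (simp add: col_def good_config_def)
  show "col (tm_step M c) i ! k =
      next_col (snd (stepf M (glob c))) (col c (i - 1)) (col c i) (col c (i + 1)) ! k"
    using act_bounds(2)[OF assms k]
    by (auto simp: col_nth[OF g k] col_nth[OF assms(2) k] next_col_def l k snd_step_nth[OF assms k])
qed

text \<open>On tape 1 the non-blank symbols of the certificate have to form an initial segment of the
  positions with \<open>guess\<close>.\<close>

definition initial :: "tm \<Rightarrow> bool \<Rightarrow> bool \<Rightarrow> nat \<Rightarrow> column \<Rightarrow> column \<Rightarrow> global \<Rightarrow> bool" where
  "initial M origin guess s c cr g \<longleftrightarrow> fst g = start M \<and> (\<forall>k<tapes M. snd (c ! k) = origin) \<and>
     (\<forall>k<tapes M. k \<noteq> 1 \<longrightarrow> fst (c ! k) = (if k = 0 then s else 0)) \<and> fst (c ! 1) < 3 \<and>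
     (if guess then fst (c ! 1) = 0 \<longrightarrow> fst (cr ! 1) = 0 else fst (c ! 1) = 0)"

text \<open>The first conjunct ties the global value to the columns: where a head stands, the
  claimed scanned symbol must be the one in the cell. Time and position enter only through the flags
  and the input symbol \<open>s\<close>, so that finitely many rules describe tableaux of all
  sizes.\<close>

definition rule :: "tm \<Rightarrow> bool \<Rightarrow> bool \<Rightarrow> bool \<Rightarrow> bool \<Rightarrow> nat \<Rightarrow> column \<Rightarrow> column \<Rightarrow> column \<Rightarrow> column \<Rightarrow>
    global \<Rightarrow> global \<Rightarrow> bool" where
  "rule M first final origin guess s cl c cr c' g g' \<longleftrightarrow>
     (\<forall>k<tapes M. snd (c ! k) \<longrightarrow> fst (c ! k) = snd g ! k) \<and>
     c' = next_col (snd (stepf M g)) cl c cr \<and> fst g' = fst (stepf M g) \<and>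
     (final \<longrightarrow> fst g' = acc M) \<and>
     (first \<longrightarrow> initial M origin guess s c cr g)"

text \<open>Column \<open>j\<close> stands for position \<open>j - S\<close>, so the window reaches
  from \<open>-S\<close> to \<open>S\<close>. As \<open>R < S\<close>, no head gets to its border
  within \<open>R\<close> steps, and cells outside, even letters of a long input, do not influence
  the run; \<open>P \<le> S\<close> lets the certificate fit.\<close>

locale tableau =
  fixes M :: tm and x :: "bool list" and P R S W :: nat
  assumes wf: "wf_tm M" and R: "0 < R" and S: "R < S" "P \<le> S" and W: "W = 2 * S + 1"
begin

definition sat :: "(nat \<Rightarrow> nat \<Rightarrow> column) \<Rightarrow> (nat \<Rightarrow> global) \<Rightarrow> bool" where
  "sat cv gv \<longleftrightarrow> (\<forall>t<R. \<forall>j<W. rule M (t = 0) (Suc t = R) (j = S) (S \<le> j \<and> j < S + P)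
     (if S \<le> j then sy x (j - S) else 0) (cv t (j - 1)) (cv t j) (cv t (if Suc j < W then Suc j else j))
     (cv (Suc t) j) (gv t) (gv (Suc t)))"

text \<open>At a border the missing neighbour is replaced by the border column itself. Of a
  neighbour only the head flags matter, and neither of the two columns carries a head.\<close>

lemma next_col_clip:
  assumes "good_config M c" "\<And>k. k < tapes M \<Longrightarrow> \<bar>fst (snd c ! k)\<bar> < int S" "j < W"
    "length acts = tapes M"
  shows "next_col acts (col c (int (j - 1) - int S)) (col c (int j - int S))
      (col c (int (if Suc j < W then Suc j else j) - int S)) =
    next_col acts (col c (int j - int S - 1)) (col c (int j - int S)) (col c (int j - int S + 1))"
proof -
  have l: "snd (col c (int (j - 1) - int S) ! k) = snd (col c (int j - int S - 1) ! k)" if "k < tapes M" for k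
  proof (cases "j = 0")
    case True
    have "fst (snd c ! k) \<noteq> - int S" "fst (snd c ! k) \<noteq> - int S - 1"
      using assms(2)[OF that] by linarith+
    then show ?thesis using True by (simp add: col_nth[OF assms(1) that])
  next
    case False
    then have *: "int (j - 1) - int S = int j - int S - 1" by (simp add: of_nat_diff)
    show ?thesis by (simp only: *)
  qed
  have r: "snd (col c (int (if Suc j < W then Suc j else j) - int S) ! k) = snd (col c (int j - int S + 1) ! k)"
    if "k < tapes M" for k
  proof (cases "Suc j < W")
    case True
    then have *: "int (if Suc j < W then Suc j else j) - int S = int j - int S + 1" by simp
    show ?thesis by (simp only: *)
  next
    case False
    then have "j = 2 * S" using assms(3) W by simp
    moreover have "fst (snd c ! k) \<noteq> int S" "fst (snd c ! k) \<noteq> int S + 1"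
      using assms(2)[OF that] by linarith+
    ultimately show ?thesis using False by (simp add: col_nth[OF assms(1) that])
  qed
  show ?thesis unfolding next_col_def using l r assms(4) by (intro map_cong refl) simp
qed

lemma run_Suc: "tm_run M ws (Suc t) = tm_step M (tm_run M ws t)"
  by (simp add: tm_run_def)

lemma col_run_Suc:
  assumes "t < R" "j < W"
  shows "col (tm_run M ws (Suc t)) (int j - int S) =
    next_col (snd (stepf M (glob (tm_run M ws t)))) (col (tm_run M ws t) (int (j - 1) - int S))
      (col (tm_run M ws t) (int j - int S)) (col (tm_run M ws t) (int (if Suc j < W then Suc j else j) - int S))"
proof -
  have "\<bar>fst (snd (tm_run M ws t) ! k)\<bar> < int S" if "k < tapes M" for k
    using head_bound[OF wf that, of ws t] assms(1) S by simp
  then show ?thesis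
    unfolding run_Suc col_step[OF wf good_run[OF wf]]
    using next_col_clip[OF good_run[OF wf], of ws t j] assms(2)
      stepf_globals(2)[OF wf glob_globals[OF good_run[OF wf]], of ws t] by simp
qed

lemma col_init:
  assumes "k < tapes M"
  shows "col (tm_run M [x, y] 0) i ! k =
    (if k = 0 then word_tape x i else if k = 1 then word_tape y i else 0, i = 0)"
proof -
  have "word_tape [] i = 0" by (simp add: word_tape_def)
  then show ?thesis using assms
    unfolding col_nth[OF good_run[OF wf] assms]
    by (auto simp: tm_run_def tm_init_def nth_Cons split: nat.split)
qed

lemma word_tape_window: "word_tape w (int j - int S) = (if S \<le> j then sy w (j - S) else 0)"
proof (cases "S \<le> j")
  case True
  then have *: "int j - int S = int (j - S)" by (simp add: of_nat_diff)
  show ?thesis unfolding * word_tape_sy using True by simp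
qed (simp add: word_tape_def)

lemma sat_run:
  assumes y: "length y \<le> P" and acc: "fst (tm_run M [x, y] R) = acc M"
  shows "sat (\<lambda>t j. col (tm_run M [x, y] t) (int j - int S)) (\<lambda>t. glob (tm_run M [x, y] t))"
  unfolding sat_def
proof (intro allI impI)
  fix t j assume t: "t < R" and j: "j < W"
  let ?c = "tm_run M [x, y] t"
  let ?r = "int (if Suc j < W then Suc j else j) - int S"
  have "2 \<le> tapes M" using wf by (simp add: wf_tm_def)
  have "fst (col ?c (int j - int S) ! k) = snd (glob ?c) ! k" if "k < tapes M" "snd (col ?c (int j - int S) ! k)" for k
    using that good_run[OF wf, of "[x, y]" t]
    by (simp add: col_nth[OF good_run[OF wf] that(1)] glob_def good_config_def case_prod_beta)
  then have "\<forall>k<tapes M. snd (col ?c (int j - int S) ! k) \<longrightarrow>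
      fst (col ?c (int j - int S) ! k) = snd (glob ?c) ! k" by blast
  moreover have "fst (glob (tm_run M [x, y] (Suc t))) = fst (stepf M (glob ?c))"
    unfolding run_Suc glob_def[of "tm_step M ?c"] fst_conv by (subst tm_step_stepf) simp
  moreover have "Suc t = R \<longrightarrow> fst (glob (tm_run M [x, y] (Suc t))) = acc M"
    using acc by (auto simp: glob_def)
  moreover have "initial M (j = S) (S \<le> j \<and> j < S + P) (if S \<le> j then sy x (j - S) else 0)
      (col ?c (int j - int S)) (col ?c ?r) (glob ?c)" if "t = 0"
  proof -
    have 1: "fst (col ?c i ! 1) = word_tape y i" for i
      using \<open>2 \<le> tapes M\<close> by (simp add: \<open>t = 0\<close> col_init)
    have "fst (glob ?c) = start M" by (simp add: \<open>t = 0\<close> glob_def tm_run_def tm_init_def)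
    moreover have "fst (col ?c (int j - int S) ! k) = (if k = 0 then (if S \<le> j then sy x (j - S) else 0) else 0)"
      if "k < tapes M" "k \<noteq> 1" for k
      using that by (simp add: \<open>t = 0\<close> col_init word_tape_window)
    moreover have "snd (col ?c (int j - int S) ! k) = (j = S)" if "k < tapes M" for k
      using that by (simp add: \<open>t = 0\<close> col_init)
    moreover have "word_tape y i < 3" for i by (simp add: word_tape_def)
    moreover have "if S \<le> j \<and> j < S + P then word_tape y (int j - int S) = 0 \<longrightarrow> word_tape y ?r = 0
      else word_tape y (int j - int S) = 0"
      unfolding word_tape_window using y by (auto simp: sy_def split: if_splits)
    ultimately show ?thesis unfolding initial_def 1 by blast
  qed
  then have "t = 0 \<longrightarrow> initial M (j = S) (S \<le> j \<and> j < S + P) (if S \<le> j then sy x (j - S) else 0)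
      (col ?c (int j - int S)) (col ?c ?r) (glob ?c)"
    by (rule impI)
  ultimately show "rule M (t = 0) (Suc t = R) (j = S) (S \<le> j \<and> j < S + P)
     (if S \<le> j then sy x (j - S) else 0) (col ?c (int (j - 1) - int S)) (col ?c (int j - int S)) (col ?c ?r)
     (col (tm_run M [x, y] (Suc t)) (int j - int S)) (glob ?c) (glob (tm_run M [x, y] (Suc t)))"
    unfolding rule_def col_run_Suc[OF t j] by blast
qed

lemma ruleD:
  assumes "sat cv gv" "t < R" "j < W"
  shows "rule M (t = 0) (Suc t = R) (j = S) (S \<le> j \<and> j < S + P)
     (if S \<le> j then sy x (j - S) else 0) (cv t (j - 1)) (cv t j) (cv t (if Suc j < W then Suc j else j))
     (cv (Suc t) j) (gv t) (gv (Suc t))"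
  using assms unfolding sat_def by blast

lemma run_sat:
  assumes cv: "\<And>t j. t \<le> R \<Longrightarrow> j < W \<Longrightarrow> cv t j \<in> columns M"
    and gv: "\<And>t. t \<le> R \<Longrightarrow> gv t \<in> globals M" and sat: "sat cv gv"
  shows "\<exists>y. length y \<le> P \<and> fst (tm_run M [x, y] R) = acc M"
proof -
  \<comment> \<open>The certificate is read off from tape 1 in the first row; it ends at the first
    blank or at length \<open>P\<close>.\<close>
  define b where "b i = fst (cv 0 (S + i) ! 1)" for i
  have K: "2 \<le> tapes M" using wf by (simp add: wf_tm_def)
  have b3: "b i < 3" and bs: "b i = 0 \<Longrightarrow> b (Suc i) = 0" if "i < P" for i
  proof -
    have j: "S + i < W" "Suc (S + i) < W" using that S W by auto
    show "b i < 3" "b i = 0 \<Longrightarrow> b (Suc i) = 0"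
      using ruleD[OF sat R j(1)] that j unfolding rule_def initial_def b_def by simp_all
  qed
  define len where "len = (LEAST i. i = P \<or> b i = 0)"
  have len: "len = P \<or> b len = 0" unfolding len_def by (rule LeastI[of _ P]) simp
  have "len \<le> P" unfolding len_def by (rule Least_le) simp
  have pos: "b i \<noteq> 0" if "i < len" for i using not_less_Least[of i "\<lambda>i. i = P \<or> b i = 0"] that by (simp add: len_def)
  have zero: "b i = 0" if "len \<le> i" "i < P" for i
    using that
  proof (induction i rule: dec_induct)
    case base
    then show ?case using len by auto
  next
    case (step i)
    then show ?case using bs[of i] by simp
  qed
  define y where "y = map (\<lambda>i. b i = 2) [0..<len]"
  have y: "sy y i = b i" if "i < P" for i
  proof (cases "i < len")
    case True
    then have "b i = 1 \<or> b i = 2" using pos[OF True] b3[OF that] by linarith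
    then show ?thesis using True by (auto simp: sy_def y_def)
  next
    case False
    then show ?thesis using zero[of i] that by (simp add: sy_def y_def)
  qed
  have y0: "sy y i = 0" if "P \<le> i" for i using that \<open>len \<le> P\<close> by (simp add: sy_def y_def)
  define c where "c t = tm_run M [x, y] t" for t
  have good: "good_config M (c t)" for t unfolding c_def by (rule good_run[OF wf])
  have init: "cv 0 j = col (c 0) (int j - int S)" if j: "j < W" for j
  proof (rule nth_equalityI)
    have l: "length (cv 0 j) = tapes M" using cv[of 0 j] j by (simp add: columns_def)
    then show "length (cv 0 j) = length (col (c 0) (int j - int S))"
      using good[of 0] by (simp add: col_def good_config_def)
    fix k assume "k < length (cv 0 j)"
    then have k: "k < tapes M" using l by simp
    note r = ruleD[OF sat R j, unfolded rule_def initial_def, simplified]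
    have "snd (cv 0 j ! k) = (j = S)" using r k by simp
    moreover have "fst (cv 0 j ! k) = (if k = 0 then word_tape x (int j - int S)
        else if k = 1 then word_tape y (int j - int S) else 0)"
    proof (cases "k = 1")
      case True
      have "fst (cv 0 j ! 1) = word_tape y (int j - int S)"
      proof (cases "S \<le> j \<and> j < S + P")
        case True
        then show ?thesis using y[of "j - S"] unfolding word_tape_window by (simp add: b_def less_diff_conv2)
      next
        case False
        then have "fst (cv 0 j ! 1) = 0" using r by auto
        then show ?thesis using False y0[of "j - S"] unfolding word_tape_window by auto
      qed
      then show ?thesis using True by simp
    next
      case False
      then show ?thesis using r k unfolding word_tape_window by simp
    qed
    ultimately show "cv 0 j ! k = col (c 0) (int j - int S) ! k"
      unfolding c_def col_init[OF k] by (simp add: prod_eq_iff)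
  qed
  have g0: "fst (gv 0) = fst (c 0)"
  proof -
    have "0 < W" using W by simp
    then show ?thesis using ruleD[OF sat R] unfolding rule_def initial_def by (auto simp: c_def tm_run_def tm_init_def)
  qed
  have globs: "gv t = glob (c t)"
    if t: "t < R" and cols: "\<And>j. j < W \<Longrightarrow> cv t j = col (c t) (int j - int S)" and st: "fst (gv t) = fst (c t)" for t
  proof -
    have l: "length (snd (gv t)) = tapes M" using gv[of t] t by (auto simp: globals_def)
    have "snd (gv t) = snd (glob (c t))"
    proof (rule nth_equalityI)
      show "length (snd (gv t)) = length (snd (glob (c t)))"
        using l good[of t] by (simp add: glob_def good_config_def)
      fix k assume "k < length (snd (gv t))"
      then have k: "k < tapes M" using l by simp
      define h where "h = fst (snd (c t) ! k)"
      \<comment> \<open>The head lies inside the window, so the rule for its column fixes the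
        claimed symbol.\<close>
      have "\<bar>h\<bar> < int S" using head_bound[OF wf k, of "[x, y]" t] t S by (simp add: h_def c_def)
      then have j: "nat (h + int S) < W" "int (nat (h + int S)) - int S = h" using W by auto
      then have "cv t (nat (h + int S)) ! k = (snd (snd (c t) ! k) h, True)"
        using cols[OF j(1)] col_nth[OF good k] by (simp add: h_def)
      then have "snd (snd (c t) ! k) h = snd (gv t) ! k"
        using ruleD[OF sat t j(1)] k unfolding rule_def initial_def by auto
      then show "snd (gv t) ! k = snd (glob (c t)) ! k"
        using k good[of t] by (simp add: glob_def good_config_def case_prod_beta h_def)
    qed
    then show ?thesis using st by (simp add: prod_eq_iff glob_def)
  qed
  \<comment> \<open>Of the global value in the last row only the state is determined, since scanned
    symbols are checked for \<open>t < R\<close> only.\<close>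
  have main: "(\<forall>j<W. cv t j = col (c t) (int j - int S)) \<and> fst (gv t) = fst (c t)" if "t \<le> R" for t
    using that
  proof (induction t)
    case 0
    then show ?case using init g0 by simp
  next
    case (Suc t)
    then have t: "t < R" and IH: "\<And>j. j < W \<Longrightarrow> cv t j = col (c t) (int j - int S)" "fst (gv t) = fst (c t)"
      by simp_all
    note g = globs[OF t IH]
    have "cv (Suc t) j = col (c (Suc t)) (int j - int S)" if j: "j < W" for j
    proof -
      have "j - 1 < W" "(if Suc j < W then Suc j else j) < W" using j by auto
      note IH' = IH(1)[OF this(1)] IH(1)[OF j] IH(1)[OF this(2)]
      have "cv (Suc t) j = next_col (snd (stepf M (gv t))) (cv t (j - 1)) (cv t j)
          (cv t (if Suc j < W then Suc j else j))"
        using ruleD[OF sat t j] unfolding rule_def initial_def by blast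
      also have "\<dots> = col (c (Suc t)) (int j - int S)"
        by (simp only: IH' g col_run_Suc[OF t j, of "[x, y]", folded c_def])
      finally show ?thesis .
    qed
    moreover have "fst (gv (Suc t)) = fst (c (Suc t))"
    proof -
      have "0 < W" using W by simp
      then have "fst (gv (Suc t)) = fst (stepf M (gv t))"
        using ruleD[OF sat t] unfolding rule_def initial_def by blast
      then show ?thesis by (simp add: g c_def run_Suc tm_step_stepf)
    qed
    ultimately show ?case by blast
  qed
  have "fst (gv R) = acc M"
  proof -
    have "0 < W" "R - 1 < R" "Suc (R - 1) = R" using W R by simp_all
    then show ?thesis using ruleD[OF sat \<open>R - 1 < R\<close> \<open>0 < W\<close>] unfolding rule_def initial_def by auto
  qed
  then have "fst (tm_run M [x, y] R) = acc M" using main[of R] by (simp add: c_def)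
  moreover have "length y \<le> P" using \<open>len \<le> P\<close> by (simp add: y_def)
  ultimately show ?thesis by blast
qed

theorem tableau_iff:
  "(\<exists>y. length y \<le> P \<and> fst (tm_run M [x, y] R) = acc M) \<longleftrightarrow>
    (\<exists>cv gv. (\<forall>t\<le>R. gv t \<in> globals M \<and> (\<forall>j<W. cv t j \<in> columns M)) \<and> sat cv gv)"
proof
  assume "\<exists>y. length y \<le> P \<and> fst (tm_run M [x, y] R) = acc M"
  then obtain y where "length y \<le> P" "fst (tm_run M [x, y] R) = acc M" by blast
  from sat_run[OF this] show "\<exists>cv gv. (\<forall>t\<le>R. gv t \<in> globals M \<and> (\<forall>j<W. cv t j \<in> columns M)) \<and> sat cv gv"
    using glob_globals[OF good_run[OF wf]] col_columns[OF good_run[OF wf]]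
    by (intro exI conjI allI impI)
next
  assume "\<exists>cv gv. (\<forall>t\<le>R. gv t \<in> globals M \<and> (\<forall>j<W. cv t j \<in> columns M)) \<and> sat cv gv"
  then show "\<exists>y. length y \<le> P \<and> fst (tm_run M [x, y] R) = acc M" using run_sat by blast
qed

end

section \<open>Hardness\<close>

lemma ex_digits:
  assumes "\<And>i. i < k \<Longrightarrow> a i < (A::nat)"
  shows "\<exists>\<tau><A ^ k. \<forall>i<k. \<tau> div A ^ i mod A = a i"
  using assms
proof (induction k arbitrary: a)
  case (Suc k)
  obtain \<tau> where \<tau>: "\<tau> < A ^ k" "\<And>i. i < k \<Longrightarrow> \<tau> div A ^ i mod A = a (Suc i)"
    using Suc.IH[of "\<lambda>i. a (Suc i)"] Suc.prems by auto
  have a0: "a 0 < A" using Suc.prems by simp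
  show ?case
  proof (intro exI[of _ "a 0 + A * \<tau>"] conjI allI impI)
    have "a 0 + A * \<tau> < A * (\<tau> + 1)" using a0 by simp
    also have "\<dots> \<le> A * A ^ k" using \<tau>(1) by (intro mult_left_mono) auto
    finally show "a 0 + A * \<tau> < A ^ Suc k" by simp
    fix i assume "i < Suc k"
    then show "(a 0 + A * \<tau>) div A ^ i mod A = a i"
      using a0 \<tau>(2) by (cases i) (simp_all add: div_mult2_eq)
  qed
qed simp

definition digit :: "nat \<Rightarrow> nat \<Rightarrow> nat \<Rightarrow> nat" where
  "digit A \<tau> i = \<tau> div A ^ i mod A"

text \<open>The elements from \<open>U\<close> on are all pairs of a constraint and an assignment,
  numbered \<open>w * A ^ 6 + \<tau>\<close>. If \<open>\<tau>\<close> is allowed, every set covers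
  the element, so the number of elements does not depend on \<open>allowed\<close>.\<close>

definition csp_cov :: "nat \<Rightarrow> nat \<Rightarrow> (nat \<Rightarrow> nat \<Rightarrow> nat) \<Rightarrow> (nat \<Rightarrow> nat \<Rightarrow> bool) \<Rightarrow> nat \<Rightarrow> nat \<Rightarrow> bool" where
  "csp_cov U A scope allowed s e \<longleftrightarrow>
     (if e < U then s div A = e
      else allowed ((e - U) div A ^ 6) ((e - U) mod A ^ 6) \<or>
        (\<exists>i<6. s div A = scope i ((e - U) div A ^ 6) \<and>
           s mod A \<noteq> digit A ((e - U) mod A ^ 6) i))"

text \<open>Constraints of arity 6 over \<open>U\<close> variables with values below \<open>A\<close>. The set \<open>u * A + a\<close> stands
  for \<open>u = a\<close>. The first \<open>U\<close> elements force one value per variable when only \<open>U\<close> sets may be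
  used; each further element forbids one assignment \<open>\<tau>\<close> to the scope of one constraint.\<close>

locale csp =
  fixes U A C :: nat and scope :: "nat \<Rightarrow> nat \<Rightarrow> nat" and allowed :: "nat \<Rightarrow> nat \<Rightarrow> bool"
  assumes U: "even U" "0 < U" and A: "2 \<le> A"
    and scope: "\<And>i w. i < 6 \<Longrightarrow> w < C \<Longrightarrow> scope i w < U"
begin

definition satisfies :: "(nat \<Rightarrow> nat) \<Rightarrow> bool" where
  "satisfies val \<longleftrightarrow> (\<forall>u<U. val u < A) \<and>
     (\<forall>w<C. \<forall>\<tau><A ^ 6. (\<forall>i<6. val (scope i w) = digit A \<tau> i) \<longrightarrow> allowed w \<tau>)"

lemma index: "a < A \<Longrightarrow> (u * A + a) div A = u" "a < A \<Longrightarrow> (u * A + a) mod A = a"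
  using A by simp_all

lemma index_less: "u < U \<Longrightarrow> a < A \<Longrightarrow> u * A + a < U * A"
  using mult_le_mono1[of "Suc u" U A] by simp

sublocale cover_graph "U * A" "U + C * A ^ 6" "U * A + (U + C * A ^ 6)" U "csp_cov U A scope allowed"
proof
  have "U * 1 \<le> U * A" using A by (intro mult_left_mono) auto
  then show "U \<le> U * A" by simp
  fix e assume e: "e < U + C * A ^ 6"
  show "\<exists>s<U * A. csp_cov U A scope allowed s e"
  proof (cases "e < U")
    case True
    then show ?thesis using A index[of 0 e] index_less[of e 0]
      by (intro exI[of _ "e * A"]) (simp add: csp_cov_def)
  next
    case False
    define w \<tau> where "w = (e - U) div A ^ 6" and "\<tau> = (e - U) mod A ^ 6"
    have "w < C" unfolding w_def using e False by (intro less_mult_imp_div_less) auto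
    \<comment> \<open>A value other than the first digit contradicts \<open>\<tau>\<close>; it
      exists since \<open>A\<close> is at least 2.\<close>
    define a where "a = (if digit A \<tau> 0 = 0 then 1 else 0::nat)"
    have a: "a < A" "a \<noteq> digit A \<tau> 0" using A by (auto simp: a_def)
    then show ?thesis using False scope[of 0 w] \<open>w < C\<close> index[of a "scope 0 w"] index_less[of "scope 0 w" a]
      by (intro exI[of _ "scope 0 w * A + a"]) (auto simp: csp_cov_def w_def[symmetric] \<tau>_def[symmetric] intro!: exI[of _ 0])
  qed
qed (use U in auto)

lemma cover_satisfies:
  assumes C: "D \<subseteq> {..<U * A}" "card D \<le> U"
    "\<And>e. e < U + C * A ^ 6 \<Longrightarrow> \<exists>s\<in>D. csp_cov U A scope allowed s e"
  shows "\<exists>val. satisfies val"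
proof -
  have fin: "finite D" using C(1) finite_subset by blast
  have "\<exists>s\<in>D. s div A = u" if "u < U" for u
    using C(3)[of u] that by (auto simp: csp_cov_def)
  then obtain g where g: "\<And>u. u < U \<Longrightarrow> g u \<in> D \<and> g u div A = u" by metis
  have "inj_on g {..<U}" by (rule inj_onI) (metis g lessThan_iff)
  then have "card (g ` {..<U}) = U" by (simp add: card_image)
  moreover have "g ` {..<U} \<subseteq> D" using g by auto
  \<comment> \<open>The first \<open>U\<close> elements need \<open>U\<close> different sets, so the
    cover has exactly one set, that is one value, for each variable.\<close>
  ultimately have D: "g ` {..<U} = D" using C(2) fin by (metis card_seteq)
  define val where "val u = g u mod A" for u
  have "val u < A" for u using A by (simp add: val_def)
  moreover have "allowed w \<tau>"
    if w: "w < C" and \<tau>: "\<tau> < A ^ 6" and eq: "\<forall>i<6. val (scope i w) = digit A \<tau> i" for w \<tau>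
  proof -
    have "(w + 1) * A ^ 6 \<le> C * A ^ 6" using w by (intro mult_right_mono) auto
    then have e: "U + (w * A ^ 6 + \<tau>) < U + C * A ^ 6" using \<tau> by simp
    then obtain s where "s \<in> D" and s: "csp_cov U A scope allowed s (U + (w * A ^ 6 + \<tau>))"
      using C(3)[OF e] by blast
    then obtain u where u: "u < U" "s = g u" using D by blast
    have "s div A = u" "s mod A = val u" using g[OF u(1)] u(2) by (simp_all add: val_def)
    moreover have "(w * A ^ 6 + \<tau>) div A ^ 6 = w" "(w * A ^ 6 + \<tau>) mod A ^ 6 = \<tau>"
      using \<tau> A by simp_all
    ultimately show ?thesis using s eq by (auto simp: csp_cov_def)
  qed
  ultimately show ?thesis unfolding satisfies_def by blast
qed

lemma satisfies_cover:
  assumes "satisfies val"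
  shows "\<exists>D\<subseteq>{..<U * A}. card D \<le> U \<and> (\<forall>e<U + C * A ^ 6. \<exists>s\<in>D. csp_cov U A scope allowed s e)"
proof -
  have val: "\<And>u. u < U \<Longrightarrow> val u < A" using assms by (simp add: satisfies_def)
  define D where "D = (\<lambda>u. u * A + val u) ` {..<U}"
  have "card D \<le> U" unfolding D_def by (metis card_image_le card_lessThan finite_lessThan)
  moreover have "D \<subseteq> {..<U * A}" using val index_less by (auto simp: D_def)
  moreover have "\<exists>s\<in>D. csp_cov U A scope allowed s e" if e: "e < U + C * A ^ 6" for e
  proof (cases "e < U")
    case True
    then show ?thesis using index(1)[OF val] by (intro bexI[of _ "e * A + val e"]) (auto simp: csp_cov_def D_def)
  next
    case False
    define w \<tau> where "w = (e - U) div A ^ 6" and "\<tau> = (e - U) mod A ^ 6"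
    have w: "w < C" unfolding w_def using e False by (intro less_mult_imp_div_less) auto
    have \<tau>: "\<tau> < A ^ 6" using A by (simp add: \<tau>_def)
    show ?thesis
    proof (cases "allowed w \<tau>")
      case True
      have "0 * A + val 0 \<in> D" using U by (force simp: D_def)
      then show ?thesis using True False by (auto simp: csp_cov_def w_def \<tau>_def)
    next
      case na: False
      then obtain i where i: "i < 6" "val (scope i w) \<noteq> digit A \<tau> i"
        using assms w \<tau> unfolding satisfies_def by blast
      let ?s = "scope i w * A + val (scope i w)"
      have "?s \<in> D" using scope[OF i(1) w] by (auto simp: D_def)
      moreover have "csp_cov U A scope allowed ?s e"
        using False i index[OF val[OF scope[OF i(1) w]], of "scope i w"]
        by (auto simp: csp_cov_def w_def[symmetric] \<tau>_def[symmetric])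
      ultimately show ?thesis by blast
    qed
  qed
  ultimately show ?thesis by blast
qed

lemmas gp5_csp = gp5

lemma csp_iff: "(\<exists>D. semipaired_dominating_set G D \<and> card D \<le> 2 * (U * A + (U + C * A ^ 6)) + U) \<longleftrightarrow>
    (\<exists>val. satisfies val)"
  unfolding cover_iff using cover_satisfies satisfies_cover by blast

end

text \<open>The variable \<open>t * (W + 1) + j\<close> holds column \<open>j < W\<close> at time \<open>t\<close>; \<open>t * (W + 1) + W\<close> holds the
  global value.\<close>

definition scope :: "nat \<Rightarrow> nat \<Rightarrow> nat \<Rightarrow> nat" where
  "scope W i w = w div W * (W + 1) +
     (if i = 0 then w mod W - 1 else if i = 1 then w mod W
      else if i = 2 then (if Suc (w mod W) < W then Suc (w mod W) else w mod W)
      else if i = 3 then W + 1 + w mod W else if i = 4 then W else W + 1 + W)"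

section \<open>Tableaux as constraint satisfaction problems\<close>

definition flags :: "bool \<Rightarrow> bool \<Rightarrow> bool \<Rightarrow> bool \<Rightarrow> nat \<Rightarrow> nat" where
  "flags first final origin guess s =
     of_bool first + 2 * (of_bool final + 2 * (of_bool origin + 2 * (of_bool guess + 2 * s)))"

lemma flags_decode:
  "odd (flags a b c d s) = a" "odd (flags a b c d s div 2) = b" "odd (flags a b c d s div 2 div 2) = c"
  "odd (flags a b c d s div 2 div 2 div 2) = d" "flags a b c d s div 2 div 2 div 2 div 2 = s"
proof -
  have "(of_bool q + 2 * m) div 2 = m" "odd (of_bool q + 2 * m) = q" for q and m :: nat
    by (cases q; simp)+
  then show "odd (flags a b c d s) = a" "odd (flags a b c d s div 2) = b" "odd (flags a b c d s div 2 div 2) = c"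
    "odd (flags a b c d s div 2 div 2 div 2) = d" "flags a b c d s div 2 div 2 div 2 div 2 = s"
    by (simp_all only: flags_def)
qed

text \<open>Four flags and a symbol below 3 give \<open>16 * 3 = 48\<close> codes.\<close>

lemma flags_less:
  assumes "s < 3" shows "flags a b c d s < 48"
proof -
  have "flags a b c d s \<le> 1 + 2 * (1 + 2 * (1 + 2 * (1 + 2 * s)))"
    unfolding flags_def by (intro add_mono mult_left_mono) auto
  also have "\<dots> < 48" using assms by simp
  finally show ?thesis .
qed

text \<open>All variables share one range of values. For injective \<open>f\<close>, a value of the
  wrong kind, such as the code of a global value in a column variable, satisfies no rule.\<close>

definition code_rule :: "tm \<Rightarrow> (column + global \<Rightarrow> nat) \<Rightarrow> nat \<Rightarrow> (nat \<Rightarrow> nat) \<Rightarrow> bool" where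
  "code_rule M f \<iota> d \<longleftrightarrow> (\<exists>cl\<in>columns M. \<exists>c\<in>columns M. \<exists>cr\<in>columns M. \<exists>c'\<in>columns M.
     \<exists>g\<in>globals M. \<exists>g'\<in>globals M.
     d 0 = f (Inl cl) \<and> d 1 = f (Inl c) \<and> d 2 = f (Inl cr) \<and> d 3 = f (Inl c') \<and>
     d 4 = f (Inr g) \<and> d 5 = f (Inr g') \<and>
     rule M (odd \<iota>) (odd (\<iota> div 2)) (odd (\<iota> div 2 div 2)) (odd (\<iota> div 2 div 2 div 2))
       (\<iota> div 2 div 2 div 2 div 2) cl c cr c' g g')"

text \<open>The table depends on the machine and the coding, not on the input. Being finite, it can
  be wired into the formula of the reduction.\<close>

definition code_table :: "tm \<Rightarrow> (column + global \<Rightarrow> nat) \<Rightarrow> nat \<Rightarrow> nat set" where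
  "code_table M f A = {s. s < 48 * A ^ 6 \<and> code_rule M f (s div A ^ 6) (digit A (s mod A ^ 6))}"

lemma finite_code_table: "finite (code_table M f A)"
  unfolding code_table_def by simp

definition info :: "bool list \<Rightarrow> nat \<Rightarrow> nat \<Rightarrow> nat \<Rightarrow> nat \<Rightarrow> nat \<Rightarrow> nat" where
  "info x P R S W w = flags (w div W = 0) (Suc (w div W) = R) (w mod W = S)
     (S \<le> w mod W \<and> w mod W < S + P) (if S \<le> w mod W then sy x (w mod W - S) else 0)"

context tableau
begin

definition U where "U = (R + 1) * (W + 1)"

lemma csp_tableau: "2 \<le> A \<Longrightarrow> csp U A (R * W) (scope W)"
proof
  have idx: "t * (W + 1) + j < U" if "t \<le> R" "j \<le> W" for t j
  proof -
    have "(t + 1) * (W + 1) \<le> U" unfolding U_def using that by (intro mult_right_mono) auto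
    then show ?thesis using that by simp
  qed
  \<comment> \<open>This is what the odd width \<open>2 * S + 1\<close> is for: \<open>U\<close> is
    the number of sets to be paired.\<close>
  have "even (W + 1)" by (simp add: W)
  then show "even U" unfolding U_def by simp
  show "0 < U" by (simp add: U_def)
  show "scope W i w < U" if "i < 6" "w < R * W" for i w
  proof -
    have wt: "w div W < R" "w mod W < W"
      using that W by (simp_all add: less_mult_imp_div_less)
    define t j where "t = w div W" and "j = w mod W"
    have "Suc t * (W + 1) + W < U" using idx[of "Suc t" W] wt by (simp add: t_def)
    moreover have "scope W i w \<le> Suc t * (W + 1) + W"
      using wt(2) unfolding scope_def t_def[symmetric] j_def[symmetric] by auto
    ultimately show ?thesis by simp
  qed
qed

lemma ex_code_values:
  assumes f: "inj_on f (Inl ` columns M \<union> Inr ` globals M)" "f ` (Inl ` columns M \<union> Inr ` globals M) \<subseteq> {..<A}"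
    and A: "2 \<le> A"
  shows "(\<exists>y. length y \<le> P \<and> fst (tm_run M [x, y] R) = acc M) \<longleftrightarrow>
    (\<exists>val. csp.satisfies U A (R * W) (scope W) (\<lambda>w \<tau>. info x P R S W w * A ^ 6 + \<tau> \<in> code_table M f A) val)"
proof -
  let ?allowed = "\<lambda>w \<tau>. info x P R S W w * A ^ 6 + \<tau> \<in> code_table M f A"
  have W0: "0 < W" using W by simp
  have sy3: "sy v i < 3" for v i by (simp add: sy_def)
  have wt: "w div W < R" "w mod W < W" if "w < R * W" for w
    using that W0 by (simp_all add: less_mult_imp_div_less)
  interpret csp U A "R * W" "scope W" ?allowed by (rule csp_tableau[OF A])
  have allowed: "?allowed w \<tau> \<longleftrightarrow> code_rule M f (info x P R S W w) (digit A \<tau>)" if "\<tau> < A ^ 6" for w \<tau>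
  proof -
    have \<iota>: "info x P R S W w < 48" unfolding info_def using sy3 by (intro flags_less) auto
    have "info x P R S W w * A ^ 6 + \<tau> < (info x P R S W w + 1) * A ^ 6" using that by simp
    also have "\<dots> \<le> 48 * A ^ 6" using \<iota> by (intro mult_right_mono) auto
    finally have "info x P R S W w * A ^ 6 + \<tau> < 48 * A ^ 6" .
    moreover have "(info x P R S W w * A ^ 6 + \<tau>) div A ^ 6 = info x P R S W w"
      using that A by simp
    ultimately show ?thesis using that by (simp add: code_table_def)
  qed
  have rule: "code_rule M f (info x P R S W w) d \<longleftrightarrow>
    (\<exists>cl\<in>columns M. \<exists>c\<in>columns M. \<exists>cr\<in>columns M. \<exists>c'\<in>columns M. \<exists>g\<in>globals M. \<exists>g'\<in>globals M.
     d 0 = f (Inl cl) \<and> d 1 = f (Inl c) \<and> d 2 = f (Inl cr) \<and> d 3 = f (Inl c') \<and>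
     d 4 = f (Inr g) \<and> d 5 = f (Inr g') \<and>
     rule M (w div W = 0) (Suc (w div W) = R) (w mod W = S) (S \<le> w mod W \<and> w mod W < S + P)
       (if S \<le> w mod W then sy x (w mod W - S) else 0) cl c cr c' g g')" for w d
    unfolding code_rule_def info_def flags_decode ..
  show ?thesis unfolding tableau_iff
  proof
    assume "\<exists>cv gv. (\<forall>t\<le>R. gv t \<in> globals M \<and> (\<forall>j<W. cv t j \<in> columns M)) \<and> sat cv gv"
    then obtain cv gv where gv: "\<And>t. t \<le> R \<Longrightarrow> gv t \<in> globals M"
      and cv: "\<And>t j. t \<le> R \<Longrightarrow> j < W \<Longrightarrow> cv t j \<in> columns M" and sat: "sat cv gv" by blast
    define val where "val u = (if u mod (W + 1) < W then f (Inl (cv (u div (W + 1)) (u mod (W + 1))))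
      else f (Inr (gv (u div (W + 1)))))" for u
    have block: "(t * m + j) div m = t \<and> (t * m + j) mod m = j" if "j < m" for t j m :: nat
      using that by simp
    have val_c: "val (t * (W + 1) + j) = f (Inl (cv t j))" if "j < W" for t j
      using that block[of j "W + 1" t] unfolding val_def by simp
    have val_g: "val (t * (W + 1) + W) = f (Inr (gv t))" for t
      using block[of W "W + 1" t] unfolding val_def by simp
    have "val u < A" if "u < U" for u
    proof -
      have "u div (W + 1) < R + 1" using that unfolding U_def by (rule less_mult_imp_div_less)
      then have "u div (W + 1) \<le> R" by simp
      moreover have "f (Inl c) < A" if "c \<in> columns M" for c
        using f(2) imageI[of "Inl c" "Inl ` columns M \<union> Inr ` globals M" f] that by auto
      moreover have "f (Inr g) < A" if "g \<in> globals M" for g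
        using f(2) imageI[of "Inr g" "Inl ` columns M \<union> Inr ` globals M" f] that by auto
      ultimately show ?thesis using gv cv unfolding val_def by auto
    qed
    moreover have "?allowed w \<tau>"
      if w: "w < R * W" and \<tau>: "\<tau> < A ^ 6" and eq: "\<forall>i<6. val (scope W i w) = digit A \<tau> i" for w \<tau>
    proof -
      let ?t = "w div W" and ?j = "w mod W"
      let ?r = "if Suc ?j < W then Suc ?j else ?j"
      note tj = wt[OF w]
      have s: "scope W 3 w = Suc ?t * (W + 1) + ?j" "scope W 5 w = Suc ?t * (W + 1) + W"
        "scope W 0 w = ?t * (W + 1) + (?j - 1)" "scope W 1 w = ?t * (W + 1) + ?j"
        "scope W 2 w = ?t * (W + 1) + ?r" "scope W 4 w = ?t * (W + 1) + W"
        by (simp_all add: scope_def)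
      have j: "?j - 1 < W" "?r < W" using tj by auto
      have d: "digit A \<tau> 0 = f (Inl (cv ?t (?j - 1)))" "digit A \<tau> 1 = f (Inl (cv ?t ?j))"
        "digit A \<tau> 2 = f (Inl (cv ?t ?r))" "digit A \<tau> 3 = f (Inl (cv (Suc ?t) ?j))"
        "digit A \<tau> 4 = f (Inr (gv ?t))" "digit A \<tau> 5 = f (Inr (gv (Suc ?t)))"
        using eq[rule_format, of 0] eq[rule_format, of 1] eq[rule_format, of 2] eq[rule_format, of 3]
          eq[rule_format, of 4] eq[rule_format, of 5]
        unfolding s val_c[OF j(1)] val_c[OF j(2)] val_c[OF tj(2)] val_g by simp_all
      have t: "?t \<le> R" "Suc ?t \<le> R" using tj(1) by simp_all
      show ?thesis unfolding allowed[OF \<tau>] rule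
        by (intro bexI[OF _ cv[OF t(1) j(1)]] bexI[OF _ cv[OF t(1) tj(2)]] bexI[OF _ cv[OF t(1) j(2)]]
          bexI[OF _ cv[OF t(2) tj(2)]] bexI[OF _ gv[OF t(1)]] bexI[OF _ gv[OF t(2)]] conjI d
          ruleD[OF sat tj])
    qed
    ultimately show "\<exists>val. satisfies val" unfolding satisfies_def by blast
  next
    assume "\<exists>val. satisfies val"
    then obtain val where val: "\<And>u. u < U \<Longrightarrow> val u < A" and ok: "\<And>w \<tau>. w < R * W \<Longrightarrow> \<tau> < A ^ 6 \<Longrightarrow>
        \<forall>i<6. val (scope W i w) = digit A \<tau> i \<Longrightarrow> ?allowed w \<tau>"
      unfolding satisfies_def by blast
    \<comment> \<open>A value below \<open>A\<close> need not be the code of a column; that it is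
      one follows in \<open>step\<close>, from a constraint in which the variable occurs.\<close>
    define cv where "cv t j = (SOME c. c \<in> columns M \<and> f (Inl c) = val (t * (W + 1) + j))" for t j
    define gv where "gv t = (SOME g. g \<in> globals M \<and> f (Inr g) = val (t * (W + 1) + W))" for t
    have cvI: "cv t j = c" if "c \<in> columns M" "f (Inl c) = val (t * (W + 1) + j)" for t j c
      unfolding cv_def
    proof (rule some_equality)
      fix c' assume c': "c' \<in> columns M \<and> f (Inl c') = val (t * (W + 1) + j)"
      then have "Inl c' = (Inl c :: column + global)" using that by (intro inj_onD[OF f(1)]) auto
      then show "c' = c" by simp
    qed (use that in simp)
    have gvI: "gv t = g" if "g \<in> globals M" "f (Inr g) = val (t * (W + 1) + W)" for t g
      unfolding gv_def
    proof (rule some_equality)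
      fix g' assume g': "g' \<in> globals M \<and> f (Inr g') = val (t * (W + 1) + W)"
      then have "Inr g' = (Inr g :: column + global)" using that by (intro inj_onD[OF f(1)]) auto
      then show "g' = g" by simp
    qed (use that in simp)
    have step: "rule M (t = 0) (Suc t = R) (j = S) (S \<le> j \<and> j < S + P) (if S \<le> j then sy x (j - S) else 0)
        (cv t (j - 1)) (cv t j) (cv t (if Suc j < W then Suc j else j)) (cv (Suc t) j) (gv t) (gv (Suc t)) \<and>
        cv t j \<in> columns M \<and> cv (Suc t) j \<in> columns M \<and> gv t \<in> globals M \<and> gv (Suc t) \<in> globals M"
      if t: "t < R" and j: "j < W" for t j
    proof -
      define w where "w = t * W + j"
      have w: "w < R * W" "w div W = t" "w mod W = j"
      proof -
        have "(t + 1) * W \<le> R * W" using t by (intro mult_right_mono) auto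
        then show "w < R * W" using j by (simp add: w_def)
      qed (use j in \<open>simp_all add: w_def\<close>)
      \<comment> \<open>\<open>\<tau>\<close> lists the actual values of the six variables, so the
        constraint applies to it.\<close>
      obtain \<tau> where \<tau>: "\<tau> < A ^ 6" "\<forall>i<6. \<tau> div A ^ i mod A = val (scope W i w)"
        using ex_digits[of 6 "\<lambda>i. val (scope W i w)" A] val scope w(1) by blast
      have d: "digit A \<tau> i = val (scope W i w)" if "i < 6" for i using \<tau>(2) that by (simp add: digit_def)
      then have "?allowed w \<tau>" using ok[OF w(1) \<tau>(1)] by simp
      then obtain cl c cr c' g g' where in_sets: "cl \<in> columns M" "c \<in> columns M" "cr \<in> columns M" "c' \<in> columns M"
        "g \<in> globals M" "g' \<in> globals M"
        and eqs: "digit A \<tau> 0 = f (Inl cl)" "digit A \<tau> 1 = f (Inl c)" "digit A \<tau> 2 = f (Inl cr)"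
        "digit A \<tau> 3 = f (Inl c')" "digit A \<tau> 4 = f (Inr g)" "digit A \<tau> 5 = f (Inr g')"
        and r: "rule M (t = 0) (Suc t = R) (j = S) (S \<le> j \<and> j < S + P)
          (if S \<le> j then sy x (j - S) else 0) cl c cr c' g g'"
        unfolding allowed[OF \<tau>(1)] rule w by (elim bexE conjE) (rule that)
      have "cv t (j - 1) = cl"
        by (rule cvI[OF in_sets(1)]) (use eqs(1) d[of 0] w in \<open>simp add: scope_def\<close>)
      moreover have "cv t j = c"
        by (rule cvI[OF in_sets(2)]) (use eqs(2) d[of 1] w in \<open>simp add: scope_def\<close>)
      moreover have "cv t (if Suc j < W then Suc j else j) = cr"
        by (rule cvI[OF in_sets(3)]) (use eqs(3) d[of 2, unfolded scope_def w(2,3)] in simp)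
      moreover have "cv (Suc t) j = c'"
        by (rule cvI[OF in_sets(4)]) (use eqs(4) d[of 3] w in \<open>simp add: scope_def ac_simps\<close>)
      moreover have "gv t = g"
        by (rule gvI[OF in_sets(5)]) (use eqs(5) d[of 4] w in \<open>simp add: scope_def\<close>)
      moreover have "gv (Suc t) = g'"
        by (rule gvI[OF in_sets(6)]) (use eqs(6) d[of 5] w in \<open>simp add: scope_def ac_simps\<close>)
      ultimately show ?thesis using r in_sets by simp
    qed
    \<comment> \<open>No step starts in the last row; it is reached as the successor of row
      \<open>R - 1\<close>.\<close>
    have "cv t j \<in> columns M" if "t \<le> R" "j < W" for t j
      using step[of t j] step[of "t - 1" j] that R by (cases "t = R") auto
    moreover have "gv t \<in> globals M" if "t \<le> R" for t
      using step[of t 0] step[of "t - 1" 0] that R W0 by (cases "t = R") auto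
    moreover have "sat cv gv" unfolding sat_def using step by blast
    ultimately show "\<exists>cv gv. (\<forall>t\<le>R. gv t \<in> globals M \<and> (\<forall>j<W. cv t j \<in> columns M)) \<and> sat cv gv"
      by blast
  qed
qed

end

section \<open>Definability of the reduction\<close>

lemma definable_flags:
  assumes "definable_pred a" "definable_pred b" "definable_pred c" "definable_pred d" "definable s"
  shows "definable (\<lambda>x y E. flags (a x y E) (b x y E) (c x y E) (d x y E) (s x y E))"
  unfolding flags_def by (intro definable_intros assms)

lemma definable_info:
  assumes "definable P" "definable R" "definable S" "definable W" "definable w"
  shows "definable (\<lambda>x y E. info x (P x y E) (R x y E) (S x y E) (W x y E) (w x y E))"
  unfolding info_def by (intro definable_flags definable_intros assms)

lemma definable_scope:
  assumes "definable W" "definable w"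
  shows "definable (\<lambda>x y E. scope (W x y E) i (w x y E))"
  unfolding scope_def by (intro definable_intros assms)

lemma definable_pred_csp_cov:
  assumes "definable U" "definable W" "definable s" "definable e"
    and allowed: "\<And>w \<tau>. definable w \<Longrightarrow> definable \<tau> \<Longrightarrow> definable_pred (\<lambda>x y E. allowed x (w x y E) (\<tau> x y E))"
  shows "definable_pred (\<lambda>x y E. csp_cov (U x y E) A (scope (W x y E)) (allowed x) (s x y E) (e x y E))"
proof -
  \<comment> \<open>The quantifier is expanded because \<open>A ^ i\<close> is available as a
    constant only for a fixed exponent \<open>i\<close>.\<close>
  have ex6: "(\<exists>i<6. Q i) \<longleftrightarrow> Q 0 \<or> Q 1 \<or> Q 2 \<or> Q 3 \<or> Q 4 \<or> Q 5" for Q :: "nat \<Rightarrow> bool"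
    by (auto simp: less_Suc_eq numeral_eq_Suc)
  show ?thesis unfolding csp_cov_def ex6 digit_def
    by (intro definable_scope allowed definable_intros assms)
qed

lemma definable_pred_gadj_cover:
  assumes "definable n" "definable l" "definable p" "definable q"
    and cov: "\<And>s e. definable s \<Longrightarrow> definable e \<Longrightarrow> definable_pred (\<lambda>x y E. cov x (s x y E) (e x y E))"
  shows "definable_pred (\<lambda>x y E. gadj (n x y E) (cover_adj (l x y E) (cov x)) (p x y E) (q x y E))"
  unfolding gadj_def cover_adj_def by (intro definable_pred_leg cov definable_intros assms)

lemma accepts_iff_run:
  assumes "halts_within M ws T" "T \<le> R"
  shows "accepts M ws \<longleftrightarrow> fst (tm_run M ws R) = acc M"
proof
  assume "accepts M ws"
  then obtain t where t: "fst (tm_run M ws t) = acc M" by (auto simp: accepts_def)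
  show "fst (tm_run M ws R) = acc M"
  proof (cases "t \<le> R")
    case True
    then show ?thesis using tm_run_halted[of M ws t R] t by simp
  next
    case False
    have T: "fst (tm_run M ws T) \<in> {acc M, rej M}" using assms(1) by (simp add: halts_within_def)
    have "tm_run M ws t = tm_run M ws T" by (rule tm_run_halted[OF T]) (use False assms(2) in simp)
    moreover have "tm_run M ws R = tm_run M ws T" by (rule tm_run_halted[OF T assms(2)])
    ultimately show ?thesis using t by simp
  qed
qed (auto simp: accepts_def)

theorem NP_hard_semipaired: "NP_hard semipaired_domination_instances semipaired_domination_yes"
  unfolding NP_hard_def
proof (intro allI impI)
  fix L assume "in_NP L"
  then obtain M and p r :: "nat poly" where wf: "wf_tm M"
    and halts: "\<And>x y. length y \<le> poly p (length x) \<Longrightarrow> halts_within M [x, y] (poly r (length x))"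
    and L: "\<And>x. x \<in> L \<longleftrightarrow> (\<exists>y. length y \<le> poly p (length x) \<and> accepts M [x, y])"
    unfolding in_NP_def by blast
  let ?V = "Inl ` columns M \<union> Inr ` globals M :: (column + global) set"
  have "finite ?V" using finite_columns finite_globals by simp
  then obtain f where "bij_betw f ?V {0..<card ?V}" using ex_bij_betw_finite_nat by blast
  then have f: "inj_on f ?V" "f ` ?V \<subseteq> {..<card ?V + 2}" by (auto simp: bij_betw_def)
  \<comment> \<open>The additional 2 guarantees at least two values.\<close>
  define A where "A = card ?V + 2"
  define P where "P x = poly p (length x)" for x :: "bool list"
  \<comment> \<open>One more than the time bound, so that the tableau has a step even if the bound
    is 0.\<close>
  define R where "R x = poly r (length x) + 1" for x :: "bool list"
  define S where "S x = R x + P x + 1" for x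
  define W where "W x = 2 * S x + 1" for x
  define U where "U x = (R x + 1) * (W x + 1)" for x
  define allowed where "allowed x w \<tau> \<longleftrightarrow> info x (P x) (R x) (S x) (W x) w * A ^ 6 + \<tau> \<in> code_table M f A" for x w \<tau>
  define cov where "cov x = csp_cov (U x) A (scope (W x)) (allowed x)" for x
  define l where "l x = U x * A" for x
  define n where "n x = l x + (U x + R x * W x * A ^ 6)" for x
  define G where "G x = gp5_of (n x) (cover_adj (l x) (cov x))" for x
  define k where "k x = 2 * n x + U x" for x
  have tab: "tableau M (P x) (R x) (S x) (W x)" for x
    by unfold_locales (auto simp: wf R_def S_def W_def)
  have U: "tableau.U (R x) (W x) = U x" for x by (simp add: tableau.U_def[OF tab] U_def)
  have csp: "csp (U x) A (R x * W x) (scope (W x))" for x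
    using tableau.csp_tableau[OF tab, of A x] unfolding U by (simp add: A_def)
  have x_in_L: "x \<in> L \<longleftrightarrow> (\<exists>D. semipaired_dominating_set (G x) D \<and> card D \<le> k x)" for x
  proof -
    have "accepts M [x, y] \<longleftrightarrow> fst (tm_run M [x, y] (R x)) = acc M" if "length y \<le> P x" for y
      using accepts_iff_run[OF halts, of y x "R x"] that by (simp add: P_def R_def)
    then have "x \<in> L \<longleftrightarrow> (\<exists>y. length y \<le> P x \<and> fst (tm_run M [x, y] (R x)) = acc M)"
      unfolding L P_def by blast
    also have "\<dots> \<longleftrightarrow> (\<exists>val. csp.satisfies (U x) A (R x * W x) (scope (W x)) (allowed x) val)"
      using tableau.ex_code_values[OF tab f(1), of A x] f(2) unfolding U allowed_def by (simp add: A_def)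
    also have "\<dots> \<longleftrightarrow> (\<exists>D. semipaired_dominating_set (G x) D \<and> card D \<le> k x)"
      using csp.csp_iff[OF csp, of x "allowed x"] by (simp add: G_def k_def n_def l_def cov_def)
    finally show ?thesis .
  qed
  have inst: "gp5_instance (G x) (k x)" for x
  proof -
    have "gp5_graph (G x)"
      using csp.gp5_csp[OF csp, of x "allowed x"] by (simp add: G_def n_def l_def cov_def)
    moreover have "0 < k x" by (simp add: k_def U_def)
    ultimately show ?thesis unfolding gp5_instance_def by (auto simp: G_def)
  qed
  have defs: "definable (\<lambda>x y E. P x)" "definable (\<lambda>x y E. R x)"
    unfolding P_def R_def by (intro definable_intros)+
  then have defs': "definable (\<lambda>x y E. S x)" unfolding S_def by (intro definable_intros)
  then have defs'': "definable (\<lambda>x y E. W x)" unfolding W_def by (intro definable_intros)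
  then have dU: "definable (\<lambda>x y E. U x)" unfolding U_def by (intro definable_intros defs)
  then have dl: "definable (\<lambda>x y E. l x)" unfolding l_def by (intro definable_intros)
  then have dn: "definable (\<lambda>x y E. n x)" unfolding n_def by (intro definable_intros defs defs'' dU)
  have dk: "definable (\<lambda>x y E. k x)" unfolding k_def by (intro definable_intros dn dU)
  have dallowed: "definable_pred (\<lambda>x y E. allowed x (w x y E) (\<tau> x y E))" if "definable w" "definable \<tau>" for w \<tau>
    unfolding allowed_def
    by (intro definable_pred_finite[OF finite_code_table] definable_info definable_intros defs defs' defs'' that)
  have dcov: "definable_pred (\<lambda>x y E. cov x (s x y E) (e x y E))" if "definable s" "definable e" for s e
    unfolding cov_def by (intro definable_pred_csp_cov dallowed dU defs'' that)
  have "outp (\<lambda>x. encode (G x) (k x))"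
  proof (rule outp_encode[where N = "\<lambda>x. 6 * n x" and A = "\<lambda>x. gadj (n x) (cover_adj (l x) (cov x))"])
    show "definable (\<lambda>x y E. 6 * n x)" by (intro definable_intros dn)
    show "definable_pred (\<lambda>x y E. gadj (n x) (cover_adj (l x) (cov x)) (E 0) (E 1))"
      by (intro definable_pred_gadj_cover dcov dn dl definable_var)
  qed (simp_all add: G_def dk)
  then have "polytime_computable (\<lambda>x. encode (G x) (k x))" by (rule polytime_computable_outp)
  moreover have "encode (G x) (k x) \<in> semipaired_domination_instances" for x
    using inst unfolding semipaired_domination_instances_def by blast
  moreover have "x \<in> L \<longleftrightarrow> encode (G x) (k x) \<in> semipaired_domination_yes" for x
    unfolding x_in_L semipaired_domination_yes_def using inst encode_inject by (smt (verit) mem_Collect_eq)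
  ultimately show "\<exists>f. polytime_computable f \<and>
      (\<forall>x. f x \<in> semipaired_domination_instances \<and> (x \<in> L \<longleftrightarrow> f x \<in> semipaired_domination_yes))"
    by (intro exI[of _ "\<lambda>x. encode (G x) (k x)"]) blast
qed

theorem theorem4:
  shows "NP_complete semipaired_domination_instances semipaired_domination_yes"
  unfolding NP_complete_def
proof (intro conjI in_NP_semipaired NP_hard_semipaired)
  show "semipaired_domination_yes \<subseteq> semipaired_domination_instances"
    unfolding semipaired_domination_yes_def semipaired_domination_instances_def by blast
qed

end
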